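(* For every integer $k\geq 2$, let $$C_{2k+1}:\ f_{2k+1}=(y^{k-1}z+x^k)^2y-x^{2k+1}=0$$ in $\mathbb{P}^2$ over $\mathbb{C}$. Then $C_{2k+1}$ is a rational cuspidal curve of type $(2k+1,2k-1)$, it has two cusps, of type $(2k+1,2k-1)$ and $(2k+1,2)$ respectively, and it is a free divisor. The corresponding Jacobian ideal $J_{f_{2k+1}}$ is of linear type if and only if $k=2$. Moreover, $\tau(C_{2k+1})=3k^2$, $\mu(C_{2k+1})=2k(2k-1)$ and $d_1=d_2=k$.
   Context: Let $S=\mathbb{C}[x,y,z]$ with its standard grading. For a homogeneous $f\in S$ defining a reduced curve $C: f=0$ in $\mathbb{P}^2$, let $f_x,f_y,f_z$ be the partial derivatives and $J_f=(f_x,f_y,f_z)\subset S$ the Jacobian ideal. $AR(f)\subset S^3$ is the graded $S$-submodule of syzygies: $AR(f)_k$ consists of the triples $(a,b,c)$ with $a,b,c\in S_k$ and $af_x+bf_y+cf_z=0$. The curve $C$ is called free (a free divisor) if $AR(f)$ is a free graded $S$-module of rank two; in that case $d_1\leq d_2$ denote the degrees of the elements of a homogeneous basis of $AR(f)$. An ideal $J\subset S$ is of linear type if the canonical surjection from the symmetric algebra $\mathrm{Sym}_S(J)$ to the Rees algebra $\bigoplus_{n\geq 0}J^n$ is an isomorphism. $\tau(C)$ and $\mu(C)$ are the total Tjurina number and total Milnor number of $C$, i.e. the sums of the Tjurina (resp. Milnor) numbers of its singular points. A cusp of $C$ is a singular point $p$ at which the analytic germ $(C,p)$ is irreducible (unibranch);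 $C$ is rational cuspidal if it is an irreducible rational curve all of whose singular points are cusps. A cuspidal curve is of type $(d,m)$ if $d$ is its degree and $m$ is the maximal multiplicity of its singular points. A cusp is said to be of type $(a,b)$ (with $a,b$ coprime) if it has a unique Puiseux characteristic pair $(a,b)$, i.e. if it is topologically equivalent to the plane curve singularity $u^a+v^b=0$ at the origin. *)

theory Defs
  imports
    "HOL-Analysis.Analysis"
    "HOL-Algebra.Algebra"
    "HOL-Algebra.Algebraic_Closure_Type"
    "HOL-Computational_Algebra.Computational_Algebra"
    "HOL-Library.Poly_Mapping"
begin

section \<open>The polynomial ring $S$\<close>

text \<open>
  Polynomials in x, y, z are iterated univariate polynomials; the outermost variable is z and
  the innermost one is x, so the coefficient of $x^i y^j z^l$ in f is
  coeff (coeff (coeff f l) j) i.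
\<close>

type_synonym poly3 = "complex poly poly poly"

definition var_x :: poly3 where "var_x = [:[:[:0, 1:]:]:]"
definition var_y :: poly3 where "var_y = [:[:0, 1:]:]"
definition var_z :: poly3 where "var_z = [:0, 1:]"

definition homogeneous3 :: "nat \<Rightarrow> poly3 \<Rightarrow> bool" where
  "homogeneous3 d f \<longleftrightarrow>
     (\<forall>i j l. Polynomial.coeff (Polynomial.coeff (Polynomial.coeff f l) j) i \<noteq> 0 \<longrightarrow> i + j + l = d)"

definition dx :: "poly3 \<Rightarrow> poly3" where "dx f = map_poly (map_poly pderiv) f"
definition dy :: "poly3 \<Rightarrow> poly3" where "dy f = map_poly pderiv f"
definition dz :: "poly3 \<Rightarrow> poly3" where "dz f = pderiv f"

text \<open>
  The value f(a, b, c) in a commutative algebra whose structure map is \<open>\<iota>\<close>.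
\<close>

definition eval3 :: "(complex \<Rightarrow> 'a::comm_ring_1) \<Rightarrow> poly3 \<Rightarrow> 'a \<times> 'a \<times> 'a \<Rightarrow> 'a" where
  "eval3 \<iota> f = (\<lambda>(a, b, c).
     poly (map_poly (\<lambda>q. poly (map_poly (\<lambda>r. poly (map_poly \<iota> r) a) q) b) f) c)"

abbreviation value3 :: "poly3 \<Rightarrow> complex \<times> complex \<times> complex \<Rightarrow> complex" where
  "value3 \<equiv> eval3 (\<lambda>c. c)"

definition homogeneous2 :: "nat \<Rightarrow> complex poly poly \<Rightarrow> bool" where
  "homogeneous2 d f \<longleftrightarrow>
     (\<forall>i j. Polynomial.coeff (Polynomial.coeff f j) i \<noteq> 0 \<longrightarrow> i + j = d)"

definition value2 :: "complex poly poly \<Rightarrow> complex \<times> complex \<Rightarrow> complex" where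
  "value2 f = (\<lambda>(s, t). poly (poly f [:t:]) s)"


section \<open>Projective space and plane curves\<close>

text \<open>
  A point of the projective line or plane is represented by its unique vector of homogeneous
  coordinates whose last nonzero entry is 1.
\<close>

type_synonym point = "complex \<times> complex \<times> complex"

definition proj_line :: "(complex \<times> complex) set" where
  "proj_line = range (\<lambda>a. (a, 1)) \<union> {(1, 0)}"

definition proj_plane :: "point set" where
  "proj_plane = range (\<lambda>(a, b). (a, b, 1)) \<union> range (\<lambda>a. (a, 1, 0)) \<union> {(1, 0, 0)}"

definition same_point2 :: "complex \<times> complex \<Rightarrow> complex \<times> complex \<Rightarrow> bool" where
  "same_point2 v w \<longleftrightarrow> v \<noteq> (0, 0) \<and> w \<noteq> (0, 0) \<and>
     (\<exists>c. c \<noteq> 0 \<and> w = (c * fst v, c * snd v))"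

definition same_point3 :: "point \<Rightarrow> point \<Rightarrow> bool" where
  "same_point3 v w \<longleftrightarrow> v \<noteq> (0, 0, 0) \<and> w \<noteq> (0, 0, 0) \<and>
     (\<exists>c. c \<noteq> 0 \<and> w = (c * fst v, c * fst (snd v), c * snd (snd v)))"

lemma ex1_normalized_point:
  assumes "v \<noteq> (0, 0, 0)"
  shows "\<exists>!p. p \<in> proj_plane \<and> same_point3 p v"
proof -
  obtain a b c where v: "v = (a, b, c)" by (cases v)
  consider "c \<noteq> 0" | "c = 0" "b \<noteq> 0" | "c = 0" "b = 0" "a \<noteq> 0"
    using assms v by auto
  thus ?thesis
  proof cases
    case 1
    thus ?thesis unfolding v
      by (intro ex1I[of _ "(a / c, b / c, 1)"])
        (auto simp: proj_plane_def same_point3_def field_simps)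
  next
    case 2
    thus ?thesis unfolding v
      by (intro ex1I[of _ "(a / b, 1, 0)"])
        (auto simp: proj_plane_def same_point3_def field_simps)
  next
    case 3
    thus ?thesis unfolding v
      by (intro ex1I[of _ "(1, 0, 0)"])
        (auto simp: proj_plane_def same_point3_def field_simps)
  qed
qed

lemma ex1_normalized_point_line:
  assumes "v \<noteq> (0, 0)"
  shows "\<exists>!p. p \<in> proj_line \<and> same_point2 p v"
proof -
  obtain a b where v: "v = (a, b)" by (cases v)
  consider "b \<noteq> 0" | "b = 0" "a \<noteq> 0"
    using assms v by auto
  thus ?thesis
  proof cases
    case 1
    thus ?thesis unfolding v
      by (intro ex1I[of _ "(a / b, 1)"])
        (auto simp: proj_line_def same_point2_def field_simps)
  next
    case 2
    thus ?thesis unfolding v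
      by (intro ex1I[of _ "(1, 0)"])
        (auto simp: proj_line_def same_point2_def field_simps)
  qed
qed

definition curve_points :: "poly3 \<Rightarrow> point set" where
  "curve_points f = {p \<in> proj_plane. value3 f p = 0}"

definition singular_points :: "poly3 \<Rightarrow> point set" where
  "singular_points f = {p \<in> curve_points f.
     value3 (dx f) p = 0 \<and> value3 (dy f) p = 0 \<and> value3 (dz f) p = 0}"

text \<open>
  Rationality of an irreducible curve C: there are mutually inverse rational maps P from the
  projective line to C and Q from C to the projective line, each given by forms of a common
  degree.  As a nonempty Zariski open subset of an irreducible curve is the complement of a
  finite set, "generically" means "outside finitely many points".
\<close>

definition rational_curve :: "poly3 \<Rightarrow> bool" where
  "rational_curve f \<longleftrightarrow>
     (\<exists>m P0 P1 P2 n Q0 Q1.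
        homogeneous2 m P0 \<and> homogeneous2 m P1 \<and> homogeneous2 m P2 \<and>
        homogeneous3 n Q0 \<and> homogeneous3 n Q1 \<and>
        (let P = (\<lambda>w. (value2 P0 w, value2 P1 w, value2 P2 w));
             Q = (\<lambda>v. (value3 Q0 v, value3 Q1 v))
         in finite {w \<in> proj_line. \<not> (P w \<noteq> (0, 0, 0) \<and> value3 f (P w) = 0 \<and>
                                      same_point2 w (Q (P w)))} \<and>
            finite {v \<in> curve_points f. \<not> (Q v \<noteq> (0, 0) \<and> same_point3 v (P (Q v)))}))"


section \<open>Local equations and the ring of convergent power series\<close>

text \<open>
  Affine coordinates (u, v) centred at the normalized point p: the coordinate of p that is
  normalized to 1 is kept equal to 1, the other two are translated.
\<close>

definition affine_chart ::
    "(complex \<Rightarrow> 'a::comm_ring_1) \<Rightarrow> point \<Rightarrow> 'a \<Rightarrow> 'a \<Rightarrow> 'a \<times> 'a \<times> 'a" where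
  "affine_chart \<iota> = (\<lambda>(a, b, c) u v.
     if c \<noteq> 0 then (\<iota> a + u, \<iota> b + v, 1)
     else if b \<noteq> 0 then (\<iota> a + u, 1, v)
     else (1, u, v))"

text \<open>
  In the type complex fps fps of formal power series in u and v, the outer variable is u, so
  fps_nth (fps_nth g i) j is the coefficient of $u^i v^j$.
\<close>

type_synonym series2 = "complex fps fps"

definition const_series :: "complex \<Rightarrow> series2" where
  "const_series c = fps_const (fps_const c)"

definition deriv_u :: "series2 \<Rightarrow> series2" where
  "deriv_u g = fps_deriv g"

definition deriv_v :: "series2 \<Rightarrow> series2" where
  "deriv_v g = Abs_fps (\<lambda>i. fps_deriv (fps_nth g i))"

definition convergent_series :: "series2 \<Rightarrow> bool" where
  "convergent_series g \<longleftrightarrow>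
     (\<exists>r>0. (\<lambda>(i, j). norm (fps_nth (fps_nth g i) j) * r ^ (i + j)) summable_on UNIV)"

definition local_ring :: "series2 ring" where
  "local_ring = (ring_of_type_algebra :: series2 ring)\<lparr>carrier := {g. convergent_series g}\<rparr>"

definition local_equation :: "poly3 \<Rightarrow> point \<Rightarrow> series2" where
  "local_equation f p = eval3 const_series f (affine_chart const_series p fps_X (fps_const fps_X))"

definition multiplicity_at :: "poly3 \<Rightarrow> point \<Rightarrow> nat" where
  "multiplicity_at f p =
     (LEAST n. \<exists>i j. i + j = n \<and> fps_nth (fps_nth (local_equation f p) i) j \<noteq> 0)"

text \<open>
  The complex dimension of the quotient of the ring of convergent power series by the ideal
  generated by G; the scalars are embedded as classes of constant series.
\<close>

definition quotient_dim :: "series2 set \<Rightarrow> nat" where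
  "quotient_dim G =
     (let I = genideal local_ring G; A = local_ring Quot I
      in ring.dim A (range (\<lambda>c. I +>\<^bsub>local_ring\<^esub> const_series c)) (carrier A))"

definition milnor_number :: "poly3 \<Rightarrow> point \<Rightarrow> nat" where
  "milnor_number f p =
     (let g = local_equation f p in quotient_dim {deriv_u g, deriv_v g})"

definition tjurina_number :: "poly3 \<Rightarrow> point \<Rightarrow> nat" where
  "tjurina_number f p =
     (let g = local_equation f p in quotient_dim {g, deriv_u g, deriv_v g})"

definition total_milnor :: "poly3 \<Rightarrow> nat" where
  "total_milnor f = (\<Sum>p\<in>singular_points f. milnor_number f p)"

definition total_tjurina :: "poly3 \<Rightarrow> nat" where
  "total_tjurina f = (\<Sum>p\<in>singular_points f. tjurina_number f p)"


section \<open>Cusps\<close>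

text \<open>
  For a reduced curve, the analytic germ at p is irreducible if and only if its local equation
  (which is then a reduced equation of the germ) is irreducible as a convergent power series.
\<close>

definition is_cusp :: "poly3 \<Rightarrow> point \<Rightarrow> bool" where
  "is_cusp f p \<longleftrightarrow>
     p \<in> singular_points f \<and> ring_irreducible\<^bsub>local_ring\<^esub> (local_equation f p)"

definition rational_cuspidal :: "poly3 \<Rightarrow> bool" where
  "rational_cuspidal f \<longleftrightarrow>
     comm_semiring_1_class.irreducible f \<and> rational_curve f \<and>
     (\<forall>p\<in>singular_points f. is_cusp f p)"

definition cuspidal_type :: "poly3 \<Rightarrow> nat \<Rightarrow> nat \<Rightarrow> bool" where
  "cuspidal_type f d m \<longleftrightarrow>
     f \<noteq> 0 \<and> homogeneous3 d f \<and> singular_points f \<noteq> {} \<and> finite (singular_points f) \<and>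
     Max (multiplicity_at f ` singular_points f) = m"

text \<open>
  Topological equivalence at the origin of two subsets of the complex affine plane, as embedded
  germs.
\<close>

definition top_equivalent_germs :: "(complex \<times> complex) set \<Rightarrow> (complex \<times> complex) set \<Rightarrow> bool" where
  "top_equivalent_germs A B \<longleftrightarrow>
     (\<exists>U V h h'. open U \<and> open V \<and> (0, 0) \<in> U \<and> (0, 0) \<in> V \<and>
        homeomorphism U V h h' \<and> h (0, 0) = (0, 0) \<and> h ` (A \<inter> U) = B \<inter> V)"

definition cusp_of_type :: "poly3 \<Rightarrow> point \<Rightarrow> nat \<Rightarrow> nat \<Rightarrow> bool" where
  "cusp_of_type f p a b \<longleftrightarrow>
     is_cusp f p \<and> coprime a b \<and>
     top_equivalent_germs
       {(u, v). value3 f (affine_chart (\<lambda>c. c) p u v) = 0} {(u, v). u ^ a + v ^ b = 0}"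


section \<open>Jacobian syzygies and free curves\<close>

definition AR :: "poly3 \<Rightarrow> (poly3 \<times> poly3 \<times> poly3) set" where
  "AR f = {(a, b, c). a * dx f + b * dy f + c * dz f = 0}"

definition AR_deg :: "poly3 \<Rightarrow> nat \<Rightarrow> (poly3 \<times> poly3 \<times> poly3) set" where
  "AR_deg f k =
     {(a, b, c). (a, b, c) \<in> AR f \<and> homogeneous3 k a \<and> homogeneous3 k b \<and> homogeneous3 k c}"

definition smult_triple :: "poly3 \<Rightarrow> poly3 \<times> poly3 \<times> poly3 \<Rightarrow> poly3 \<times> poly3 \<times> poly3" where
  "smult_triple s = (\<lambda>(a, b, c). (s * a, s * b, s * c))"

definition free_with_exponents :: "poly3 \<Rightarrow> nat \<Rightarrow> nat \<Rightarrow> bool" where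
  "free_with_exponents f d1 d2 \<longleftrightarrow> d1 \<le> d2 \<and>
     (\<exists>r1 \<in> AR_deg f d1. \<exists>r2 \<in> AR_deg f d2.
        \<forall>r \<in> AR f. \<exists>!(s1, s2). r = smult_triple s1 r1 + smult_triple s2 r2)"

definition free_divisor :: "poly3 \<Rightarrow> bool" where
  "free_divisor f \<longleftrightarrow> (\<exists>d1 d2. free_with_exponents f d1 d2)"


section \<open>Ideals of linear type\<close>

abbreviation S_ring :: "poly3 ring" where
  "S_ring \<equiv> ring_of_type_algebra"

definition jacobian_ideal :: "poly3 \<Rightarrow> poly3 set" where
  "jacobian_ideal f = genideal S_ring {dx f, dy f, dz f}"

fun ideal_power :: "poly3 set \<Rightarrow> nat \<Rightarrow> poly3 set" where
  "ideal_power J 0 = carrier S_ring"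
| "ideal_power J (Suc n) = ideal_prod S_ring J (ideal_power J n)"

text \<open>
  The Rees algebra, as the subring of S[t] of the polynomials whose coefficient of $t^n$ lies
  in $J^n$.
\<close>

definition rees_algebra :: "poly3 set \<Rightarrow> poly3 poly ring" where
  "rees_algebra J = (ring_of_type_algebra :: poly3 poly ring)
     \<lparr>carrier := {p. \<forall>n. Polynomial.coeff p n \<in> ideal_power J n}\<rparr>"

text \<open>
  The symmetric algebra of the S-module J is the polynomial ring over S with one variable
  \<open>sym_var j\<close> for each element j of J, modulo the relations saying that \<open>sym_var\<close> is
  S-linear.
\<close>

type_synonym sym_poly = "(poly3 \<Rightarrow>\<^sub>0 nat) \<Rightarrow>\<^sub>0 poly3"

definition sym_const :: "poly3 \<Rightarrow> sym_poly" where
  "sym_const s = Poly_Mapping.single 0 s"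

definition sym_var :: "poly3 \<Rightarrow> sym_poly" where
  "sym_var j = Poly_Mapping.single (Poly_Mapping.single j 1) 1"

definition sym_poly_ring :: "poly3 set \<Rightarrow> sym_poly ring" where
  "sym_poly_ring J = (ring_of_type_algebra :: sym_poly ring)
     \<lparr>carrier := {p. \<forall>m \<in> Poly_Mapping.keys p. Poly_Mapping.keys m \<subseteq> J}\<rparr>"

definition sym_relations :: "poly3 set \<Rightarrow> sym_poly set" where
  "sym_relations J =
     {sym_var (a + b) - sym_var a - sym_var b | a b. a \<in> J \<and> b \<in> J} \<union>
     {sym_var (s * a) - sym_const s * sym_var a | s a. a \<in> J}"

definition sym_algebra :: "poly3 set \<Rightarrow> sym_poly set ring" where
  "sym_algebra J = sym_poly_ring J Quot genideal (sym_poly_ring J) (sym_relations J)"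

text \<open>
  The S-algebra homomorphism sending \<open>sym_var j\<close> to $j t$; the canonical surjection from the
  symmetric algebra to the Rees algebra is the map it induces on the quotient.
\<close>

definition sym_eval :: "sym_poly \<Rightarrow> poly3 poly" where
  "sym_eval p = (\<Sum>m \<in> Poly_Mapping.keys p.
     Polynomial.smult (Poly_Mapping.lookup p m)
       (\<Prod>j \<in> Poly_Mapping.keys m. Polynomial.monom j 1 ^ Poly_Mapping.lookup m j))"

definition sym_to_rees :: "sym_poly set \<Rightarrow> poly3 poly" where
  "sym_to_rees = (\<lambda>A. the_elem (sym_eval ` A))"

definition linear_type :: "poly3 set \<Rightarrow> bool" where
  "linear_type J \<longleftrightarrow> sym_to_rees \<in> ring_iso (sym_algebra J) (rees_algebra J)"


section \<open>The curves\<close>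

definition curve_C :: "nat \<Rightarrow> poly3" where
  "curve_C k =
     (var_y ^ (k - 1) * var_z + var_x ^ k) ^ 2 * var_y - var_x ^ (2 * k + 1)"

end

(*
  The partial derivatives of f are expressed through g = y^(k-1) z + x^k, and two explicit
  syzygies of degree k have a Hilbert-Burch determinant equal to f_x, f_y, f_z up to a constant;
  a divisibility argument shows that they generate AR(f).  The two cusps are parametrized by
  power series; their Milnor and Tjurina numbers come from standard bases, with respect to a
  weighted order, of the Jacobian and Tjurina ideals in the ring of convergent power series:
  the monomials below the staircase of leading monomials are a basis of the quotient.  The Jacobian ideal is of linear type iff
  every polynomial relation between the partial derivatives is a combination of the linear
  forms R1, R2 given by the two syzygies.  After multiplication by a power of y this always
  holds; for k = 2 the forms R1, R2 are coprime modulo y, so y can be cancelled, while for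
  k > 2 both forms lie in the ideal (x^(k-1), y^(k-2)) and the determinant of their
  coefficients is a relation that is not generated by them.
*)

theory Submission
  imports Defs
begin

section \<open>Homomorphisms, evaluations and derivations\<close>

text \<open>At (0, 0, 1) the Milnor and Tjurina numbers differ for k > 2, so no analytic change of
  coordinates leads to the model u^(2k+1) + v^(2k-1) = 0; a homeomorphism has to be built by hand,
  by extending the parameter of the branch continuously to a full neighbourhood of the origin. At
  (0, 1, 0) a polynomial change of coordinates is enough. Convergence shapes the standard basis
  argument: the cofactors of a representation are not controlled, so independence is proved for
  combinations with formal coefficients, while spanning uses that powers of both variables lie in
  the ideal, so that finitely many reductions suffice and every remainder converges. The symmetric
  algebra has one variable for every element of the Jacobian ideal; before any computation it is
  replaced by a polynomial ring in three variables modulo R1 and R2. Irreducibility of f is a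
  discriminant argument, f being quadratic in z.\<close>

locale comm_ring_hom =
  fixes \<phi> :: "'a::comm_ring_1 \<Rightarrow> 'b::comm_ring_1"
  assumes add: "\<phi> (a + b) = \<phi> a + \<phi> b"
    and mult: "\<phi> (a * b) = \<phi> a * \<phi> b"
    and one: "\<phi> 1 = 1"
begin

lemma zero: "\<phi> 0 = 0"
  using add[of 0 0] by simp

lemma uminus: "\<phi> (- a) = - \<phi> a"
  using add[of a "- a"] zero by (simp add: add_eq_0_iff)

lemma diff: "\<phi> (a - b) = \<phi> a - \<phi> b"
  using add[of a "- b"] uminus by simp

lemma power: "\<phi> (a ^ n) = \<phi> a ^ n"
  by (induction n) (simp_all add: one mult)

lemma sum: "\<phi> (sum f A) = (\<Sum>i\<in>A. \<phi> (f i))"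
  by (induction A rule: infinite_finite_induct) (simp_all add: zero add)

lemma prod: "\<phi> (prod f A) = (\<Prod>i\<in>A. \<phi> (f i))"
  by (induction A rule: infinite_finite_induct) (simp_all add: one mult)

lemma of_nat: "\<phi> (of_nat n) = of_nat n"
  by (induction n) (simp_all add: zero one add)

lemma numeral: "\<phi> (numeral n) = numeral n"
  using of_nat[of "numeral n"] by simp

lemmas simps = add mult one zero uminus diff power sum prod of_nat numeral

text \<open>The universal property of a polynomial ring in one variable. Iterated three times it
  covers \<open>eval3\<close> and \<open>spoly_eval\<close>, which are nested evaluations of this
  form.\<close>

lemma comm_ring_hom_poly: "comm_ring_hom (\<lambda>p. poly (map_poly \<phi> p) a)"
proof
  show p_add: "poly (map_poly \<phi> (p + q)) a = poly (map_poly \<phi> p) a + poly (map_poly \<phi> q) a" for p q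
    by (subst poly_add[symmetric], rule arg_cong[where f = "\<lambda>p. poly p a"])
       (simp add: poly_eq_iff coeff_map_poly zero add)
  have p_smult: "poly (map_poly \<phi> (Polynomial.smult c p)) a = \<phi> c * poly (map_poly \<phi> p) a" for c p
    by (subst poly_smult[symmetric], rule arg_cong[where f = "\<lambda>p. poly p a"])
       (simp add: poly_eq_iff coeff_map_poly zero mult)
  show "poly (map_poly \<phi> (p * q)) a = poly (map_poly \<phi> p) a * poly (map_poly \<phi> q) a" for p q
    by (induction p) (simp_all add: map_poly_pCons zero p_add p_smult algebra_simps)
  show "poly (map_poly \<phi> 1) a = 1"
    by (simp add: one)
qed

end

lemma comm_ring_hom_id: "comm_ring_hom (\<lambda>x. x)"
  by unfold_locales simp_all

lemma comm_ring_hom_compose: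
  assumes "comm_ring_hom \<phi>" "comm_ring_hom \<psi>"
  shows "comm_ring_hom (\<lambda>x. \<psi> (\<phi> x))"
proof -
  interpret \<phi>: comm_ring_hom \<phi> by fact
  interpret \<psi>: comm_ring_hom \<psi> by fact
  show ?thesis by unfold_locales (simp_all add: \<phi>.simps \<psi>.simps)
qed

lemma comm_ring_hom_eval3:
  assumes "comm_ring_hom \<iota>"
  shows "comm_ring_hom (\<lambda>f. eval3 \<iota> f p)"
proof -
  obtain a b c where p: "p = (a, b, c)" by (cases p)
  show ?thesis
    unfolding p eval3_def prod.case
    by (intro comm_ring_hom.comm_ring_hom_poly assms)
qed

abbreviation const3 :: "complex \<Rightarrow> poly3" where "const3 c \<equiv> [:[:[:c:]:]:]"

lemma eval3_vars:
  assumes "comm_ring_hom \<iota>"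
  shows "eval3 \<iota> var_x (a, b, c) = a" "eval3 \<iota> var_y (a, b, c) = b"
    "eval3 \<iota> var_z (a, b, c) = c" "eval3 \<iota> (const3 s) (a, b, c) = \<iota> s"
proof -
  interpret comm_ring_hom \<iota> by fact
  show "eval3 \<iota> var_x (a, b, c) = a" "eval3 \<iota> var_y (a, b, c) = b"
    "eval3 \<iota> var_z (a, b, c) = c" "eval3 \<iota> (const3 s) (a, b, c) = \<iota> s"
    by (simp_all add: eval3_def var_x_def var_y_def var_z_def map_poly_pCons simps)
qed

text \<open>The sum runs to the degree of \<open>p\<close>, since \<open>map_poly \<phi> p\<close>
  may have smaller degree; the additional terms vanish.\<close>

lemma poly_hom_expand:
  assumes "comm_ring_hom \<phi>"
  shows "poly (map_poly \<phi> p) a = (\<Sum>i\<le>Polynomial.degree p. \<phi> (Polynomial.coeff p i) * a ^ i)"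
proof -
  interpret comm_ring_hom \<phi> by fact
  have "poly (map_poly \<phi> p) a = (\<Sum>i\<le>Polynomial.degree p. Polynomial.coeff (map_poly \<phi> p) i * a ^ i)"
    unfolding poly_altdef by (intro sum.mono_neutral_left) (auto simp: map_poly_degree_leq coeff_eq_0)
  then show ?thesis by (simp add: coeff_map_poly zero)
qed

lemma eval3_expand:
  assumes "comm_ring_hom \<iota>"
  shows "eval3 \<iota> f (a, b, c) =
    (\<Sum>l\<le>Polynomial.degree f. \<Sum>j\<le>Polynomial.degree (Polynomial.coeff f l).
      \<Sum>i\<le>Polynomial.degree (Polynomial.coeff (Polynomial.coeff f l) j).
      \<iota> (Polynomial.coeff (Polynomial.coeff (Polynomial.coeff f l) j) i) * a ^ i * b ^ j * c ^ l)"
proof -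
  note h1 = comm_ring_hom.comm_ring_hom_poly[OF assms, of a]
  note h2 = comm_ring_hom.comm_ring_hom_poly[OF h1, of b]
  show ?thesis
    unfolding eval3_def prod.case
    unfolding poly_hom_expand[OF h2]
    unfolding poly_hom_expand[OF h1]
    by (simp add: poly_hom_expand[OF assms] sum_distrib_right)
qed

text \<open>The scalar t lives in the target ring, so it can be a polynomial variable; degrees of
  syzygies are later compared on lines through the origin in this way.\<close>

lemma eval3_homogeneous:
  assumes "comm_ring_hom \<iota>" "homogeneous3 d f"
  shows "eval3 \<iota> f (t * a, t * b, t * c) = t ^ d * eval3 \<iota> f (a, b, c)"
proof -
  interpret comm_ring_hom \<iota> by fact
  have *: "\<iota> (Polynomial.coeff (Polynomial.coeff (Polynomial.coeff f l) j) i) * (t * a) ^ i * (t * b) ^ j * (t * c) ^ l =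
        t ^ d * (\<iota> (Polynomial.coeff (Polynomial.coeff (Polynomial.coeff f l) j) i) * a ^ i * b ^ j * c ^ l)" for i j l
  proof (cases "Polynomial.coeff (Polynomial.coeff (Polynomial.coeff f l) j) i = 0")
    case False
    then have d: "d = i + j + l" using assms(2) by (auto simp: homogeneous3_def)
    show ?thesis unfolding d by (simp add: power_mult_distrib power_add mult_ac)
  qed (simp add: zero)
  show ?thesis
    unfolding eval3_expand[OF assms(1)] * by (simp only: sum_distrib_left)
qed

text \<open>Serves both the partial derivatives of polynomials and those of power series in two
  variables.\<close>

locale derivation =
  fixes D :: "'a::comm_ring_1 \<Rightarrow> 'a"
  assumes add: "D (a + b) = D a + D b"
    and mult: "D (a * b) = D a * b + a * D b"
begin

lemma zero: "D 0 = 0"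
  using add[of 0 0] by simp

lemma uminus: "D (- a) = - D a"
  using add[of a "- a"] zero by (simp add: add_eq_0_iff)

lemma diff: "D (a - b) = D a - D b"
  using add[of a "- b"] uminus by simp

lemma one: "D 1 = 0"
  using mult[of 1 1] by simp

lemma power: "D (a ^ n) = of_nat n * a ^ (n - 1) * D a"
proof (induction n)
  case (Suc n)
  have "a * (of_nat n * a ^ (n - 1) * D a) = of_nat n * a ^ n * D a"
    by (cases n) (simp_all add: algebra_simps)
  then show ?case by (simp add: mult Suc algebra_simps)
qed (simp add: one)

lemmas simps = add mult zero uminus diff one power

lemma map_poly_derivation: "derivation (map_poly D)"
proof
  show m_add: "map_poly D (p + q) = map_poly D p + map_poly D q" for p q
    by (simp add: poly_eq_iff coeff_map_poly zero add)
  have m_smult: "map_poly D (Polynomial.smult c p) =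
      Polynomial.smult (D c) p + Polynomial.smult c (map_poly D p)" for c p
    by (simp add: poly_eq_iff coeff_map_poly zero mult)
  show "map_poly D (p * q) = map_poly D p * q + p * map_poly D q" for p q
    by (induction p) (simp_all add: map_poly_pCons zero m_add m_smult algebra_simps)
qed

end

lemma derivation_pderiv: "derivation (pderiv :: 'a::idom poly \<Rightarrow> 'a poly)"
  by unfold_locales (simp_all add: pderiv_add pderiv_mult algebra_simps)

interpretation dz: derivation dz
  unfolding dz_def[abs_def] by (rule derivation_pderiv)

interpretation dy: derivation dy
  unfolding dy_def[abs_def] by (intro derivation.map_poly_derivation derivation_pderiv)

interpretation dx: derivation dx
  unfolding dx_def[abs_def] by (intro derivation.map_poly_derivation derivation_pderiv)

lemma partial_vars [simp]:
  "dx var_x = 1" "dx var_y = 0" "dx var_z = 0"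
  "dy var_x = 0" "dy var_y = 1" "dy var_z = 0"
  "dz var_x = 0" "dz var_y = 0" "dz var_z = 1"
  by (simp_all add: dx_def dy_def dz_def var_x_def var_y_def var_z_def map_poly_pCons pderiv_pCons
      one_pCons)

section \<open>Homogeneous polynomials\<close>

lemma homogeneous3_add:
  assumes "homogeneous3 d f" "homogeneous3 d g"
  shows "homogeneous3 d (f + g)"
  using assms unfolding homogeneous3_def by (metis add_0 coeff_add)

lemma homogeneous3_uminus: "homogeneous3 d f \<Longrightarrow> homogeneous3 d (- f)"
  by (simp add: homogeneous3_def)

lemma homogeneous3_diff:
  assumes "homogeneous3 d f" "homogeneous3 d g"
  shows "homogeneous3 d (f - g)"
  using homogeneous3_add[OF assms(1) homogeneous3_uminus[OF assms(2)]] by simp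

lemma homogeneous3_mult:
  assumes "homogeneous3 d f" "homogeneous3 e g"
  shows "homogeneous3 (d + e) (f * g)"
  unfolding homogeneous3_def
proof (intro allI impI)
  fix i j l
  assume nz: "Polynomial.coeff (Polynomial.coeff (Polynomial.coeff (f * g) l) j) i \<noteq> 0"
  let ?F = "\<lambda>i j l. Polynomial.coeff (Polynomial.coeff (Polynomial.coeff f l) j) i"
  let ?G = "\<lambda>i j l. Polynomial.coeff (Polynomial.coeff (Polynomial.coeff g l) j) i"
  have "Polynomial.coeff (Polynomial.coeff (Polynomial.coeff (f * g) l) j) i =
      (\<Sum>l'\<le>l. \<Sum>j'\<le>j. \<Sum>i'\<le>i. ?F i' j' l' * ?G (i - i') (j - j') (l - l'))"
    by (simp add: coeff_mult coeff_sum)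
  with nz obtain l' j' i' where le: "l' \<le> l" "j' \<le> j" "i' \<le> i"
    and "?F i' j' l' * ?G (i - i') (j - j') (l - l') \<noteq> 0"
    by (metis (no_types, lifting) sum.not_neutral_contains_not_neutral atMost_iff)
  then have "?F i' j' l' \<noteq> 0" "?G (i - i') (j - j') (l - l') \<noteq> 0" by simp_all
  then have "i' + j' + l' = d" "(i - i') + (j - j') + (l - l') = e"
    using assms unfolding homogeneous3_def by blast+
  with le show "i + j + l = d + e" by linarith
qed

lemma homogeneous3_const: "homogeneous3 0 (const3 c)"
  by (auto simp: homogeneous3_def coeff_pCons split: nat.splits)

lemma homogeneous3_one: "homogeneous3 0 1"
  using homogeneous3_const[of 1] by (simp flip: one_pCons)

lemma homogeneous3_power: "homogeneous3 d f \<Longrightarrow> homogeneous3 (n * d) (f ^ n)"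
  by (induction n) (simp_all add: homogeneous3_one homogeneous3_mult)

lemma homogeneous3_vars:
  "homogeneous3 1 var_x" "homogeneous3 1 var_y" "homogeneous3 1 var_z"
  by (auto simp: homogeneous3_def var_x_def var_y_def var_z_def coeff_pCons
      split: nat.splits)

lemma homogeneous3_var_power:
  "homogeneous3 n (var_x ^ n)" "homogeneous3 n (var_y ^ n)" "homogeneous3 n (var_z ^ n)"
  using homogeneous3_vars[THEN homogeneous3_power, of n] by simp_all

lemma of_nat_const3: "of_nat n = const3 (of_nat n)"
  by (simp add: of_nat_poly)

lemma homogeneous3_of_nat_mult: "homogeneous3 d f \<Longrightarrow> homogeneous3 d (of_nat n * f)"
  using homogeneous3_mult[OF homogeneous3_const[of "of_nat n"]] unfolding of_nat_const3 by fastforce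

lemma homogeneous3_const_mult: "homogeneous3 d f \<Longrightarrow> homogeneous3 d (const3 c * f)"
  using homogeneous3_mult[OF homogeneous3_const[of c]] by fastforce

section \<open>The curve and its partial derivatives\<close>

text \<open>
  In terms of $g = y^{k-1} z + x^k$ the partial derivatives are $f_x = x^{k-1} Q$, $f_y = g L$
  and $f_z = 2 g y^k$.
\<close>

definition curve_g :: "nat \<Rightarrow> poly3" where
  "curve_g k = var_y ^ (k - 1) * var_z + var_x ^ k"

definition curve_Q :: "nat \<Rightarrow> poly3" where
  "curve_Q k = of_nat (2 * k) * curve_g k * var_y - of_nat (2 * k + 1) * var_x ^ (k + 1)"

definition curve_L :: "nat \<Rightarrow> poly3" where
  "curve_L k = of_nat (2 * k - 1) * var_y ^ (k - 1) * var_z + var_x ^ k"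

lemma curve_C_g: "curve_C k = curve_g k ^ 2 * var_y - var_x ^ (2 * k + 1)"
  by (simp add: curve_C_def curve_g_def)

context
  fixes k :: nat
  assumes k: "k \<ge> 2"
begin

lemma dx_curve_C: "dx (curve_C k) = var_x ^ (k - 1) * curve_Q k"
proof -
  have e: "var_x ^ (2 * k) = var_x ^ (k - 1) * var_x ^ (k + 1)"
  proof -
    have "2 * k = (k - 1) + (k + 1)" using k by simp
    then show ?thesis by (simp only: power_add)
  qed
  have "dx (curve_g k) = of_nat k * var_x ^ (k - 1)"
    by (simp add: curve_g_def dx.simps)
  then have "dx (curve_C k) =
      2 * curve_g k * (of_nat k * var_x ^ (k - 1)) * var_y - of_nat (2 * k + 1) * var_x ^ (2 * k)"
    unfolding curve_C_g dx.simps by simp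
  then show ?thesis
    unfolding curve_Q_def e by (simp add: algebra_simps)
qed

lemma dy_curve_C: "dy (curve_C k) = curve_g k * curve_L k"
proof -
  obtain n where n: "k = n + 2" using k by (metis add.commute le_Suc_ex)
  \<comment> \<open>The product rule gives f_y = g (g + 2 y g_y), and L is this bracket, with g_y =
    (k-1) y^(k-2) z.\<close>
  have L: "curve_L k = curve_g k + 2 * (of_nat (n + 1) * var_y ^ n * var_z) * var_y"
  proof -
    have "2 * k - 1 = 1 + 2 * (n + 1)" "var_y ^ (k - 1) = var_y * var_y ^ n"
      by (simp_all add: n)
    then show ?thesis
      unfolding curve_L_def curve_g_def by (simp only: of_nat_add of_nat_mult) (simp add: algebra_simps)
  qed
  have "dy (curve_g k) = of_nat (n + 1) * var_y ^ n * var_z"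
    unfolding curve_g_def dy.simps by (simp add: n)
  then have "dy (curve_C k) =
      2 * curve_g k * (of_nat (n + 1) * var_y ^ n * var_z) * var_y + curve_g k ^ 2"
    unfolding curve_C_g dy.simps by simp
  then show ?thesis
    unfolding L power2_eq_square by (simp only: distrib_left) (simp add: mult_ac)
qed

lemma dz_curve_C: "dz (curve_C k) = 2 * curve_g k * var_y ^ k"
proof -
  have e: "var_y ^ k = var_y * var_y ^ (k - 1)"
    using k by (simp flip: power_Suc)
  have d: "dz (curve_g k) = var_y ^ (k - 1)"
    by (simp add: curve_g_def dz.simps)
  show ?thesis
    unfolding curve_C_g dz.simps d e by (simp add: algebra_simps)
qed

lemma homogeneous_curve_g: "homogeneous3 k (curve_g k)"
proof -
  have "homogeneous3 ((k - 1) + 1) (var_y ^ (k - 1) * var_z)"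
    by (intro homogeneous3_mult homogeneous3_var_power homogeneous3_vars)
  then show ?thesis
    using k unfolding curve_g_def by (intro homogeneous3_add homogeneous3_var_power) simp_all
qed

lemma homogeneous_curve_C: "homogeneous3 (2 * k + 1) (curve_C k)"
  unfolding curve_C_g
  by (intro homogeneous3_diff homogeneous3_mult homogeneous3_power homogeneous_curve_g
      homogeneous3_vars homogeneous3_var_power)

end

section \<open>Values at points and the singular locus\<close>

interpretation value3: comm_ring_hom "\<lambda>f. value3 f p" for p
  by (intro comm_ring_hom_eval3 comm_ring_hom_id)

lemmas value3_vars = eval3_vars[OF comm_ring_hom_id]

lemma value3_curve_g: "value3 (curve_g k) (a, b, c) = b ^ (k - 1) * c + a ^ k"
  by (simp add: curve_g_def value3.simps value3_vars)

lemma value3_curve_C: "value3 (curve_C k) (a, b, c) = (b ^ (k - 1) * c + a ^ k) ^ 2 * b - a ^ (2 * k + 1)"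
  by (simp add: curve_C_g value3.simps value3_vars value3_curve_g)

lemma proj_plane_iff: "(a, b, c) \<in> proj_plane \<longleftrightarrow> c = 1 \<or> c = 0 \<and> b = 1 \<or> c = 0 \<and> b = 0 \<and> a = 1"
  by (auto simp add: proj_plane_def image_iff)

text \<open>If f_z = 2 G b^k vanishes then G^2 b = 0, so f = 0 forces a = 0. Then G = b^(k-1) c, and
  its vanishing leaves two normalized points.\<close>

lemma singular_points_curve_C:
  assumes "k \<ge> 2"
  shows "singular_points (curve_C k) = {(0, 0, 1), (0, 1, 0)}"
proof -
  have *: "(a, b, c) \<in> singular_points (curve_C k) \<longleftrightarrow> (a, b, c) \<in> proj_plane \<and> a = 0 \<and> (b = 0 \<or> c = 0)"
    for a b c
  proof -
    define G where "G = b ^ (k - 1) * c + a ^ k"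
    have "(a, b, c) \<in> singular_points (curve_C k) \<longleftrightarrow> (a, b, c) \<in> proj_plane \<and>
        G ^ 2 * b - a ^ (2 * k + 1) = 0 \<and>
        a ^ (k - 1) * (of_nat (2 * k) * G * b - of_nat (2 * k + 1) * a ^ (k + 1)) = 0 \<and>
        G * (of_nat (2 * k - 1) * b ^ (k - 1) * c + a ^ k) = 0 \<and> 2 * G * b ^ k = 0"
      unfolding singular_points_def curve_points_def dx_curve_C[OF assms] dy_curve_C[OF assms]
        dz_curve_C[OF assms] curve_Q_def curve_L_def value3.simps value3_curve_C value3_curve_g
        value3_vars mem_Collect_eq G_def
      by (simp only: conj_assoc)
    also have "\<dots> \<longleftrightarrow> (a, b, c) \<in> proj_plane \<and> a = 0 \<and> (b = 0 \<or> c = 0)"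
    proof (cases "a = 0")
      case True
      then have G: "G = b ^ (k - 1) * c" and z: "a ^ (k - 1) = 0" "a ^ (2 * k + 1) = 0" "a ^ k = 0"
        using assms by (simp_all add: G_def)
      have "G = 0 \<longleftrightarrow> b = 0 \<or> c = 0" using G assms by simp
      then show ?thesis unfolding z using True by (cases "G = 0") simp_all
    next
      case False
      then have "a ^ (2 * k + 1) \<noteq> 0" by simp
      moreover have "G ^ 2 * b = 0" if "2 * G * b ^ k = 0"
        using that by (cases "G = 0") simp_all
      ultimately have "\<not> (G ^ 2 * b - a ^ (2 * k + 1) = 0 \<and> 2 * G * b ^ k = 0)"
        by auto
      with False show ?thesis by blast
    qed
    finally show ?thesis .
  qed
  have "p \<in> singular_points (curve_C k) \<longleftrightarrow> p = (0, 0, 1) \<or> p = (0, 1, 0)" for p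
  proof -
    obtain a b c where p: "p = (a, b, c)" by (cases p)
    have pair: "(a, b, c) = (0, 0, 1) \<longleftrightarrow> a = 0 \<and> b = 0 \<and> c = 1"
      "(a, b, c) = (0, 1, 0) \<longleftrightarrow> a = 0 \<and> b = 1 \<and> c = 0" by auto
    show ?thesis
      unfolding p pair * proj_plane_iff by (cases "b = 0"; cases "c = 0"; cases "a = 0") simp_all
  qed
  then show ?thesis by blast
qed

section \<open>Freeness\<close>

text \<open>Only p is prime. It is applied to q = g and q = Q, whose primality is never established:
  as p does not divide q, the power of p passes to the cofactor h and can be cancelled.\<close>

lemma dvd_cancel_prime_power:
  fixes p :: "'a::algebraic_semidom"
  assumes p: "prime_elem p" "\<not> p dvd q" and dvd: "q dvd a * p ^ n"
  shows "q dvd a"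
proof -
  obtain h where h: "a * p ^ n = q * h" using dvd ..
  then have "p ^ n dvd h * q" by (metis dvd_triv_right mult.commute)
  then have "p ^ n dvd h \<or> p ^ 1 dvd q"
    by (rule prime_elem_power_dvd_cases) (simp_all add: p(1))
  then obtain h' where "h = p ^ n * h'" using p(2) by auto
  with h have "p ^ n * a = p ^ n * (q * h')" by (simp add: mult_ac)
  moreover have "p ^ n \<noteq> 0" using p(1) by (simp add: prime_elem_not_zeroI)
  ultimately show ?thesis by (metis dvd_triv_left mult_left_cancel)
qed

lemma hom_eval3:
  assumes "comm_ring_hom \<iota>" "comm_ring_hom \<psi>"
  shows "\<psi> (eval3 \<iota> f (a, b, c)) = eval3 (\<lambda>s. \<psi> (\<iota> s)) f (\<psi> a, \<psi> b, \<psi> c)"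
proof -
  interpret \<psi>: comm_ring_hom \<psi> by fact
  show ?thesis
    unfolding eval3_expand[OF assms(1)] eval3_expand[OF comm_ring_hom_compose[OF assms]]
    by (simp only: \<psi>.simps)
qed

lemma const3_inverse_mult:
  assumes "c \<noteq> 0"
  shows "const3 (inverse c) * (const3 c * h) = h"
proof -
  have "const3 (inverse c) * const3 c = 1" using assms by (simp add: one_pCons)
  then show ?thesis by (simp only: mult.assoc[symmetric] mult_1_left)
qed

lemma prime_elem_var_x: "prime_elem var_x"
  unfolding var_x_def by (intro lift_prime_elem_poly prime_elem_linear_field_poly) simp

lemma prime_elem_var_y: "prime_elem var_y"
  unfolding var_y_def by (intro lift_prime_elem_poly prime_elem_linear_poly) simp_all

text \<open>Chosen so that x^(k-1) Q + b L is a multiple of y^k: the first bracket is the conjugate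
  of L, whose product with L has no mixed term, and the last summand removes x^(2k-1) y.\<close>

definition syz_b :: "nat \<Rightarrow> poly3" where
  "syz_b k = of_nat (2 * k + 1) * (var_x ^ k - of_nat (2 * k - 1) * var_y ^ (k - 1) * var_z)
    - of_nat (2 * k) * var_x ^ (k - 1) * var_y"

text \<open>The remainder of x^(k-1) Q + b L contains (2k+1) (2k-1)^2 y^(2k-2) z^2 with a minus
  sign; the division by 2 compensates for the factor 2 in f_z.\<close>

definition syz_kappa :: "nat \<Rightarrow> complex" where
  "syz_kappa k = of_nat ((2 * k + 1) * (2 * k - 1) ^ 2) / 2"

definition syz_c :: "nat \<Rightarrow> poly3" where
  "syz_c k = of_nat (2 * k * (k - 1)) * var_x ^ (k - 1) * var_z
    + const3 (syz_kappa k) * var_y ^ (k - 2) * var_z ^ 2"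

text \<open>The Koszul relation between f_y = g L and f_z = 2 g y^k, divided by their common factor
  g.\<close>

definition syz1 :: "nat \<Rightarrow> poly3 \<times> poly3 \<times> poly3" where
  "syz1 k = (0, 2 * var_y ^ k, - curve_L k)"

text \<open>The first entry is the smallest possible one: g divides f_y and f_z and has no common
  factor with f_x, hence it divides the first entry of every syzygy.\<close>

definition syz2 :: "nat \<Rightarrow> poly3 \<times> poly3 \<times> poly3" where
  "syz2 k = (curve_g k, syz_b k, syz_c k)"

lemma AR_curve_C:
  assumes "k \<ge> 2"
  shows "(a, b, c) \<in> AR (curve_C k) \<longleftrightarrow>
    a * (var_x ^ (k - 1) * curve_Q k) + curve_g k * (b * curve_L k + 2 * c * var_y ^ k) = 0"
  by (simp add: AR_def dx_curve_C dy_curve_C dz_curve_C assms algebra_simps)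

lemma smult_triple_add:
  "smult_triple s r1 + smult_triple t r2 =
    (s * fst r1 + t * fst r2, s * fst (snd r1) + t * fst (snd r2), s * snd (snd r1) + t * snd (snd r2))"
  by (simp add: smult_triple_def split_beta)

context
  fixes k :: nat
  assumes k: "k \<ge> 2"
begin

lemma syz2_eq: "var_x ^ (k - 1) * curve_Q k + syz_b k * curve_L k + 2 * syz_c k * var_y ^ k = 0"
proof -
  obtain n where n: "k = n + 2" using k by (metis add.commute le_Suc_ex)
  define m :: poly3 where "m = of_nat n"
  define w where "w = const3 (syz_kappa k)"
  define x where "x = var_x ^ (n + 1)"
  define y where "y = var_y ^ n"
  have p: "var_x ^ (k - 1) = x" "var_x ^ k = var_x * x" "var_x ^ (k + 1) = var_x * var_x * x"
    "var_y ^ (k - 1) = var_y * y" "var_y ^ k = var_y * var_y * y" "var_y ^ (k - 2) = y"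
    by (simp_all add: n x_def y_def)
  \<comment> \<open>Only twice \<open>syz_kappa k\<close> enters the identity, so after clearing the
    denominator it is an identity with integer coefficients.\<close>
  have "2 * w = of_nat ((2 * k + 1) * (2 * k - 1) ^ 2)"
    unfolding w_def of_nat_const3 by (simp add: syz_kappa_def numeral_poly)
  also have "\<dots> = (2 * m + 5) * (2 * m + 3) ^ 2"
    by (simp add: n m_def power2_eq_square algebra_simps)
  finally have w: "2 * w = (2 * m + 5) * (2 * m + 3) ^ 2" .
  have c: "of_nat (2 * k) = 2 * m + 4" "of_nat (2 * k + 1) = 2 * m + 5"
    "of_nat (2 * k - 1) = 2 * m + 3" "of_nat (2 * k * (k - 1)) = (2 * m + 4) * (m + 1)"
    by (simp_all add: n m_def algebra_simps)
  have "2 * syz_c k = 2 * ((2 * m + 4) * (m + 1)) * x * var_z + (2 * w) * y * var_z ^ 2"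
    unfolding syz_c_def p c w_def[symmetric] by (simp add: algebra_simps)
  then have c': "2 * syz_c k = 2 * ((2 * m + 4) * (m + 1)) * x * var_z + (2 * m + 5) * (2 * m + 3) ^ 2 * y * var_z ^ 2"
    unfolding w .
  show ?thesis
    unfolding c' unfolding curve_Q_def curve_L_def syz_b_def curve_g_def p c
    by (simp add: algebra_simps power2_eq_square)
qed

lemma syz_in_AR: "syz1 k \<in> AR (curve_C k)" "syz2 k \<in> AR (curve_C k)"
proof -
  show "syz1 k \<in> AR (curve_C k)"
    unfolding syz1_def AR_curve_C[OF k] by (simp add: algebra_simps)
  have "curve_g k * (var_x ^ (k - 1) * curve_Q k + syz_b k * curve_L k + 2 * syz_c k * var_y ^ k) = 0"
    unfolding syz2_eq by simp
  then show "syz2 k \<in> AR (curve_C k)"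
    unfolding syz2_def AR_curve_C[OF k] by (simp add: algebra_simps)
qed

lemma syz_in_AR_deg: "syz1 k \<in> AR_deg (curve_C k) k" "syz2 k \<in> AR_deg (curve_C k) k"
proof -
  have yz: "homogeneous3 k (var_y ^ (k - 1) * var_z)" and xz: "homogeneous3 k (var_x ^ (k - 1) * var_z)"
    and xy: "homogeneous3 k (var_x ^ (k - 1) * var_y)" 
    using homogeneous3_mult[OF homogeneous3_var_power(2)[of "k - 1"] homogeneous3_vars(3)]
      homogeneous3_mult[OF homogeneous3_var_power(1)[of "k - 1"] homogeneous3_vars(3)]
      homogeneous3_mult[OF homogeneous3_var_power(1)[of "k - 1"] homogeneous3_vars(2)] k
    by simp_all
  have yzz: "homogeneous3 k (var_y ^ (k - 2) * var_z ^ 2)"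
    using homogeneous3_mult[OF homogeneous3_var_power(2)[of "k - 2"] homogeneous3_var_power(3)[of 2]]
    unfolding le_add_diff_inverse2[OF k] .
  have "homogeneous3 k (2 * var_y ^ k)" "homogeneous3 k 0"
    using homogeneous3_of_nat_mult[OF homogeneous3_var_power(2), of k 2] by (simp_all add: homogeneous3_def)
  moreover have "homogeneous3 k (curve_L k)"
    unfolding curve_L_def mult.assoc
    by (intro homogeneous3_add homogeneous3_of_nat_mult yz homogeneous3_var_power)
  ultimately show "syz1 k \<in> AR_deg (curve_C k) k"
    using syz_in_AR(1) unfolding syz1_def AR_deg_def by (simp add: homogeneous3_uminus)
  have "homogeneous3 k (syz_b k)" "homogeneous3 k (syz_c k)"
    unfolding syz_b_def syz_c_def mult.assoc
    by (intro homogeneous3_add homogeneous3_diff homogeneous3_of_nat_mult homogeneous3_const_mult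
        yz xz xy yzz homogeneous3_var_power)+
  then show "syz2 k \<in> AR_deg (curve_C k) k"
    using syz_in_AR(2) homogeneous_curve_g[OF k] unfolding syz2_def AR_deg_def by simp
qed

lemma not_var_x_dvd_curve_g: "\<not> var_x dvd curve_g k"
proof
  assume "var_x dvd curve_g k"
  then obtain h where "curve_g k = var_x * h" ..
  then have "value3 (curve_g k) (0, 1, 1) = value3 (var_x * h) (0, 1, 1)" by simp
  then show False using k by (simp add: value3_curve_g value3.simps value3_vars power_0_left)
qed

lemma not_var_y_dvd_curve_L: "\<not> var_y dvd curve_L k"
proof
  assume "var_y dvd curve_L k"
  then obtain h where "curve_L k = var_y * h" ..
  then have "value3 (curve_L k) (1, 0, 0) = value3 (var_y * h) (1, 0, 0)" by simp
  then show False using k by (simp add: curve_L_def value3.simps value3_vars)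
qed

lemma curve_g_nonzero: "curve_g k \<noteq> 0"
  using not_var_x_dvd_curve_g by auto

lemma curve_L_nonzero: "curve_L k \<noteq> 0"
  using not_var_y_dvd_curve_L by auto

lemma var_power_nonzero: "var_x ^ n \<noteq> 0" "var_y ^ n \<noteq> 0"
  by (simp_all add: var_x_def var_y_def)

text \<open>Modulo g, the polynomial Q is -(2k+1) x^(k+1), so only a power of x has to be cancelled,
  and x does not divide g.\<close>

lemma curve_g_dvd_cancel:
  assumes "curve_g k dvd a * (var_x ^ n * curve_Q k)"
  shows "curve_g k dvd a"
proof -
  have "curve_g k dvd of_nat (2 * k) * curve_g k * var_y * (a * var_x ^ n) - a * (var_x ^ n * curve_Q k)"
    using assms by (intro dvd_diff) auto
  also have "\<dots> = const3 (of_nat (2 * k + 1)) * (a * var_x ^ (n + k + 1))"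
    unfolding curve_Q_def of_nat_const3[of "2 * k + 1", symmetric] by (simp add: power_add algebra_simps)
  finally have "curve_g k dvd const3 (of_nat (2 * k + 1)) * (a * var_x ^ (n + k + 1))" .
  then have "curve_g k dvd const3 (inverse (of_nat (2 * k + 1))) * (const3 (of_nat (2 * k + 1)) * (a * var_x ^ (n + k + 1)))"
    by (rule dvd_mult)
  then have "curve_g k dvd a * var_x ^ (n + k + 1)"
    by (subst (asm) const3_inverse_mult) (simp_all flip: of_nat_Suc)
  then show ?thesis
    by (rule dvd_cancel_prime_power[OF prime_elem_var_x not_var_x_dvd_curve_g])
qed

text \<open>Since g divides the first entry, subtracting a multiple of \<open>syz2 k\<close> makes
  that entry zero. What remains is a relation between L and 2 y^k; as y is prime and does not divide
  L, it is a multiple of \<open>syz1 k\<close>.\<close>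

lemma AR_generated:
  assumes "r \<in> AR (curve_C k)"
  shows "\<exists>s t. r = smult_triple s (syz1 k) + smult_triple t (syz2 k)"
proof -
  obtain a b c where r: "r = (a, b, c)" by (cases r)
  have eq: "a * (var_x ^ (k - 1) * curve_Q k) + curve_g k * (b * curve_L k + 2 * c * var_y ^ k) = 0"
    using assms unfolding r AR_curve_C[OF k] .
  then have "a * (var_x ^ (k - 1) * curve_Q k) = curve_g k * - (b * curve_L k + 2 * c * var_y ^ k)"
    by (simp only: add_eq_0_iff2 mult_minus_right)
  then have "curve_g k dvd a * (var_x ^ (k - 1) * curve_Q k)" by (simp only: dvd_triv_left)
  then have "curve_g k dvd a" by (rule curve_g_dvd_cancel)
  then obtain t where t: "a = curve_g k * t" ..
  define b' where "b' = b - t * syz_b k"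
  define c' where "c' = c - t * syz_c k"
  have "curve_g k * (b' * curve_L k + 2 * c' * var_y ^ k) =
      a * (var_x ^ (k - 1) * curve_Q k) + curve_g k * (b * curve_L k + 2 * c * var_y ^ k)
      - curve_g k * t * (var_x ^ (k - 1) * curve_Q k + syz_b k * curve_L k + 2 * syz_c k * var_y ^ k)"
    unfolding b'_def c'_def t by (simp add: algebra_simps)
  then have eq': "b' * curve_L k + 2 * c' * var_y ^ k = 0"
    unfolding eq syz2_eq using curve_g_nonzero by simp
  then have "b' * curve_L k = var_y ^ k * (- 2 * c')" by (simp add: add_eq_0_iff2 mult_ac)
  then have "var_y ^ k dvd b' * curve_L k" by simp
  then have "var_y ^ k dvd b' \<or> var_y ^ 1 dvd curve_L k"
    by (rule prime_elem_power_dvd_cases) (simp_all add: prime_elem_var_y)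
  then obtain h where h: "b' = var_y ^ k * h" using not_var_y_dvd_curve_L by auto
  define s where "s = const3 (inverse 2) * h"
  have two: "(2 :: poly3) = const3 2" by (simp add: numeral_poly)
  have "2 * s = h"
    unfolding s_def two using const3_inverse_mult[of 2 h] by (simp only: mult.left_commute) simp
  then have b': "b' = s * (2 * var_y ^ k)" using h by (simp add: mult_ac)
  have "var_y ^ k * (2 * (s * curve_L k + c')) = 0"
    using eq' unfolding b' by (simp add: algebra_simps)
  then have "2 * (s * curve_L k + c') = 0" using var_power_nonzero(2)[of k] mult_eq_0_iff by blast
  then have "s * curve_L k + c' = 0" by (simp only: mult_eq_0_iff) simp
  then have c': "c' = s * (- curve_L k)" by (simp add: add_eq_0_iff2 add.commute)
  have "r = smult_triple s (syz1 k) + smult_triple t (syz2 k)"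
    unfolding smult_triple_add r syz1_def syz2_def using t b' c' b'_def c'_def
    by (simp add: algebra_simps)
  then show ?thesis by blast
qed

text \<open>The two syzygies are in triangular form: the first entry determines t because g is
  nonzero, then L being nonzero determines s.\<close>

lemma syz_independent:
  assumes "smult_triple s (syz1 k) + smult_triple t (syz2 k) =
    smult_triple s' (syz1 k) + smult_triple t' (syz2 k)"
  shows "s = s' \<and> t = t'"
proof
  show t: "t = t'"
    using assms curve_g_nonzero unfolding smult_triple_add syz1_def syz2_def by simp
  show "s = s'"
    using assms curve_L_nonzero unfolding smult_triple_add syz1_def syz2_def t by simp
qed

lemma free_with_exponents_curve_C: "free_with_exponents (curve_C k) k k"
  unfolding free_with_exponents_def
proof (intro conjI bexI ballI)
  fix r assume "r \<in> AR (curve_C k)"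
  then obtain s t where st: "r = smult_triple s (syz1 k) + smult_triple t (syz2 k)"
    using AR_generated by blast
  show "\<exists>!(s1, s2). r = smult_triple s1 (syz1 k) + smult_triple s2 (syz2 k)"
  proof (rule ex1I[of _ "(s, t)"])
    fix p assume "case p of (s1, s2) \<Rightarrow> r = smult_triple s1 (syz1 k) + smult_triple s2 (syz2 k)"
    then show "p = (s, t)" unfolding st using syz_independent by (cases p) auto
  qed (simp add: st)
qed (simp_all add: syz_in_AR_deg)

text \<open>
  A syzygy which is homogeneous of a degree other than k has coordinates in the maximal ideal,
  as one sees by restricting its first two entries to lines through the origin.
\<close>

lemma AR_deg_coordinates:
  assumes r: "smult_triple s (syz1 k) + smult_triple t (syz2 k) \<in> AR_deg (curve_C k) d" and "d \<noteq> k"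
  shows "value3 s (0, 0, 0) = 0" "value3 t (0, 0, 0) = 0"
proof -
  let ?\<iota> = "\<lambda>c. [:c:] :: complex poly"
  let ?t = "[:0, 1:] :: complex poly"
  have \<iota>: "comm_ring_hom ?\<iota>" by unfold_locales (simp_all flip: one_pCons)
  interpret \<iota>: comm_ring_hom ?\<iota> by fact
  interpret E: comm_ring_hom "\<lambda>f. eval3 ?\<iota> f p" for p by (intro comm_ring_hom_eval3 \<iota>)
  have ev0: "comm_ring_hom (\<lambda>q. poly q 0 :: complex)" by unfold_locales simp_all
  have at0: "poly (eval3 ?\<iota> f (?t * ?\<iota> a, ?t * ?\<iota> b, ?t * ?\<iota> c)) 0 = value3 f (0, 0, 0)" for f a b c
    using hom_eval3[OF \<iota> ev0] by simp
  \<comment> \<open>Degrees are compared along a line: for d < k the constant e must vanish and q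
    with it, for d > k the variable divides q. In both cases q is zero at the origin.\<close>
  have key: "poly q 0 = 0" if "q * ?t ^ k = ?t ^ d * ?\<iota> e" for q e
  proof (cases "d < k")
    case True
    then have "?t ^ k = ?t ^ d * ?t ^ (k - d)" by (simp flip: power_add)
    with that have "?t ^ d * (q * ?t ^ (k - d)) = ?t ^ d * ?\<iota> e" by (simp only: mult_ac)
    then have *: "q * ?t ^ (k - d) = ?\<iota> e" unfolding mult_cancel_left by simp
    then have "poly (q * ?t ^ (k - d)) 0 = e" by simp
    with True have "e = 0" by (simp add: poly_power power_0_left)
    with * have "q = 0" by simp
    then show ?thesis by simp
  next
    case False
    then have "?t ^ d = ?t ^ k * ?t ^ (d - k)" by (simp flip: power_add)
    with that have "?t ^ k * q = ?t ^ k * (?t ^ (d - k) * ?\<iota> e)" by (simp only: mult_ac)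
    then have "q = ?t ^ (d - k) * ?\<iota> e" unfolding mult_cancel_left by simp
    then show ?thesis using False \<open>d \<noteq> k\<close> by (simp add: poly_power power_0_left)
  qed
  have hom: "homogeneous3 d (t * curve_g k)" "homogeneous3 d (s * (2 * var_y ^ k) + t * syz_b k)"
    using r unfolding smult_triple_add AR_deg_def syz1_def syz2_def by simp_all
  \<comment> \<open>On the x-axis g restricts to the k-th power of the line parameter, which
    isolates t.\<close>
  have g: "eval3 ?\<iota> (curve_g k) (?t * ?\<iota> 1, ?t * ?\<iota> 0, ?t * ?\<iota> 0) = ?t ^ k"
    using k by (simp add: curve_g_def E.simps eval3_vars[OF \<iota>] del: mult_pCons_left mult_pCons_right flip: one_pCons)
  have "eval3 ?\<iota> t (?t * ?\<iota> 1, ?t * ?\<iota> 0, ?t * ?\<iota> 0) * ?t ^ k = ?t ^ d * ?\<iota> (value3 (t * curve_g k) (1, 0, 0))"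
    using eval3_homogeneous[OF \<iota> hom(1), of ?t "?\<iota> 1" "?\<iota> 0" "?\<iota> 0"]
      hom_eval3[OF comm_ring_hom_id \<iota>, of "t * curve_g k" 1 0 0]
    unfolding E.mult g by simp
  from key[OF this] show "value3 t (0, 0, 0) = 0" unfolding at0 .
  \<comment> \<open>On the y-axis the entry b vanishes, so the second coordinate involves s
    alone.\<close>
  have b: "eval3 ?\<iota> (syz_b k) (?t * ?\<iota> 0, ?t * ?\<iota> 1, ?t * ?\<iota> 0) = 0"
    using k by (simp add: syz_b_def E.simps eval3_vars[OF \<iota>] power_0_left del: mult_pCons_left mult_pCons_right)
  have y: "eval3 ?\<iota> (var_y) (?t * ?\<iota> 0, ?t * ?\<iota> 1, ?t * ?\<iota> 0) = ?t"
    by (simp add: eval3_vars[OF \<iota>])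
  have "eval3 ?\<iota> (s * (2 * var_y ^ k) + t * syz_b k) (?t * ?\<iota> 0, ?t * ?\<iota> 1, ?t * ?\<iota> 0) =
      ?t ^ d * ?\<iota> (value3 (s * (2 * var_y ^ k) + t * syz_b k) (0, 1, 0))"
    using eval3_homogeneous[OF \<iota> hom(2), of ?t "?\<iota> 0" "?\<iota> 1" "?\<iota> 0"]
      hom_eval3[OF comm_ring_hom_id \<iota>, of "s * (2 * var_y ^ k) + t * syz_b k" 0 1 0]
    by (simp only:)
  then have "(2 * eval3 ?\<iota> s (?t * ?\<iota> 0, ?t * ?\<iota> 1, ?t * ?\<iota> 0)) * ?t ^ k =
      ?t ^ d * ?\<iota> (value3 (s * (2 * var_y ^ k) + t * syz_b k) (0, 1, 0))"
    unfolding E.add E.mult E.power E.numeral b y by (simp only: mult_ac mult_zero_right mult_zero_left add_0_right)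
  from key[OF this] show "value3 s (0, 0, 0) = 0" unfolding mult_2 poly_add at0 by simp
qed

text \<open>The transition matrix between two bases is invertible, hence so is its value at the
  origin. A basis element of degree other than k would make a row of that value zero.\<close>

lemma free_exponents_unique:
  assumes "free_with_exponents (curve_C k) d1 d2"
  shows "d1 = k \<and> d2 = k"
proof -
  obtain r1 r2 where r1: "r1 \<in> AR_deg (curve_C k) d1" and r2: "r2 \<in> AR_deg (curve_C k) d2"
    and basis: "\<forall>r\<in>AR (curve_C k). \<exists>!(s1, s2). r = smult_triple s1 r1 + smult_triple s2 r2"
    using assms unfolding free_with_exponents_def by (elim conjE bexE) (rule that)
  have ex: "\<exists>s t. r = smult_triple s r1 + smult_triple t r2" if "r \<in> AR (curve_C k)" for r
    using ex1_implies_ex[OF bspec[OF basis that]] by auto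
  have "r1 \<in> AR (curve_C k)" "r2 \<in> AR (curve_C k)"
    using r1 r2 unfolding AR_deg_def by auto
  then obtain a1 b1 a2 b2 where e1: "r1 = smult_triple a1 (syz1 k) + smult_triple b1 (syz2 k)"
    and e2: "r2 = smult_triple a2 (syz1 k) + smult_triple b2 (syz2 k)"
    using AR_generated by metis
  obtain s1 t1 where st1: "syz1 k = smult_triple s1 r1 + smult_triple t1 r2"
    using ex[OF syz_in_AR(1)] by blast
  obtain s2 t2 where st2: "syz2 k = smult_triple s2 r1 + smult_triple t2 r2"
    using ex[OF syz_in_AR(2)] by blast
  have comb: "smult_triple s r1 + smult_triple t r2 =
      smult_triple (s * a1 + t * a2) (syz1 k) + smult_triple (s * b1 + t * b2) (syz2 k)" for s t
    unfolding e1 e2 smult_triple_add by (simp add: algebra_simps)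
  have "smult_triple 1 (syz1 k) + smult_triple 0 (syz2 k) = smult_triple s1 r1 + smult_triple t1 r2"
    "smult_triple 0 (syz1 k) + smult_triple 1 (syz2 k) = smult_triple s2 r1 + smult_triple t2 r2"
    unfolding st1[symmetric] st2[symmetric] by (simp_all add: smult_triple_add)
  then have m: "1 = s1 * a1 + t1 * a2" "0 = s1 * b1 + t1 * b2" "0 = s2 * a1 + t2 * a2" "1 = s2 * b1 + t2 * b2"
    unfolding comb using syz_independent by blast+
  let ?v = "\<lambda>f. value3 f (0, 0, 0)"
  have v: "1 = ?v s1 * ?v a1 + ?v t1 * ?v a2" "0 = ?v s1 * ?v b1 + ?v t1 * ?v b2"
      "0 = ?v s2 * ?v a1 + ?v t2 * ?v a2" "1 = ?v s2 * ?v b1 + ?v t2 * ?v b2"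
    using m[THEN arg_cong[where f = ?v]] by (simp_all add: value3.simps)
  have "d1 = k"
  proof (rule ccontr)
    assume "d1 \<noteq> k"
    then have "?v a1 = 0" "?v b1 = 0" using AR_deg_coordinates r1 unfolding e1 by blast+
    with v show False by auto
  qed
  moreover have "d2 = k"
  proof (rule ccontr)
    assume "d2 \<noteq> k"
    then have "?v a2 = 0" "?v b2 = 0" using AR_deg_coordinates r2 unfolding e2 by blast+
    with v show False by auto
  qed
  ultimately show ?thesis ..
qed

end

section \<open>Irreducibility and rationality\<close>

lemma const_poly_power: "[:a:] ^ n = [:a ^ n:]"
  by (induction n) (simp_all add: one_pCons mult.commute)

lemma degree_1_pCons:
  assumes "Polynomial.degree p = 1"
  shows "\<exists>a b. p = [:a, b:]"
proof -
  obtain a r where p: "p = pCons a r" by (rule pCons_cases)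
  with assms have "Polynomial.degree r = 0" by (auto simp: degree_pCons_eq_if split: if_splits)
  then show ?thesis unfolding p by (metis degree_eq_zeroE)
qed

lemma curve_C_pCons:
  fixes k :: nat
  defines "Y \<equiv> [:0, 1:] :: complex poly poly" and "U \<equiv> [:[:0, 1:]:] :: complex poly poly"
  assumes "k \<ge> 2"
  shows "curve_C k = [:U ^ (2 * k) * Y - U ^ (2 * k + 1), 2 * U ^ k * Y ^ k, Y ^ (2 * k - 1):]"
proof -
  have v: "var_x = [:U:]" "var_y = [:Y:]" "var_z = [:0, 1:]"
    by (simp_all add: var_x_def var_y_def var_z_def U_def Y_def)
  have sq: "([:b:] * [:0, 1:] + [:a:]) ^ 2 * [:y:] - [:c:] = [:a ^ 2 * y - c, 2 * a * (b * y), b ^ 2 * y:]"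
    for a b c y :: "complex poly poly"
    by (simp add: power2_eq_square algebra_simps)
  obtain n where "k = Suc n" using assms(3) by (metis Suc_le_D numeral_2_eq_2)
  then have "Y ^ (k - 1) * Y = Y ^ k" "(Y ^ (k - 1)) ^ 2 * Y = Y ^ (2 * k - 1)"
    by (simp_all add: mult.commute flip: power_mult)
  then show ?thesis
    unfolding curve_C_def v const_poly_power sq by (simp flip: power_mult add: mult.commute)
qed

text \<open>As a polynomial in z, f is quadratic. It has no constant factor, since its leading
  coefficient is a power of y and y does not divide the lowest coefficient. Two linear factors would
  make the discriminant 4 x^(2k+1) y^(2k-1) a square, but its degree in y is odd.\<close>

lemma irreducible_curve_C:
  assumes k: "k \<ge> 2"
  shows "comm_semiring_1_class.irreducible (curve_C k)"
proof -
  define Y where "Y = ([:0, 1:] :: complex poly poly)"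
  define U where "U = ([:[:0, 1:]:] :: complex poly poly)"
  let ?a0 = "U ^ (2 * k) * Y - U ^ (2 * k + 1)" and ?a1 = "2 * U ^ k * Y ^ k" and ?a2 = "Y ^ (2 * k - 1)"
  have f: "curve_C k = [:?a0, ?a1, ?a2:]"
    using curve_C_pCons[OF k] unfolding U_def Y_def .
  have primeY: "prime_elem Y" unfolding Y_def by (rule prime_elem_linear_poly) simp_all
  have Y0: "Y \<noteq> 0" and U0: "U \<noteq> 0" by (simp_all add: Y_def U_def)
  have a2: "?a2 \<noteq> 0" using Y0 by simp
  have deg: "Polynomial.degree (curve_C k) = 2" unfolding f using a2 by simp
  \<comment> \<open>At y = 0 the lowest coefficient becomes -x^(2k+1).\<close>
  have ndvd: "\<not> Y dvd ?a0"
  proof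
    assume "Y dvd ?a0"
    then have "poly ?a0 0 = 0" using poly_eq_0_iff_dvd[of ?a0 0] unfolding Y_def by (simp del: mult_pCons_left mult_pCons_right)
    then show False by (simp add: U_def Y_def poly_power)
  qed
  have const: "is_unit p" if pq: "curve_C k = p * q" and d: "Polynomial.degree p = 0" for p q
  proof -
    obtain c where c: "p = [:c:]" using d degree_eq_zeroE by blast
    have "c dvd Polynomial.coeff (curve_C k) n" for n unfolding pq c by simp
    from this[of 0] this[of 2] have c0: "c dvd ?a0" and c2: "c dvd ?a2"
      unfolding f by (simp_all add: numeral_2_eq_2)
    have "is_unit c"
    proof (rule ccontr)
      assume "\<not> is_unit c"
      moreover have "c \<noteq> 0" using c2 a2 by auto
      ultimately obtain r where r: "normalization_semidom_class.prime r" "r dvd c"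
        using prime_divisor_exists by blast
      then have "r dvd Y" using c2 prime_dvd_power by (metis dvd_trans)
      moreover have "comm_semiring_1_class.irreducible Y" using primeY by (rule prime_elem_imp_irreducible)
      ultimately have "Y dvd r"
        using r(1) by (metis irreducibleD' not_prime_unit)
      then have "Y dvd ?a0" using r(2) c0 by (metis dvd_trans)
      then show False using ndvd by simp
    qed
    then show ?thesis unfolding c by (simp add: is_unit_const_poly_iff)
  qed
  show ?thesis
  proof (rule Factorial_Ring.irreducibleI)
    show "curve_C k \<noteq> 0" using deg by auto
    show "\<not> is_unit (curve_C k)" using deg dvd_imp_degree_le[of "curve_C k" 1] by auto
    fix p q assume pq: "curve_C k = p * q"
    then have nz: "p \<noteq> 0" "q \<noteq> 0" using deg by auto
    then have "Polynomial.degree p + Polynomial.degree q = 2"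
      using deg unfolding pq by (simp add: degree_mult_eq)
    then consider "Polynomial.degree p = 0" | "Polynomial.degree q = 0"
      | "Polynomial.degree p = 1" "Polynomial.degree q = 1" by linarith
    then show "is_unit p \<or> is_unit q"
    proof cases
      case 1
      then show ?thesis using const[OF pq] by simp
    next
      case 2
      then show ?thesis using const[of q p] pq by (simp add: mult.commute)
    next
      case 3
      obtain p0 p1 where p: "p = [:p0, p1:]" using 3(1) degree_1_pCons by blast
      obtain q0 q1 where q: "q = [:q0, q1:]" using 3(2) degree_1_pCons by blast
      have e: "?a0 = p0 * q0" "?a1 = p0 * q1 + p1 * q0" "?a2 = p1 * q1"
        using pq unfolding f p q by (simp_all add: algebra_simps)
      have "(p0 * q1 - p1 * q0) ^ 2 = ?a1 ^ 2 - 4 * ?a2 * ?a0"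
        unfolding e by (simp add: power2_eq_square algebra_simps)
      also have "\<dots> = 4 * U ^ (2 * k + 1) * Y ^ (2 * k - 1)"
      proof -
        have "Y ^ (2 * k) = Y * Y ^ (2 * k - 1)" using k by (simp flip: power_Suc)
        moreover have "?a1 ^ 2 = 4 * U ^ (2 * k) * Y ^ (2 * k)"
          by (simp add: power_mult_distrib mult.commute[of 2 k] flip: power_mult)
        ultimately show ?thesis by (simp add: algebra_simps)
      qed
      also have "\<dots> = [:4 * [:0, 1:] ^ (2 * k + 1):] * Y ^ (2 * k - 1)"
        unfolding U_def const_poly_power by (simp add: numeral_poly)
      finally have sq: "(p0 * q1 - p1 * q0) ^ 2 = [:4 * [:0, 1:] ^ (2 * k + 1):] * Y ^ (2 * k - 1)" .
      have "Polynomial.degree ([:4 * [:0, 1:] ^ (2 * k + 1):] * Y ^ (2 * k - 1)) = 2 * k - 1"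
        using Y0 by (subst degree_mult_eq) (simp_all add: degree_power_eq Y_def numeral_poly)
      moreover have "Polynomial.degree ((p0 * q1 - p1 * q0) ^ 2) = 2 * Polynomial.degree (p0 * q1 - p1 * q0)"
        by (cases "p0 * q1 - p1 * q0 = 0") (simp_all add: degree_power_eq)
      ultimately have "2 * Polynomial.degree (p0 * q1 - p1 * q0) = 2 * k - 1"
        using sq by simp
      then show ?thesis using k by presburger
    qed
  qed
qed

lemma homogeneous2_monom: "i + j = d \<Longrightarrow> homogeneous2 d (Polynomial.monom (Polynomial.monom c i) j)"
  by (auto simp: homogeneous2_def split: if_splits)

lemma homogeneous2_diff:
  "homogeneous2 d f \<Longrightarrow> homogeneous2 d g \<Longrightarrow> homogeneous2 d (f - g)"
  unfolding homogeneous2_def by (metis coeff_diff diff_zero)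

lemma value2_monom: "value2 (Polynomial.monom (Polynomial.monom c i) j) (s, t) = c * s ^ i * t ^ j"
  by (simp add: value2_def poly_monom const_poly_power)

text \<open>
  The normalization of the curve is $(s : t) \mapsto (t^2 s^{2k-1} : s^{2k+1} : t^{2k+1} - s t^{2k})$,
  with inverse $(x : y : z) \mapsto (x^k : g)$.
\<close>

lemma rational_curve_C:
  assumes k: "k \<ge> 2"
  shows "rational_curve (curve_C k)"
proof -
  define P0 where "P0 = Polynomial.monom (Polynomial.monom (1 :: complex) (2 * k - 1)) 2"
  define P1 where "P1 = Polynomial.monom (Polynomial.monom (1 :: complex) (2 * k + 1)) 0"
  define P2 where "P2 = Polynomial.monom (Polynomial.monom (1 :: complex) 0) (2 * k + 1)
    - Polynomial.monom (Polynomial.monom 1 1) (2 * k)"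
  define P where "P = (\<lambda>w. (value2 P0 w, value2 P1 w, value2 P2 w))"
  define Q where "Q = (\<lambda>v. (value3 (var_x ^ k) v, value3 (curve_g k) v))"
  have P: "P (s, t) = (s ^ (2 * k - 1) * t ^ 2, s ^ (2 * k + 1), t ^ (2 * k + 1) - s * t ^ (2 * k))" for s t
    by (simp add: P_def P0_def P1_def P2_def value2_monom value2_def[of "_ - _"])
       (simp add: value2_def poly_monom const_poly_power)
  have Q: "Q (a, b, c) = (a ^ k, b ^ (k - 1) * c + a ^ k)" for a b c
    by (simp add: Q_def value3.simps value3_vars value3_curve_g)
  obtain n where kn: "k = n + 1" using k by (metis Suc_eq_plus1 Suc_le_D numeral_2_eq_2)
  \<comment> \<open>The exponent of the scalar factor by which the composites of the two maps differ
    from the identity.\<close>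
  define e where "e = (2 * k + 1) * (k - 1)"
  have e: "(2 * k + 1) * (k - 1) = e" "(2 * k - 1) * k = e + 1" "e * 2 + (2 * k + 1) = (2 * k - 1) * (2 * k + 1)"
    "e + (2 * k + 1) = (2 * k + 1) * k"
    unfolding e_def by (simp_all add: kn algebra_simps)
  have Px: "(s ^ (2 * k + 1)) ^ (k - 1) * (1 - s) + (s ^ (2 * k - 1)) ^ k = s ^ e" for s :: complex
    unfolding power_mult[symmetric] e by (simp add: algebra_simps)
  \<comment> \<open>The excluded parameters (1, 0) and (0, 1) are the preimages of the two cusps,
    where x^k and g both vanish.\<close>
  have "finite {w \<in> proj_line. \<not> (P w \<noteq> (0, 0, 0) \<and> value3 (curve_C k) (P w) = 0 \<and> same_point2 w (Q (P w)))}"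
  proof (rule finite_subset[of _ "{(1, 0), (0, 1)}"], rule subsetI, rule ccontr)
    fix w :: "complex \<times> complex"
    assume w: "w \<in> {w \<in> proj_line. \<not> (P w \<noteq> (0, 0, 0) \<and> value3 (curve_C k) (P w) = 0 \<and> same_point2 w (Q (P w)))}"
      and n: "w \<notin> {(1, 0), (0, 1)}"
    then obtain s where s: "w = (s, 1)" "s \<noteq> 0" by (auto simp: proj_line_def)
    have Pw: "P w = (s ^ (2 * k - 1), s ^ (2 * k + 1), 1 - s)" unfolding s P by simp
    have "value3 (curve_C k) (P w) = 0"
      unfolding Pw value3_curve_C Px
      unfolding power_mult[symmetric] power_add[symmetric] e by simp
    moreover have "Q (P w) = (s ^ e * s, s ^ e * 1)"
      unfolding Pw Q Px unfolding power_mult[symmetric] e by simp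
    then have "same_point2 w (Q (P w))"
      unfolding s same_point2_def using s(2) by auto
    moreover have "P w \<noteq> (0, 0, 0)" using s(2) unfolding Pw by simp
    ultimately show False using w by blast
  qed simp
  moreover have "finite {v \<in> curve_points (curve_C k). \<not> (Q v \<noteq> (0, 0) \<and> same_point3 v (P (Q v)))}"
  proof (rule finite_subset[of _ "{(0, 0, 1), (0, 1, 0)}"], rule subsetI, rule ccontr)
    fix v :: point
    assume v: "v \<in> {v \<in> curve_points (curve_C k). \<not> (Q v \<noteq> (0, 0) \<and> same_point3 v (P (Q v)))}"
      and n: "v \<notin> {(0, 0, 1), (0, 1, 0)}"
    obtain a b c where abc: "v = (a, b, c)" by (cases v)
    define G where "G = b ^ (k - 1) * c + a ^ k"
    have f: "G ^ 2 * b = a ^ (2 * k + 1)" and pp: "(a, b, c) \<in> proj_plane"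
      using v unfolding abc curve_points_def G_def by (simp_all add: value3_curve_C)
    have a0: "a \<noteq> 0"
    proof
      assume a: "a = 0"
      then have "G ^ 2 * b = 0" using f by simp
      then have "b = 0 \<or> c = 0" using a k by (auto simp: G_def power_0_left)
      then show False using pp n a unfolding abc proj_plane_iff by auto
    qed
    then have "G ^ 2 * b \<noteq> 0" unfolding f by simp
    then have G0: "G \<noteq> 0" and b0: "b \<noteq> 0" by auto
    \<comment> \<open>All coordinates of \<open>P (Q v)\<close> are G^2 a^e times those of v; for
      the second and third one the curve equation G^2 b = a^(2k+1) is used.\<close>
    have "G ^ (2 * k + 1) - a ^ k * G ^ (2 * k) = G ^ (2 * k) * (b ^ (k - 1) * c)"
      by (simp add: G_def algebra_simps)
    also have "\<dots> = G ^ 2 * (G ^ 2 * b) ^ (k - 1) * c"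
      by (simp add: kn power_mult power2_eq_square power_mult_distrib)
    also have "(G ^ 2 * b) ^ (k - 1) = a ^ e"
      unfolding f power_mult[symmetric] e ..
    finally have 3: "G ^ (2 * k + 1) - a ^ k * G ^ (2 * k) = (G ^ 2 * a ^ e) * c" by simp
    have 2: "(a ^ k) ^ (2 * k + 1) = (G ^ 2 * a ^ e) * b"
    proof -
      have "(G ^ 2 * a ^ e) * b = a ^ e * (G ^ 2 * b)" by simp
      also have "\<dots> = a ^ (e + (2 * k + 1))" unfolding f by (simp add: power_add)
      finally show ?thesis unfolding e power_mult[symmetric] by (simp only: mult.commute[of k])
    qed
    have 1: "(a ^ k) ^ (2 * k - 1) * G ^ 2 = (G ^ 2 * a ^ e) * a"
      unfolding power_mult[symmetric] mult.commute[of k] e by simp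
    have "P (Q v) = ((G ^ 2 * a ^ e) * a, (G ^ 2 * a ^ e) * b, (G ^ 2 * a ^ e) * c)"
      unfolding abc Q G_def[symmetric] P 1 2 3 ..
    then have "same_point3 v (P (Q v))"
      unfolding abc same_point3_def using a0 b0 G0 by auto
    moreover have "Q v \<noteq> (0, 0)" unfolding abc Q using a0 by simp
    ultimately show False using v by blast
  qed simp
  moreover have "homogeneous2 (2 * k + 1) P0" "homogeneous2 (2 * k + 1) P1" "homogeneous2 (2 * k + 1) P2"
    unfolding P0_def P1_def P2_def using k
    by (intro homogeneous2_monom homogeneous2_diff; simp)+
  moreover have "homogeneous3 k (var_x ^ k)" "homogeneous3 k (curve_g k)"
    by (simp_all add: homogeneous3_var_power homogeneous_curve_g k)
  ultimately show ?thesis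
    unfolding rational_curve_def P_def Q_def Let_def by blast
qed

section \<open>Power series in two variables\<close>

definition cf :: "series2 \<Rightarrow> nat \<Rightarrow> nat \<Rightarrow> complex" where
  "cf g i j = fps_nth (fps_nth g i) j"

definition series :: "(nat \<Rightarrow> nat \<Rightarrow> complex) \<Rightarrow> series2" where
  "series F = Abs_fps (\<lambda>i. Abs_fps (F i))"

definition ser_u :: series2 where "ser_u = fps_X"
definition ser_v :: series2 where "ser_v = fps_const fps_X"
definition mono :: "nat \<Rightarrow> nat \<Rightarrow> series2" where "mono i j = ser_u ^ i * ser_v ^ j"

lemma series2_eq_iff: "g = h \<longleftrightarrow> (\<forall>i j. cf g i j = cf h i j)"
  by (auto simp: fps_eq_iff cf_def)

lemma cf_simps [simp]:
  "cf (series F) i j = F i j" "cf 0 i j = 0" "cf (g + h) i j = cf g i j + cf h i j"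
  "cf (g - h) i j = cf g i j - cf h i j" "cf (- g) i j = - cf g i j"
  by (simp_all add: cf_def series_def)

lemma cf_sum: "cf (sum f A) i j = (\<Sum>x\<in>A. cf (f x) i j)"
  by (simp add: cf_def fps_sum_nth)

lemma cf_mult: "cf (g * h) i j = (\<Sum>p\<le>i. \<Sum>q\<le>j. cf g p q * cf h (i - p) (j - q))"
  by (simp add: cf_def fps_mult_nth fps_sum_nth atLeast0AtMost)

lemma cf_const_mult [simp]: "cf (const_series c * g) i j = c * cf g i j"
  by (simp add: cf_def const_series_def)

lemma cf_mono_mult: "cf (mono a b * g) i j = (if a \<le> i \<and> b \<le> j then cf g (i - a) (j - b) else 0)"
  by (simp add: cf_def mono_def ser_u_def ser_v_def mult.assoc fps_X_power_mult_nth fps_const_power)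

lemma cf_one: "cf 1 i j = (if i = 0 \<and> j = 0 then 1 else 0)"
  by (simp add: cf_def)

lemma cf_mono: "cf (mono a b) i j = (if i = a \<and> j = b then 1 else 0)"
  using cf_mono_mult[of a b 1 i j] by (auto simp: cf_one)

lemma mono_mult: "mono a b * mono c d = mono (a + c) (b + d)"
  by (simp add: mono_def power_add)

lemma comm_ring_hom_const_series: "comm_ring_hom const_series"
  by unfold_locales (simp_all add: const_series_def fps_const_add fps_const_mult)

interpretation const_series: comm_ring_hom const_series
  by (rule comm_ring_hom_const_series)

lemma cf_const_series: "cf (const_series c) i j = (if i = 0 \<and> j = 0 then c else 0)"
  using cf_const_mult[of c 1 i j] by (simp add: cf_one)

lemma series_divide_mono:
  assumes "\<And>i j. cf g i j \<noteq> 0 \<Longrightarrow> a \<le> i \<and> b \<le> j"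
  shows "g = mono a b * series (\<lambda>i j. cf g (i + a) (j + b))"
  unfolding series2_eq_iff cf_mono_mult using assms by auto

definition part :: "(nat \<times> nat) set \<Rightarrow> series2 \<Rightarrow> series2" where
  "part S g = series (\<lambda>i j. if (i, j) \<in> S then cf g i j else 0)"

lemma cf_part [simp]: "cf (part S g) i j = (if (i, j) \<in> S then cf g i j else 0)"
  by (simp add: part_def)

lemma part_finite:
  assumes "finite S"
  shows "part S g = (\<Sum>(i, j)\<in>S. const_series (cf g i j) * mono i j)"
proof -
  have "cf (\<Sum>(i, j)\<in>S. const_series (cf g i j) * mono i j) p q = cf (part S g) p q" for p q
  proof -
    have "cf (\<Sum>(i, j)\<in>S. const_series (cf g i j) * mono i j) p q =
        (\<Sum>x\<in>S. if x = (p, q) then cf g p q else 0)"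
      unfolding cf_sum by (intro sum.cong) (auto simp: cf_mono split: if_splits)
    then show ?thesis using assms by (simp add: sum.delta)
  qed
  then show ?thesis unfolding series2_eq_iff by simp
qed

section \<open>The ring of convergent power series\<close>

text \<open>A geometric bound on the coefficients replaces summability, because it is easy to carry
  through products, shifts and recursions.\<close>

lemma convergent_series_iff:
  "convergent_series g \<longleftrightarrow> (\<exists>C R. 0 < R \<and> (\<forall>i j. norm (cf g i j) \<le> C * R ^ (i + j)))"
proof
  assume "convergent_series g"
  then obtain r where r: "r > 0" and s: "(\<lambda>(i, j). norm (cf g i j) * r ^ (i + j)) summable_on UNIV"
    unfolding convergent_series_def cf_def by blast
  define C where "C = infsum (\<lambda>(i, j). norm (cf g i j) * r ^ (i + j)) UNIV"
  have "norm (cf g i j) \<le> C * (1 / r) ^ (i + j)" for i j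
  proof -
    have "sum (\<lambda>(i, j). norm (cf g i j) * r ^ (i + j)) {(i, j)} \<le> C"
      unfolding C_def using r by (intro finite_sum_le_infsum[OF s]) auto
    then show ?thesis using r by (simp add: field_simps power_one_over)
  qed
  then show "\<exists>C R. 0 < R \<and> (\<forall>i j. norm (cf g i j) \<le> C * R ^ (i + j))"
    using r by (intro exI[of _ C] exI[of _ "1 / r"]) auto
next
  assume "\<exists>C R. 0 < R \<and> (\<forall>i j. norm (cf g i j) \<le> C * R ^ (i + j))"
  then obtain C R where R: "R > 0" and C: "\<And>i j. norm (cf g i j) \<le> C * R ^ (i + j)" by blast
  have C0: "C \<ge> 0" using order.trans[OF norm_ge_zero C[of 0 0]] by simp
  \<comment> \<open>Half the radius 1/R, so that the series is dominated by C times a product of two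
    geometric series of ratio 1/2.\<close>
  define r where "r = 1 / (2 * R)"
  have le: "norm (cf g i j) * r ^ (i + j) \<le> C * ((1 / 2) ^ i * (1 / 2) ^ j)" for i j
  proof -
    have "norm (cf g i j) * r ^ (i + j) \<le> C * R ^ (i + j) * r ^ (i + j)"
      using C R unfolding r_def by (intro mult_right_mono) auto
    also have "\<dots> = C * (R * r) ^ (i + j)" by (simp add: power_mult_distrib)
    also have "R * r = 1 / 2" using R by (simp add: r_def)
    finally show ?thesis by (simp add: power_add)
  qed
  have geo: "(\<Sum>i\<le>n. (1 / 2) ^ i) \<le> (2 :: real)" for n :: nat
    unfolding sum_gp0 by simp
  have "(\<lambda>(i, j). norm (cf g i j) * r ^ (i + j)) summable_on UNIV"
  proof (rule nonneg_bdd_above_summable_on)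
    show "bdd_above (sum (\<lambda>(i, j). norm (cf g i j) * r ^ (i + j)) ` {F. F \<subseteq> UNIV \<and> finite F})"
    proof (rule bdd_aboveI2)
      fix F :: "(nat \<times> nat) set" assume "F \<in> {F. F \<subseteq> UNIV \<and> finite F}"
      then have F: "finite F" by simp
      define n where "n = Max (insert 0 (fst ` F \<union> snd ` F))"
      have sub: "F \<subseteq> {..n} \<times> {..n}"
      proof
        fix x assume "x \<in> F"
        then have "fst x \<le> n" "snd x \<le> n" unfolding n_def using F by (auto intro!: Max_ge)
        then show "x \<in> {..n} \<times> {..n}" by (simp add: mem_Times_iff)
      qed
      have "sum (\<lambda>(i, j). norm (cf g i j) * r ^ (i + j)) F \<le> sum (\<lambda>(i, j). C * ((1 / 2) ^ i * (1 / 2) ^ j)) F"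
        using le by (intro sum_mono) (simp only: split_beta)
      also have "\<dots> \<le> sum (\<lambda>(i, j). C * ((1 / 2) ^ i * (1 / 2) ^ j)) ({..n} \<times> {..n})"
        using sub C0 by (intro sum_mono2) (simp_all add: split_beta)
      also have "\<dots> = C * ((\<Sum>i\<le>n. (1 / 2) ^ i) * (\<Sum>j\<le>n. (1 / 2) ^ j))"
        unfolding sum_product unfolding sum.cartesian_product by (simp only: sum_distrib_left case_prod_unfold)
      also have "\<dots> \<le> C * (2 * 2)"
        using C0 geo by (intro mult_left_mono mult_mono sum_nonneg) auto
      finally show "sum (\<lambda>(i, j). norm (cf g i j) * r ^ (i + j)) F \<le> C * (2 * 2)" .
    qed
  qed (use R in \<open>auto simp: r_def\<close>)
  then show "convergent_series g"
    unfolding convergent_series_def cf_def[symmetric] using R by (intro exI[of _ r]) (auto simp: r_def)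
qed

text \<open>Normalizing to R at least 1 makes the bounds monotone in the degree and lets two
  different ratios be majorized by their product.\<close>

lemma convergent_seriesD:
  assumes "convergent_series g"
  shows "\<exists>C R. C \<ge> 0 \<and> R \<ge> 1 \<and> (\<forall>i j. norm (cf g i j) \<le> C * R ^ (i + j))"
proof -
  obtain C R where R: "R > 0" and C: "\<And>i j. norm (cf g i j) \<le> C * R ^ (i + j)"
    using assms unfolding convergent_series_iff by blast
  have C0: "C \<ge> 0" using order.trans[OF norm_ge_zero C[of 0 0]] by simp
  have "norm (cf g i j) \<le> C * (max 1 R) ^ (i + j)" for i j
  proof -
    have "norm (cf g i j) \<le> C * R ^ (i + j)" by (rule C)
    also have "\<dots> \<le> C * (max 1 R) ^ (i + j)" using C0 R by (intro mult_left_mono power_mono) auto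
    finally show ?thesis .
  qed
  with C0 show ?thesis by (intro exI[of _ C] exI[of _ "max 1 R"]) auto
qed

lemma convergent_series_finite_support:
  assumes "finite S" "\<And>i j. cf g i j \<noteq> 0 \<Longrightarrow> (i, j) \<in> S"
  shows "convergent_series g"
  unfolding convergent_series_iff
proof (intro exI conjI allI)
  fix i j
  show "norm (cf g i j) \<le> (\<Sum>(p, q)\<in>S. norm (cf g p q)) * 1 ^ (i + j)"
  proof (cases "cf g i j = 0")
    case False
    then have "(i, j) \<in> S" using assms(2) by blast
    then show ?thesis using assms(1)
      using member_le_sum[of "(i, j)" S "\<lambda>(p, q). norm (cf g p q)"] by (auto simp: split_beta)
  qed (auto intro: sum_nonneg)
qed simp

lemma convergent_const: "convergent_series (const_series c)"
  by (rule convergent_series_finite_support[of "{(0, 0)}"]) (auto simp: cf_const_series split: if_splits)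

lemma convergent_mono: "convergent_series (mono a b)"
  by (rule convergent_series_finite_support[of "{(a, b)}"]) (auto simp: cf_mono split: if_splits)

lemma convergent_0: "convergent_series 0" and convergent_1: "convergent_series 1"
  using convergent_const[of 0] convergent_const[of 1] by (simp_all add: const_series.simps)

lemma convergent_add:
  assumes "convergent_series g" "convergent_series h"
  shows "convergent_series (g + h)"
proof -
  obtain C R where 1: "C \<ge> 0" "R \<ge> 1" "\<And>i j. norm (cf g i j) \<le> C * R ^ (i + j)"
    using convergent_seriesD[OF assms(1)] by blast
  obtain D T where 2: "D \<ge> 0" "T \<ge> 1" "\<And>i j. norm (cf h i j) \<le> D * T ^ (i + j)"
    using convergent_seriesD[OF assms(2)] by blast
  have "norm (cf (g + h) i j) \<le> (C + D) * (R * T) ^ (i + j)" for i j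
  proof -
    have "norm (cf (g + h) i j) \<le> C * R ^ (i + j) + D * T ^ (i + j)"
      using 1(3)[of i j] 2(3)[of i j] norm_triangle_ineq[of "cf g i j" "cf h i j"] by simp
    also have "\<dots> \<le> C * (R * T) ^ (i + j) + D * (R * T) ^ (i + j)"
      using 1 2 by (intro add_mono mult_left_mono power_mono) (auto simp: mult_le_cancel_left1 mult_le_cancel_right1)
    finally show ?thesis by (simp add: algebra_simps)
  qed
  then show ?thesis unfolding convergent_series_iff using 1 2
    by (intro exI[of _ "C + D"] exI[of _ "R * T"]) auto
qed

lemma convergent_uminus: "convergent_series g \<Longrightarrow> convergent_series (- g)"
  by (simp add: convergent_series_iff)

lemma convergent_diff: "convergent_series g \<Longrightarrow> convergent_series h \<Longrightarrow> convergent_series (g - h)"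
  using convergent_add[of g "- h"] convergent_uminus[of h] by simp

lemma convergent_sum: "(\<And>x. x \<in> A \<Longrightarrow> convergent_series (f x)) \<Longrightarrow> convergent_series (sum f A)"
  by (induction A rule: infinite_finite_induct) (auto intro: convergent_0 convergent_add)

text \<open>A coefficient of the product is a sum of (i+1)(j+1) terms; this number is at most
  2^(i+j) and is absorbed by doubling the ratio.\<close>

lemma convergent_mult:
  assumes "convergent_series g" "convergent_series h"
  shows "convergent_series (g * h)"
proof -
  obtain C R where 1: "C \<ge> 0" "R \<ge> 1" "\<And>i j. norm (cf g i j) \<le> C * R ^ (i + j)"
    using convergent_seriesD[OF assms(1)] by blast
  obtain D T where 2: "D \<ge> 0" "T \<ge> 1" "\<And>i j. norm (cf h i j) \<le> D * T ^ (i + j)"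
    using convergent_seriesD[OF assms(2)] by blast
  have "norm (cf (g * h) i j) \<le> (C * D) * (2 * (R * T)) ^ (i + j)" for i j
  proof -
    have "norm (cf (g * h) i j) \<le> (\<Sum>p\<le>i. \<Sum>q\<le>j. norm (cf g p q * cf h (i - p) (j - q)))"
      unfolding cf_mult by (intro order.trans[OF norm_sum] sum_mono norm_sum)
    also have "\<dots> \<le> (\<Sum>p\<le>i. \<Sum>q\<le>j. C * D * (R * T) ^ (i + j))"
    proof (intro sum_mono)
      fix p q assume "p \<in> {..i}" "q \<in> {..j}"
      then have "R ^ (p + q) \<le> R ^ (i + j)" "T ^ ((i - p) + (j - q)) \<le> T ^ (i + j)"
        using 1(2) 2(2) by (auto intro!: power_increasing)
      then have "norm (cf g p q) \<le> C * R ^ (i + j)" "norm (cf h (i - p) (j - q)) \<le> D * T ^ (i + j)"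
        using 1(1) 2(1) 1(3)[of p q] 2(3)[of "i - p" "j - q"]
        by (meson mult_left_mono order.trans)+
      then have "norm (cf g p q) * norm (cf h (i - p) (j - q)) \<le> (C * R ^ (i + j)) * (D * T ^ (i + j))"
        using 1(1,2) by (intro mult_mono) auto
      then show "norm (cf g p q * cf h (i - p) (j - q)) \<le> C * D * (R * T) ^ (i + j)"
        by (simp add: norm_mult power_mult_distrib mult_ac)
    qed
    also have "\<dots> = real (Suc i) * real (Suc j) * (C * D * (R * T) ^ (i + j))"
      by simp
    also have "\<dots> \<le> (2 ^ i * 2 ^ j) * (C * D * (R * T) ^ (i + j))"
    proof (intro mult_right_mono mult_mono)
      have "real (Suc n) \<le> 2 ^ n" for n by (induction n) (auto simp: algebra_simps intro: order.trans)
      from this[of i] this[of j] show "real (Suc i) \<le> 2 ^ i" "real (Suc j) \<le> 2 ^ j" .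
    qed (use 1 2 in auto)
    finally show ?thesis by (simp add: power_mult_distrib power_add mult_ac)
  qed
  then show ?thesis unfolding convergent_series_iff using 1 2
    by (intro exI[of _ "C * D"] exI[of _ "2 * (R * T)"]) auto
qed

lemma convergent_power: "convergent_series g \<Longrightarrow> convergent_series (g ^ n)"
  by (induction n) (auto intro: convergent_1 convergent_mult)

lemma convergent_of_nat: "convergent_series (of_nat n)"
  using convergent_const[of "of_nat n"] by (simp add: const_series.simps)

lemma convergent_numeral: "convergent_series (numeral n)"
  using convergent_const[of "numeral n"] by (simp add: const_series.simps)

lemma convergent_ser_u: "convergent_series ser_u" and convergent_ser_v: "convergent_series ser_v"
  using convergent_mono[of 1 0] convergent_mono[of 0 1] by (simp_all add: mono_def)

lemmas convergent_intros = convergent_const convergent_mono convergent_0 convergent_1 convergent_add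
  convergent_uminus convergent_diff convergent_sum convergent_mult convergent_power convergent_of_nat
  convergent_numeral convergent_ser_u convergent_ser_v

text \<open>Majorant method: the equation g h = 1 determines the coefficients of h recursively, and
  a bound T^(i+j) reproduces itself under the recursion when T is large compared with the growth of
  g.\<close>

lemma convergent_inverse:
  assumes g: "convergent_series g" and 0: "cf g 0 0 = 1" and gh: "g * h = 1"
  shows "convergent_series h"
proof -
  obtain C R where C: "C \<ge> 0" "R \<ge> 1" "\<And>i j. norm (cf g i j) \<le> C * R ^ (i + j)"
    using convergent_seriesD[OF g] by blast
  \<comment> \<open>This q satisfies q at most 1/2 and 6 C q at most 1. The first makes the double
    geometric sum without its leading term at most 6 q, the second closes the induction.\<close>
  define q where "q = 1 / (6 * C + 2)"
  define T where "T = R / q"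
  have q: "0 < q" "q \<le> 1 / 2" "6 * C * q \<le> 1"
    using C(1) by (simp_all add: q_def field_simps)
  have T: "T > 0" and RT: "R = q * T" using C(2) q by (simp_all add: T_def)
  have geo: "(\<Sum>i\<le>n. q ^ i) \<le> 1 + 2 * q" for n
  proof -
    have "(\<Sum>i\<le>n. q ^ i) * (1 - q) = 1 - q ^ Suc n" using q by (simp add: sum_gp0)
    also have "\<dots> \<le> 1" using q by simp
    also have "1 \<le> (1 + 2 * q) * (1 - q)" using q by (simp add: algebra_simps mult_left_mono[of q "1/2" q, simplified])
    finally show ?thesis using q by simp
  qed
  have "norm (cf h i j) \<le> T ^ (i + j)" for i j
  proof (induction "i + j" arbitrary: i j rule: less_induct)
    case less
    define S where "S = ({..i} \<times> {..j}) - {(0, 0)}"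
    have ins: "{..i} \<times> {..j} = insert (0, 0) S" "(0, 0) \<notin> S" "finite S"
      unfolding S_def by auto
    have "cf (g * h) i j = (\<Sum>(p, r)\<in>{..i} \<times> {..j}. cf g p r * cf h (i - p) (j - r))"
      unfolding cf_mult by (rule sum.cartesian_product)
    also have "\<dots> = cf h i j + (\<Sum>(p, r)\<in>S. cf g p r * cf h (i - p) (j - r))"
      unfolding ins(1) using ins(2,3) 0 by simp
    finally have e: "cf h i j = cf 1 i j - (\<Sum>(p, r)\<in>S. cf g p r * cf h (i - p) (j - r))"
      unfolding gh by simp
    show ?case
    proof (cases "i = 0 \<and> j = 0")
      case True
      then have "S = {}" unfolding S_def by auto
      then show ?thesis unfolding e using True by (simp add: cf_one)
    next
      case False
      then have "cf 1 i j = 0" by (simp add: cf_one)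
      then have "norm (cf h i j) = norm (\<Sum>(p, r)\<in>S. cf g p r * cf h (i - p) (j - r))"
        unfolding e by simp
      also have "\<dots> \<le> (\<Sum>(p, r)\<in>S. norm (cf g p r * cf h (i - p) (j - r)))"
        by (rule order.trans[OF norm_sum]) (simp add: split_beta)
      also have "\<dots> \<le> (\<Sum>(p, r)\<in>S. C * T ^ (i + j) * (q ^ p * q ^ r))"
      proof (intro sum_mono, clarify)
        fix p r assume pr: "(p, r) \<in> S"
        then have "p \<le> i" "r \<le> j" "p + r > 0" unfolding S_def by auto
        then have "norm (cf h (i - p) (j - r)) \<le> T ^ (i - p + (j - r))" by (intro less) auto
        then have "norm (cf g p r * cf h (i - p) (j - r)) \<le> (C * R ^ (p + r)) * T ^ (i - p + (j - r))"
          unfolding norm_mult using C by (intro mult_mono) auto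
        also have "\<dots> = C * (q ^ p * q ^ r) * (T ^ (p + r) * T ^ (i - p + (j - r)))"
          unfolding RT by (simp add: power_mult_distrib power_add)
        also have "T ^ (p + r) * T ^ (i - p + (j - r)) = T ^ (i + j)"
          using \<open>p \<le> i\<close> \<open>r \<le> j\<close> by (simp flip: power_add)
        finally show "norm (cf g p r * cf h (i - p) (j - r)) \<le> C * T ^ (i + j) * (q ^ p * q ^ r)"
          by (simp add: mult_ac)
      qed
      also have "\<dots> = C * T ^ (i + j) * (\<Sum>(p, r)\<in>S. q ^ p * q ^ r)"
        by (simp add: sum_distrib_left split_beta)
      also have "(\<Sum>(p, r)\<in>S. q ^ p * q ^ r) = (\<Sum>p\<le>i. q ^ p) * (\<Sum>r\<le>j. q ^ r) - 1"
      proof -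
        have "(\<Sum>(p, r)\<in>{..i} \<times> {..j}. q ^ p * q ^ r) = (\<Sum>p\<le>i. q ^ p) * (\<Sum>r\<le>j. q ^ r)"
          by (simp add: sum.cartesian_product[symmetric] sum_product)
        then show ?thesis unfolding ins(1) using ins(2,3) by simp
      qed
      also have "C * T ^ (i + j) * ((\<Sum>p\<le>i. q ^ p) * (\<Sum>r\<le>j. q ^ r) - 1) \<le> C * T ^ (i + j) * (6 * q)"
      proof (intro mult_left_mono)
        have "(\<Sum>p\<le>i. q ^ p) * (\<Sum>r\<le>j. q ^ r) \<le> (1 + 2 * q) * (1 + 2 * q)"
          using geo q by (intro mult_mono sum_nonneg) auto
        also have "\<dots> \<le> 1 + 6 * q" using q by (simp add: algebra_simps mult_left_mono[of q "1/2" q, simplified])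
        finally show "(\<Sum>p\<le>i. q ^ p) * (\<Sum>r\<le>j. q ^ r) - 1 \<le> 6 * q" by simp
      qed (use C T in auto)
      also have "\<dots> = (6 * C * q) * T ^ (i + j)" by simp
      also have "\<dots> \<le> 1 * T ^ (i + j)" using q T by (intro mult_right_mono) auto
      finally show ?thesis by simp
    qed
  qed
  then show ?thesis unfolding convergent_series_iff using T by (intro exI[of _ 1] exI[of _ T]) auto
qed

text \<open>A formal inverse exists as soon as the constant coefficient is nonzero; the point is its
  convergence, which is reduced to constant coefficient 1 by scaling.\<close>

lemma convergent_unit:
  assumes "convergent_series g" "cf g 0 0 \<noteq> 0"
  obtains h where "convergent_series h" "g * h = 1"
proof -
  define c where "c = const_series (inverse (cf g 0 0))"
  have c: "convergent_series c" unfolding c_def by (rule convergent_const)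
  have "fps_nth (fps_nth g 0) 0 \<noteq> 0" using assms(2) by (simp add: cf_def)
  then have "inverse (fps_nth g 0) * fps_nth g 0 = 1" by (rule inverse_mult_eq_1)
  then have "fps_nth g 0 * inverse (fps_nth g 0) = 1" by (simp add: mult.commute)
  then have gh: "g * fps_right_inverse g (inverse (fps_nth g 0)) = 1"
    by (rule fps_right_inverse)
  then obtain h where h: "g * h = 1" by blast
  have "(c * g) * (const_series (cf g 0 0) * h) = (c * const_series (cf g 0 0)) * (g * h)" by simp
  also have "c * const_series (cf g 0 0) = 1"
    unfolding c_def const_series.mult[symmetric] using assms(2) by (simp add: const_series.one)
  finally have "(c * g) * (const_series (cf g 0 0) * h) = 1" using h by simp
  moreover have "cf (c * g) 0 0 = 1" unfolding c_def using assms(2) by simp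
  ultimately have "convergent_series (const_series (cf g 0 0) * h)"
    using convergent_mult[OF c assms(1)] convergent_inverse by blast
  then have "convergent_series (c * (const_series (cf g 0 0) * h))" by (rule convergent_mult[OF c])
  moreover have "c * (const_series (cf g 0 0) * h) = h"
    unfolding c_def mult.assoc[symmetric] const_series.mult[symmetric] using assms(2)
    by (simp add: const_series.one)
  ultimately show ?thesis using that h by simp
qed

lemma local_ring_simps:
  "x \<in> carrier local_ring \<longleftrightarrow> convergent_series x"
  "x \<otimes>\<^bsub>local_ring\<^esub> y = x * y" "x \<oplus>\<^bsub>local_ring\<^esub> y = x + y" "\<zero>\<^bsub>local_ring\<^esub> = 0" "\<one>\<^bsub>local_ring\<^esub> = 1"
  by (simp_all add: local_ring_def ring_of_type_algebra_def)

lemma domain_local_ring: "domain local_ring"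
proof -
  have "\<exists>y\<in>{g. convergent_series g}. y + x = 0 \<and> x + y = 0" if "convergent_series x" for x
    using convergent_uminus[OF that] by (intro bexI[of _ "- x"]) auto
  then have "cring local_ring"
    by unfold_locales
      (auto simp: local_ring_def ring_of_type_algebra_def Units_def algebra_simps intro!: convergent_intros)
  then show ?thesis
    by (intro domain.intro domain_axioms.intro) (auto simp: local_ring_simps)
qed

interpretation local_ring: domain local_ring
  by (rule domain_local_ring)

lemma Units_local_ring: "g \<in> Units local_ring \<longleftrightarrow> convergent_series g \<and> cf g 0 0 \<noteq> 0"
proof
  assume "g \<in> Units local_ring"
  then obtain h where "g * h = 1" and g: "convergent_series g"
    unfolding Units_def local_ring_simps by auto
  then have "cf (g * h) 0 0 = 1" by (simp add: cf_one)
  then have "cf g 0 0 * cf h 0 0 = 1" by (simp add: cf_mult)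
  with g show "convergent_series g \<and> cf g 0 0 \<noteq> 0" by auto
next
  assume "convergent_series g \<and> cf g 0 0 \<noteq> 0"
  then obtain h where "convergent_series h" "g * h = 1" using convergent_unit by blast
  then show "g \<in> Units local_ring" using \<open>convergent_series g \<and> _\<close>
    unfolding Units_def by (auto simp: local_ring_simps mult.commute intro!: bexI[of _ h])
qed

lemma ring_irreducible_local_ringI:
  assumes "convergent_series g" "g \<noteq> 0" "cf g 0 0 = 0"
    and "\<And>a b. g = a * b \<Longrightarrow> cf a 0 0 = 0 \<Longrightarrow> cf b 0 0 = 0 \<Longrightarrow> False"
  shows "ring_irreducible\<^bsub>local_ring\<^esub> g"
  by (rule local_ring.ring_irreducibleI)
    (use assms in \<open>auto simp: local_ring_simps Units_local_ring\<close>)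

section \<open>Substitution of power series in one variable\<close>

definition tri :: "nat \<Rightarrow> (nat \<times> nat) set" where
  "tri n = {(i, j). i + j \<le> n}"

lemma finite_tri: "finite (tri n)"
  by (rule finite_subset[of _ "{..n} \<times> {..n}"]) (auto simp: tri_def)

text \<open>When both substituted series have zero constant term, \<alpha>^i \<beta>^j has order at
  least i + j, so that the triangle captures every contribution to the coefficient n. This avoids
  infinite sums.\<close>

definition subst_series :: "complex fps \<Rightarrow> complex fps \<Rightarrow> series2 \<Rightarrow> complex fps" where
  "subst_series \<alpha> \<beta> g = Abs_fps (\<lambda>n. \<Sum>(i, j)\<in>tri n. cf g i j * fps_nth (\<alpha> ^ i * \<beta> ^ j) n)"

context
  fixes \<alpha> \<beta> :: "complex fps"
  assumes \<alpha>: "fps_nth \<alpha> 0 = 0" and \<beta>: "fps_nth \<beta> 0 = 0"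
begin

lemma power_mult_nth_0:
  assumes "n < i + j"
  shows "fps_nth (\<alpha> ^ i * \<beta> ^ j) n = 0"
  unfolding fps_mult_nth
proof (rule sum.neutral, rule ballI)
  fix p assume "p \<in> {0..n}"
  then have "p < i \<or> n - p < j" using assms by auto
  then show "fps_nth (\<alpha> ^ i) p * fps_nth (\<beta> ^ j) (n - p) = 0"
    using startsby_zero_power_prefix[OF \<alpha>, of i] startsby_zero_power_prefix[OF \<beta>, of j] by auto
qed

lemma subst_series_nth:
  assumes "finite S" "tri n \<subseteq> S"
  shows "fps_nth (subst_series \<alpha> \<beta> g) n = (\<Sum>(i, j)\<in>S. cf g i j * fps_nth (\<alpha> ^ i * \<beta> ^ j) n)"
proof -
  have "fps_nth (\<alpha> ^ i * \<beta> ^ j) n = 0" if "(i, j) \<notin> tri n" for i j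
    using that by (intro power_mult_nth_0) (auto simp: tri_def)
  then show ?thesis
    unfolding subst_series_def fps_nth_Abs_fps using assms
    by (intro sum.mono_neutral_left) auto
qed

lemma subst_series_add: "subst_series \<alpha> \<beta> (g + h) = subst_series \<alpha> \<beta> g + subst_series \<alpha> \<beta> h"
  by (simp add: fps_eq_iff subst_series_def case_prod_unfold sum.distrib distrib_right)

lemma subst_series_const_mult: "subst_series \<alpha> \<beta> (const_series c * g) = fps_const c * subst_series \<alpha> \<beta> g"
  by (simp add: fps_eq_iff subst_series_def case_prod_unfold sum_distrib_left mult.assoc)

lemma subst_series_0: "subst_series \<alpha> \<beta> 0 = 0"
  by (simp add: fps_eq_iff subst_series_def case_prod_unfold)

lemma subst_series_sum: "subst_series \<alpha> \<beta> (sum f A) = (\<Sum>x\<in>A. subst_series \<alpha> \<beta> (f x))"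
  by (induction A rule: infinite_finite_induct) (simp_all add: subst_series_0 subst_series_add)

lemma subst_series_mono: "subst_series \<alpha> \<beta> (mono i j) = \<alpha> ^ i * \<beta> ^ j"
proof (rule fps_ext)
  fix n
  have "fps_nth (subst_series \<alpha> \<beta> (mono i j)) n =
      (\<Sum>x\<in>insert (i, j) (tri n). if x = (i, j) then fps_nth (\<alpha> ^ i * \<beta> ^ j) n else 0)"
    unfolding subst_series_nth[of "insert (i, j) (tri n)", OF finite.insertI[OF finite_tri] subset_insertI]
    by (intro sum.cong refl) (auto simp: cf_mono split: if_splits)
  then show "fps_nth (subst_series \<alpha> \<beta> (mono i j)) n = fps_nth (\<alpha> ^ i * \<beta> ^ j) n"
    by (simp add: finite_tri sum.delta)
qed

lemma subst_series_cong:
  assumes "\<And>i j. i + j \<le> n \<Longrightarrow> cf g i j = cf h i j" "m \<le> n"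
  shows "fps_nth (subst_series \<alpha> \<beta> g) m = fps_nth (subst_series \<alpha> \<beta> h) m"
  unfolding subst_series_def fps_nth_Abs_fps
  using assms by (intro sum.cong) (auto simp: tri_def)

text \<open>The coefficient n depends only on the coefficients of g and h in degrees at most n, so
  both may be truncated to finite sums of monomials, where multiplicativity is bilinear.\<close>

lemma subst_series_mult: "subst_series \<alpha> \<beta> (g * h) = subst_series \<alpha> \<beta> g * subst_series \<alpha> \<beta> h"
proof (rule fps_ext)
  fix n
  let ?s = "subst_series \<alpha> \<beta>" and ?g = "part (tri n) g" and ?h = "part (tri n) h"
  have "cf (g * h) i j = cf (?g * ?h) i j" if "i + j \<le> n" for i j
    unfolding cf_mult using that by (intro sum.cong) (auto simp: tri_def)
  then have "fps_nth (?s (g * h)) n = fps_nth (?s (?g * ?h)) n"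
    by (intro subst_series_cong) auto
  also have "?s (?g * ?h) = ?s ?g * ?s ?h"
  proof -
    have "const_series c * mono i j * (const_series d * mono p q) = const_series (c * d) * mono (i + p) (j + q)"
      for c d i j p q
      by (simp add: const_series.mult mult_ac flip: mono_mult)
    then have "?s (const_series c * mono i j * (const_series d * mono p q)) =
        ?s (const_series c * mono i j) * ?s (const_series d * mono p q)" for c d i j p q
      by (simp add: subst_series_const_mult subst_series_mono power_add mult_ac flip: fps_const_mult)
    then show ?thesis
      unfolding part_finite[OF finite_tri] sum_product subst_series_sum case_prod_unfold by simp
  qed
  also have "fps_nth (?s ?g * ?s ?h) n = fps_nth (?s g * ?s h) n"
    unfolding fps_mult_nth
  proof (rule sum.cong[OF refl])
    fix p assume "p \<in> {0..n}"
    then have "fps_nth (?s ?g) p = fps_nth (?s g) p" "fps_nth (?s ?h) (n - p) = fps_nth (?s h) (n - p)"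
      by (auto intro!: subst_series_cong[of n] simp: tri_def)
    then show "fps_nth (?s ?g) p * fps_nth (?s ?h) (n - p) = fps_nth (?s g) p * fps_nth (?s h) (n - p)"
      by simp
  qed
  finally show "fps_nth (?s (g * h)) n = fps_nth (?s g * ?s h) n" .
qed

lemma comm_ring_hom_subst_series: "comm_ring_hom (subst_series \<alpha> \<beta>)"
  using subst_series_mono[of 0 0]
  by unfold_locales (simp_all add: subst_series_add subst_series_mult mono_def)

lemma subst_series_vars: "subst_series \<alpha> \<beta> ser_u = \<alpha>" "subst_series \<alpha> \<beta> ser_v = \<beta>"
  using subst_series_mono[of 1 0] subst_series_mono[of 0 1] by (simp_all add: mono_def)

end

section \<open>The two cusps\<close>

definition eq_p :: "nat \<Rightarrow> series2" where
  "eq_p k = (ser_v ^ (k - 1) + ser_u ^ k) ^ 2 * ser_v - ser_u ^ (2 * k + 1)"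

definition eq_q :: "nat \<Rightarrow> series2" where
  "eq_q k = (ser_v + ser_u ^ k) ^ 2 - ser_u ^ (2 * k + 1)"

lemma local_equation_p: "local_equation (curve_C k) (0, 0, 1) = eq_p k"
proof -
  interpret E: comm_ring_hom "\<lambda>f. eval3 const_series f q" for q
    by (intro comm_ring_hom_eval3 comm_ring_hom_const_series)
  have c: "affine_chart const_series (0, 0, 1) fps_X (fps_const fps_X) = (ser_u, ser_v, 1)"
    by (simp add: affine_chart_def ser_u_def ser_v_def const_series.zero)
  show ?thesis
    unfolding local_equation_def c curve_C_def E.simps eval3_vars[OF comm_ring_hom_const_series]
      eq_p_def mult_1_right ..
qed

lemma local_equation_q: "local_equation (curve_C k) (0, 1, 0) = eq_q k"
proof -
  interpret E: comm_ring_hom "\<lambda>f. eval3 const_series f q" for q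
    by (intro comm_ring_hom_eval3 comm_ring_hom_const_series)
  have c: "affine_chart const_series (0, 1, 0) fps_X (fps_const fps_X) = (ser_u, 1, ser_v)"
    by (simp add: affine_chart_def ser_u_def ser_v_def const_series.zero)
  show ?thesis
    unfolding local_equation_def c curve_C_def E.simps eval3_vars[OF comm_ring_hom_const_series]
      eq_q_def mult_1_right mult_1_left power_one ..
qed

lemma convergent_eq: "convergent_series (eq_p k)" "convergent_series (eq_q k)"
  unfolding eq_p_def eq_q_def by (intro convergent_intros)+

context
  fixes k :: nat
  assumes k: "k \<ge> 2"
begin

lemma eq_p_mono: "eq_p k = mono 0 (2 * k - 1) + const_series 2 * mono k k + mono (2 * k) 1 - mono (2 * k + 1) 0"
proof -
  have sq: "(a + b) ^ 2 * v - c = a ^ 2 * v + 2 * (b * (a * v)) + b ^ 2 * v - c" for a b c v :: series2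
    by (simp add: power2_eq_square algebra_simps)
  obtain n where n: "k = Suc n" using k by (metis Suc_le_D numeral_2_eq_2)
  have e: "(ser_v ^ (k - 1)) ^ 2 * ser_v = ser_v ^ (2 * k - 1)" "ser_v ^ (k - 1) * ser_v = ser_v ^ k"
    by (simp_all add: n mult.commute flip: power_mult)
  have e2: "(ser_u ^ k) ^ 2 = ser_u ^ (2 * k)"
    by (simp add: mult.commute flip: power_mult)
  show ?thesis
    unfolding eq_p_def mono_def sq e e2 const_series.numeral by simp
qed

lemma eq_q_mono: "eq_q k = mono 0 2 + const_series 2 * mono k 1 + mono (2 * k) 0 - mono (2 * k + 1) 0"
proof -
  have sq: "(v + b) ^ 2 - c = v ^ 2 + 2 * (b * v) + b ^ 2 - c" for b c v :: series2
    by (simp add: power2_eq_square algebra_simps)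
  have e: "(ser_u ^ k) ^ 2 = ser_u ^ (2 * k)"
    by (simp add: mult.commute flip: power_mult)
  show ?thesis
    unfolding eq_q_def mono_def sq e const_series.numeral by simp
qed

lemma cf_eq_p: "cf (eq_p k) i j =
    (if i = 0 \<and> j = 2 * k - 1 then 1 else 0) + 2 * (if i = k \<and> j = k then 1 else 0) +
    (if i = 2 * k \<and> j = 1 then 1 else 0) - (if i = 2 * k + 1 \<and> j = 0 then 1 else 0)"
  unfolding eq_p_mono by (simp add: cf_mono)

lemma cf_eq_q: "cf (eq_q k) i j =
    (if i = 0 \<and> j = 2 then 1 else 0) + 2 * (if i = k \<and> j = 1 then 1 else 0) +
    (if i = 2 * k \<and> j = 0 then 1 else 0) - (if i = 2 * k + 1 \<and> j = 0 then 1 else 0)"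
  unfolding eq_q_mono by (simp add: cf_mono)

lemma multiplicity_p: "multiplicity_at (curve_C k) (0, 0, 1) = 2 * k - 1"
  unfolding multiplicity_at_def local_equation_p cf_def[symmetric]
proof (rule Least_equality)
  show "\<exists>i j. i + j = 2 * k - 1 \<and> cf (eq_p k) i j \<noteq> 0"
    using k by (intro exI[of _ 0] exI[of _ "2 * k - 1"]) (simp add: cf_eq_p)
  fix n assume "\<exists>i j. i + j = n \<and> cf (eq_p k) i j \<noteq> 0"
  then show "2 * k - 1 \<le> n" using k by (auto simp: cf_eq_p split: if_splits)
qed

lemma multiplicity_q: "multiplicity_at (curve_C k) (0, 1, 0) = 2"
  unfolding multiplicity_at_def local_equation_q cf_def[symmetric]
proof (rule Least_equality)
  show "\<exists>i j. i + j = 2 \<and> cf (eq_q k) i j \<noteq> 0"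
    using k by (intro exI[of _ 0] exI[of _ 2]) (simp add: cf_eq_q)
  fix n assume "\<exists>i j. i + j = n \<and> cf (eq_q k) i j \<noteq> 0"
  then show "2 \<le> n" using k by (auto simp: cf_eq_q split: if_splits)
qed

lemma cuspidal_type_curve_C: "cuspidal_type (curve_C k) (2 * k + 1) (2 * k - 1)"
proof -
  have "curve_C k \<noteq> 0"
    using value3_curve_C[of k 1 0 0] k by (auto simp: value3.simps power_0_left)
  moreover have "Max (multiplicity_at (curve_C k) ` {(0, 0, 1), (0, 1, 0)}) = 2 * k - 1"
    using k by (simp add: multiplicity_p multiplicity_q)
  ultimately show ?thesis
    unfolding cuspidal_type_def singular_points_curve_C[OF k]
    using homogeneous_curve_C[OF k] by simp
qed

text \<open>
  A factor of the local equation without constant term restricts to the v-axis with positive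
  order, smaller than that of the local equation.
\<close>

lemma factor_v_axis:
  assumes g: "g = a * b" "cf a 0 0 = 0" "cf b 0 0 = 0"
    and "\<And>j. cf g 0 j = (if j = N then 1 else 0)"
  shows "\<exists>j<N. cf a 0 j \<noteq> 0"
proof -
  have "fps_nth g 0 = fps_X ^ N"
    using assms(4) by (simp add: fps_eq_iff cf_def)
  moreover have "fps_nth g 0 = fps_nth a 0 * fps_nth b 0"
    unfolding g by simp
  ultimately have e: "fps_nth a 0 * fps_nth b 0 = fps_X ^ N" by simp
  then have nz: "fps_nth a 0 \<noteq> 0" "fps_nth b 0 \<noteq> 0" by auto
  then have "subdegree (fps_nth a 0) + subdegree (fps_nth b 0) = N"
    using arg_cong[OF e, of subdegree] by simp
  moreover have "subdegree (fps_nth b 0) > 0"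
    using g(3) nz by (simp add: cf_def subdegree_eq_0_iff neq0_conv[symmetric] del: neq0_conv)
  ultimately have "subdegree (fps_nth a 0) < N" by simp
  moreover have "cf a 0 (subdegree (fps_nth a 0)) \<noteq> 0"
    unfolding cf_def using nz by simp
  ultimately show ?thesis by blast
qed

text \<open>The equation vanishes along a parametrized branch. In a product of two nonunits each
  factor has a nonzero coefficient of v, and this is the coefficient of t^(2k+1) in its restriction
  to the branch: pure powers of u contribute even exponents only, all other terms have larger order.
  So neither restriction vanishes, a contradiction in a domain.\<close>

lemma is_cusp_q: "is_cusp (curve_C k) (0, 1, 0)"
proof -
  define \<alpha> :: "complex fps" where "\<alpha> = fps_X ^ 2"
  \<comment> \<open>Solves v + u^k = t^(2k+1), a square root of u^(2k+1) for u = t^2.\<close>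
  define \<beta> :: "complex fps" where "\<beta> = fps_X ^ (2 * k) * (fps_X - 1)"
  have 0: "fps_nth \<alpha> 0 = 0" "fps_nth \<beta> 0 = 0" using k by (simp_all add: \<alpha>_def \<beta>_def)
  interpret s: comm_ring_hom "subst_series \<alpha> \<beta>" by (rule comm_ring_hom_subst_series[OF 0])
  have "\<beta> + \<alpha> ^ k = fps_X ^ (2 * k + 1)"
    unfolding \<alpha>_def \<beta>_def power_mult[symmetric] by (simp add: right_diff_distrib)
  moreover have "subst_series \<alpha> \<beta> (eq_q k) = (\<beta> + \<alpha> ^ k) ^ 2 - \<alpha> ^ (2 * k + 1)"
    unfolding eq_q_def s.simps subst_series_vars[OF 0] ..
  moreover have "\<alpha> ^ (2 * k + 1) = (fps_X ^ (2 * k + 1)) ^ 2"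
    unfolding \<alpha>_def power_mult[symmetric] by (simp only: mult.commute)
  ultimately have "subst_series \<alpha> \<beta> (eq_q k) = 0" by simp
  moreover have nz: "subst_series \<alpha> \<beta> a \<noteq> 0" if a: "cf a 0 0 = 0" "cf a 0 1 \<noteq> 0" for a
  proof -
    have nth: "fps_nth (\<alpha> ^ i * \<beta> ^ j) (2 * k + 1) = (if i = 0 \<and> j = 1 then 1 else 0)"
      if "(i, j) \<noteq> (0, 0)" for i j
    proof -
      have e: "\<alpha> ^ i * \<beta> ^ j = fps_X ^ (2 * i + 2 * k * j) * (fps_X - 1) ^ j"
        unfolding \<alpha>_def \<beta>_def by (simp add: power_mult_distrib power_add flip: power_mult)
      consider "j = 0" | "j = 1" | "j \<ge> 2" by linarith
      then show ?thesis
      proof cases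
        case 1
        then show ?thesis unfolding e by (simp add: fps_X_power_nth) presburger
      next
        case 2
        then show ?thesis unfolding e
          by (cases "i = 0") (simp_all add: fps_X_power_mult_nth)
      next
        case 3
        then have "2 * k * 2 \<le> 2 * k * j" by (intro mult_le_mono2)
        then have "2 * k + 1 < 2 * i + 2 * k * j" using k by linarith
        then show ?thesis unfolding e using 3 by (simp add: fps_X_power_mult_nth)
      qed
    qed
    have c: "cf a i j * fps_nth (\<alpha> ^ i * \<beta> ^ j) (2 * k + 1) = (if (i, j) = (0, 1) then cf a 0 1 else 0)" for i j
    proof (cases "(i, j) = (0, 0)")
      case True
      then show ?thesis using a(1) by simp
    next
      case False
      show ?thesis unfolding nth[OF False] by simp
    qed
    have "fps_nth (subst_series \<alpha> \<beta> a) (2 * k + 1) =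
        (\<Sum>x\<in>tri (2 * k + 1). if x = (0, 1) then cf a 0 1 else 0)"
      unfolding subst_series_def fps_nth_Abs_fps
      by (intro sum.cong refl) (clarify, simp only: prod.case c)
    also have "\<dots> = cf a 0 1" by (simp add: finite_tri sum.delta) (simp add: tri_def)
    finally show ?thesis using a(2) by auto
  qed
  have "ring_irreducible\<^bsub>local_ring\<^esub> (eq_q k)"
  proof (rule ring_irreducible_local_ringI[OF convergent_eq(2)])
    show "eq_q k \<noteq> 0" using cf_eq_q[of 0 2] k by auto
    show "cf (eq_q k) 0 0 = 0" using k by (simp add: cf_eq_q)
    fix a b assume ab: "eq_q k = a * b" "cf a 0 0 = 0" "cf b 0 0 = 0"
    have axis: "cf (eq_q k) 0 j = (if j = 2 then 1 else 0)" for j using k by (simp add: cf_eq_q)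
    have "\<exists>j<2. cf a 0 j \<noteq> 0" "\<exists>j<2. cf b 0 j \<noteq> 0"
      using factor_v_axis[OF ab axis] factor_v_axis[OF _ ab(3,2) axis] ab(1) by (simp_all add: mult.commute)
    then have "cf a 0 1 \<noteq> 0" "cf b 0 1 \<noteq> 0" using ab(2,3) by (auto simp: less_2_cases_iff)
    then have "subst_series \<alpha> \<beta> a * subst_series \<alpha> \<beta> b \<noteq> 0" using nz ab(2,3) by simp
    then show False using \<open>subst_series \<alpha> \<beta> (eq_q k) = 0\<close> unfolding ab(1) s.mult by simp
  qed
  then show ?thesis
    unfolding is_cusp_def local_equation_q singular_points_curve_C[OF k] by simp
qed

lemma coprime_2k: "coprime (2 * k + 1) (2 * k - 1)"
proof -
  have e: "2 * k + 1 = 2 + (2 * k - 1)" using k by simp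
  have "odd (2 * k - 1)" using k by simp
  then have "coprime 2 (2 * k - 1)" by simp
  then show ?thesis unfolding e coprime_iff_gcd_eq_1 gcd_add1 .
qed

text \<open>As the weights are coprime, two exponent pairs of equal weight differ by a multiple of
  (2k+1, -(2k-1)), which is impossible below the weight (2k-1)(2k+1).\<close>

lemma weight_p_unique:
  assumes "(2 * k - 1) * i + (2 * k + 1) * j = (2 * k - 1) * i' + (2 * k + 1) * j'"
    and "(2 * k - 1) * i + (2 * k + 1) * j < (2 * k - 1) * (2 * k + 1)"
  shows "i = i' \<and> j = j'"
  using assms
proof (induction j j' arbitrary: i i' rule: linorder_wlog)
  case (le j j')
  have "(2 * k + 1) * j \<le> (2 * k + 1) * j'" using le(1) by (rule mult_le_mono2)
  then have "(2 * k - 1) * i' \<le> (2 * k - 1) * i" using le(2) by linarith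
  then have "i' \<le> i" using k by simp
  then obtain d e where d: "i = i' + d" "j' = j + e" using le(1) by (metis le_Suc_ex)
  with le(2) have "(2 * k - 1) * d = (2 * k + 1) * e" by (simp add: add_mult_distrib2)
  then have "(2 * k + 1) dvd (2 * k - 1) * d" by (simp only: dvd_triv_left)
  then have "(2 * k + 1) dvd d" unfolding coprime_dvd_mult_right_iff[OF coprime_2k] .
  moreover have "d < 2 * k + 1"
  proof -
    have "(2 * k - 1) * d < (2 * k - 1) * (2 * k + 1)" using le(3) unfolding d by (simp add: add_mult_distrib2)
    then show ?thesis by (simp only: mult_less_cancel1)
  qed
  ultimately have "d = 0" by (auto dest: dvd_imp_le)
  then have "e = 0" using \<open>(2 * k - 1) * d = (2 * k + 1) * e\<close> by simp
  with \<open>d = 0\<close> show ?case unfolding d by simp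
next
  case (sym j j')
  then show ?case by metis
qed

text \<open>The branch has orders 2k-1 and 2k+1 in its coordinates. A proper factor has order less
  than 2k-1 on the v-axis, hence a term of weight below (2k-1)(2k+1); its term of least weight is
  unique and survives on the branch.\<close>

lemma is_cusp_p: "is_cusp (curve_C k) (0, 0, 1)"
proof -
  \<comment> \<open>This is 1/(1-t): the normalization of the curve is divided by its last
    coordinate 1 - t to obtain affine coordinates.\<close>
  define e :: "complex fps" where "e = Abs_fps (\<lambda>_. 1)"
  have e: "e = 1 + fps_X * e"
    unfolding e_def fps_eq_iff by (simp add: fps_X_mult_nth)
  have e0: "fps_nth (e ^ n) 0 = 1" for n by (simp add: e_def fps_nth_power_0)
  define \<alpha> :: "complex fps" where "\<alpha> = fps_X ^ (2 * k - 1) * e"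
  define \<beta> :: "complex fps" where "\<beta> = fps_X ^ (2 * k + 1) * e"
  have 0: "fps_nth \<alpha> 0 = 0" "fps_nth \<beta> 0 = 0" using k by (simp_all add: \<alpha>_def \<beta>_def)
  interpret s: comm_ring_hom "subst_series \<alpha> \<beta>" by (rule comm_ring_hom_subst_series[OF 0])
  have "subst_series \<alpha> \<beta> (eq_p k) = 0"
  proof -
    have pw: "(fps_X ^ a * e ^ b) ^ 2 * (fps_X ^ c * e) - (fps_X ^ d * e) ^ m =
        fps_X ^ (a * 2 + c) * e ^ (b * 2 + 1) - fps_X ^ (d * m) * e ^ m" for a b c d m
      by (simp add: power_mult_distrib power_add power_mult)
    obtain n where n: "k = n + 1" using k by (metis Suc_eq_plus1 Suc_le_D numeral_2_eq_2)
    have "\<beta> ^ (k - 1) + \<alpha> ^ k = fps_X ^ ((2 * k + 1) * n) * e ^ n * (1 + fps_X * e)"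
    proof -
      have "(2 * k - 1) * k = (2 * k + 1) * n + 1" unfolding n by (simp add: algebra_simps)
      then show ?thesis
        unfolding \<alpha>_def \<beta>_def power_mult_distrib power_mult[symmetric]
        by (simp add: n algebra_simps)
    qed
    also have "\<dots> = fps_X ^ ((2 * k + 1) * n) * e ^ k"
      unfolding e[symmetric] by (simp add: n)
    finally have "subst_series \<alpha> \<beta> (eq_p k) =
        (fps_X ^ ((2 * k + 1) * n) * e ^ k) ^ 2 * (fps_X ^ (2 * k + 1) * e) - (fps_X ^ (2 * k - 1) * e) ^ (2 * k + 1)"
      unfolding eq_p_def s.simps subst_series_vars[OF 0] by (simp only: \<alpha>_def \<beta>_def)
    also have "\<dots> = fps_X ^ ((2 * k + 1) * n * 2 + (2 * k + 1)) * e ^ (k * 2 + 1) - fps_X ^ ((2 * k - 1) * (2 * k + 1)) * e ^ (2 * k + 1)"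
      by (rule pw)
    also have "(2 * k + 1) * n * 2 + (2 * k + 1) = (2 * k - 1) * (2 * k + 1)"
      unfolding n by (simp add: algebra_simps)
    finally show ?thesis by (simp add: mult.commute)
  qed
  moreover have nz: "subst_series \<alpha> \<beta> a \<noteq> 0" if a: "cf a 0 j \<noteq> 0" "j < 2 * k - 1" for a j
  proof -
    define w where "w = (\<lambda>(i, j). (2 * k - 1) * i + (2 * k + 1) * j)"
    \<comment> \<open>A term of least weight; since its weight is below the product of the two
      weights, no other term of \<open>a\<close> can cancel it on the branch.\<close>
    obtain pq where pq: "cf a (fst pq) (snd pq) \<noteq> 0"
      and min: "\<And>x. cf a (fst x) (snd x) \<noteq> 0 \<Longrightarrow> w pq \<le> w x"
      using ex_has_least_nat[of "\<lambda>x. cf a (fst x) (snd x) \<noteq> 0" "(0, j)" w] a(1) by auto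
    obtain p q where pq': "pq = (p, q)" by (cases pq)
    define W where "W = w (p, q)"
    have "W \<le> w (0, j)" using min[of "(0, j)"] a(1) unfolding W_def pq' by simp
    also have "\<dots> < (2 * k - 1) * (2 * k + 1)"
      using a(2) unfolding w_def by (simp del: mult_Suc mult_Suc_right add: mult.commute)
    finally have W: "W < (2 * k - 1) * (2 * k + 1)" .
    have "cf a i j * fps_nth (\<alpha> ^ i * \<beta> ^ j) W = (if (i, j) = (p, q) then cf a p q else 0)" for i j
    proof -
      have c: "fps_nth (\<alpha> ^ i * \<beta> ^ j) W = (if W < w (i, j) then 0 else fps_nth (e ^ (i + j)) (W - w (i, j)))"
      proof -
        have "(fps_X ^ r * e) ^ i * (fps_X ^ t * e) ^ j = fps_X ^ (r * i + t * j) * e ^ (i + j)" for r t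
          by (simp add: power_mult_distrib power_add power_mult)
        then have "\<alpha> ^ i * \<beta> ^ j = fps_X ^ w (i, j) * e ^ (i + j)"
          unfolding \<alpha>_def \<beta>_def w_def prod.case .
        then show ?thesis by (simp add: fps_X_power_mult_nth)
      qed
      consider "cf a i j = 0" | "W < w (i, j)" | "cf a i j \<noteq> 0" "w (i, j) \<le> W" by linarith
      then show ?thesis
      proof cases
        case 1
        then show ?thesis using pq unfolding pq' by auto
      next
        case 2
        then show ?thesis using c unfolding W_def by auto
      next
        case 3
        then have "w (i, j) = W" using min[of "(i, j)"] unfolding pq' W_def by simp
        then have "p = i \<and> q = j"
          using weight_p_unique[of p q i j] W unfolding W_def w_def by simp
        then show ?thesis using c \<open>w (i, j) = W\<close> e0 by simp
      qed
    qed
    then have "fps_nth (subst_series \<alpha> \<beta> a) W = (\<Sum>x\<in>tri W. if x = (p, q) then cf a p q else 0)"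
      unfolding subst_series_def fps_nth_Abs_fps by (intro sum.cong refl) (clarify, simp only: prod.case)
    also have "\<dots> = cf a p q"
    proof -
      have "(p, q) \<in> tri W"
        unfolding tri_def W_def w_def mem_Collect_eq prod.case
        using add_mono[OF mult_le_mono1[of 1 "2 * k - 1" p] mult_le_mono1[of 1 "2 * k + 1" q]] k by simp
      then show ?thesis by (simp add: finite_tri sum.delta)
    qed
    finally show ?thesis using pq unfolding pq' by auto
  qed
  have "ring_irreducible\<^bsub>local_ring\<^esub> (eq_p k)"
  proof (rule ring_irreducible_local_ringI[OF convergent_eq(1)])
    show "eq_p k \<noteq> 0" using cf_eq_p[of 0 "2 * k - 1"] k by auto
    show "cf (eq_p k) 0 0 = 0" using k by (simp add: cf_eq_p)
    fix a b assume ab: "eq_p k = a * b" "cf a 0 0 = 0" "cf b 0 0 = 0"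
    have axis: "cf (eq_p k) 0 j = (if j = 2 * k - 1 then 1 else 0)" for j using k by (simp add: cf_eq_p)
    have "\<exists>j<2 * k - 1. cf a 0 j \<noteq> 0" "\<exists>j<2 * k - 1. cf b 0 j \<noteq> 0"
      using factor_v_axis[OF ab axis] factor_v_axis[OF _ ab(3,2) axis] ab(1) by (simp_all add: mult.commute)
    then have "subst_series \<alpha> \<beta> a * subst_series \<alpha> \<beta> b \<noteq> 0" using nz by auto
    then show False using \<open>subst_series \<alpha> \<beta> (eq_p k) = 0\<close> unfolding ab(1) s.mult by simp
  qed
  then show ?thesis
    unfolding is_cusp_def local_equation_p singular_points_curve_C[OF k] by simp
qed

end

section \<open>Subrings of a commutative ring type\<close>

lemma type_algebra_simps:
  "carrier ring_of_type_algebra = UNIV" "x \<otimes>\<^bsub>ring_of_type_algebra\<^esub> y = x * y"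
  "x \<oplus>\<^bsub>ring_of_type_algebra\<^esub> y = x + y" "\<zero>\<^bsub>ring_of_type_algebra\<^esub> = 0" "\<one>\<^bsub>ring_of_type_algebra\<^esub> = 1"
  by (simp_all add: ring_of_type_algebra_def)

text \<open>The local ring, the Rees algebra and the polynomial ring over the symmetric algebra all
  arise by restricting the carrier of a ring type. The locale translates ideals and cosets of such
  rings into type class arithmetic once and for all.\<close>

locale subring_type =
  fixes C :: "'a::comm_ring_1 set"
  assumes C_closed: "0 \<in> C" "1 \<in> C" "x \<in> C \<Longrightarrow> y \<in> C \<Longrightarrow> x + y \<in> C"
    "x \<in> C \<Longrightarrow> y \<in> C \<Longrightarrow> x * y \<in> C" "x \<in> C \<Longrightarrow> - x \<in> C"
begin

abbreviation R :: "'a ring" where "R \<equiv> ring_of_type_algebra\<lparr>carrier := C\<rparr>"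

lemma R_simps':
  "carrier R = C" "x \<otimes>\<^bsub>R\<^esub> y = x * y" "x \<oplus>\<^bsub>R\<^esub> y = x + y" "\<zero>\<^bsub>R\<^esub> = 0" "\<one>\<^bsub>R\<^esub> = 1"
  by (simp_all add: ring_of_type_algebra_def)

lemmas R_simps = R_simps' type_algebra_simps

lemma C_diff: "x \<in> C \<Longrightarrow> y \<in> C \<Longrightarrow> x - y \<in> C"
  using C_closed(3)[of x "- y"] C_closed(5)[of y] by simp

lemma C_sum: "(\<And>i. i \<in> A \<Longrightarrow> f i \<in> C) \<Longrightarrow> sum f A \<in> C"
  by (induction A rule: infinite_finite_induct) (auto intro: C_closed)

lemma C_prod: "(\<And>i. i \<in> A \<Longrightarrow> f i \<in> C) \<Longrightarrow> prod f A \<in> C"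
  by (induction A rule: infinite_finite_induct) (auto intro: C_closed)

lemma C_power: "x \<in> C \<Longrightarrow> x ^ n \<in> C"
  by (induction n) (auto intro: C_closed)

lemma cring_R: "cring R"
proof -
  have "\<exists>y\<in>C. y + x = 0 \<and> x + y = 0" if "x \<in> C" for x
    using C_closed(5)[OF that] by (intro bexI[of _ "- x"]) auto
  then show ?thesis
    by unfold_locales (auto simp: ring_of_type_algebra_def Units_def algebra_simps intro!: C_closed)
qed

lemma R_minus: "x \<in> C \<Longrightarrow> \<ominus>\<^bsub>R\<^esub> x = - x"
proof -
  interpret cring R by (rule cring_R)
  show "x \<in> C \<Longrightarrow> \<ominus>\<^bsub>R\<^esub> x = - x"
    by (rule minus_equality) (auto simp: R_simps C_closed)
qed

lemma ideal_closed:
  assumes "ideal I R"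
  shows "x \<in> I \<Longrightarrow> x \<in> C" "0 \<in> I" "x \<in> I \<Longrightarrow> y \<in> I \<Longrightarrow> x + y \<in> I"
    "x \<in> I \<Longrightarrow> r \<in> C \<Longrightarrow> r * x \<in> I" "x \<in> I \<Longrightarrow> - x \<in> I" "x \<in> I \<Longrightarrow> y \<in> I \<Longrightarrow> x - y \<in> I"
proof -
  interpret ideal I R by fact
  show "x \<in> C" if "x \<in> I" for x using Icarr[OF that] by (simp add: R_simps)
  show "0 \<in> I" using additive_subgroup.zero_closed[OF is_additive_subgroup] by (simp add: R_simps)
  show add: "x + y \<in> I" if "x \<in> I" "y \<in> I" for x y using additive_subgroup.a_closed[OF is_additive_subgroup that] by (simp add: R_simps)
  show mult: "r * x \<in> I" if "x \<in> I" "r \<in> C" for x r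
    using I_l_closed[OF that(1), of r] that(2) by (simp add: R_simps)
  show um: "- x \<in> I" if "x \<in> I" for x using mult[OF that, of "- 1"] by (simp add: C_closed)
  show "x - y \<in> I" if "x \<in> I" "y \<in> I" for x y using add[OF that(1) um[OF that(2)]] by simp
qed

lemma ideal_sum:
  assumes "ideal I R"
  shows "(\<And>x. x \<in> A \<Longrightarrow> f x \<in> I) \<Longrightarrow> sum f A \<in> I"
  by (induction A rule: infinite_finite_induct) (auto intro: ideal_closed[OF assms])

lemma idealI_type:
  assumes "I \<subseteq> C" "0 \<in> I" "\<And>x y. x \<in> I \<Longrightarrow> y \<in> I \<Longrightarrow> x + y \<in> I"
    "\<And>x r. x \<in> I \<Longrightarrow> r \<in> C \<Longrightarrow> r * x \<in> I"
  shows "ideal I R"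
proof -
  interpret cring R by (rule cring_R)
  have um: "- x \<in> I" if "x \<in> I" for x
    using assms(4)[OF that, of "- 1"] by (simp add: C_closed)
  show ?thesis
  proof (rule idealI)
    show "ring R" by (rule ring_axioms)
    show "subgroup I (add_monoid R)"
    proof (rule add.subgroupI)
      show "I \<subseteq> carrier R" using assms(1) by (simp add: R_simps)
      show "I \<noteq> {}" using assms(2) by auto
      show "\<ominus>\<^bsub>R\<^esub> a \<in> I" if "a \<in> I" for a
        using um[OF that] assms(1) that R_minus[of a] by auto
      show "a \<oplus>\<^bsub>R\<^esub> b \<in> I" if "a \<in> I" "b \<in> I" for a b
        using assms(3)[OF that] by (simp add: R_simps)
    qed
  qed (use assms(4) in \<open>auto simp: R_simps mult.commute\<close>)
qed

lemma coset_eq_iff: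
  assumes "ideal I R" "x \<in> C" "y \<in> C"
  shows "I +>\<^bsub>R\<^esub> x = I +>\<^bsub>R\<^esub> y \<longleftrightarrow> x - y \<in> I"
proof -
  note cl = ideal_closed[OF assms(1)]
  have c: "I +>\<^bsub>R\<^esub> z = {h + z | h. h \<in> I}" for z
    unfolding a_r_coset_def' R_simps by blast
  show ?thesis
  proof
    assume "I +>\<^bsub>R\<^esub> x = I +>\<^bsub>R\<^esub> y"
    moreover have "x \<in> I +>\<^bsub>R\<^esub> x" unfolding c using cl(2) by force
    ultimately obtain h where "x = h + y" "h \<in> I" unfolding c by blast
    then show "x - y \<in> I" by simp
  next
    assume xy: "x - y \<in> I"
    have "h + x = (h + (x - y)) + y" "h + y = (h - (x - y)) + x" for h by simp_all
    then show "I +>\<^bsub>R\<^esub> x = I +>\<^bsub>R\<^esub> y"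
      unfolding c using cl(3)[OF _ xy] cl(6)[OF _ xy] by blast
  qed
qed

end

interpretation type_ring: subring_type UNIV
  by unfold_locales auto

lemma ring_of_type_algebra_UNIV: "ring_of_type_algebra\<lparr>carrier := UNIV\<rparr> = ring_of_type_algebra"
  by (simp add: ring_of_type_algebra_def)

section \<open>Dimensions of quotients of the local ring\<close>

interpretation convergent: subring_type "{g. convergent_series g}"
  by unfold_locales (simp_all add: convergent_intros convergent_uminus)

lemma ideal_local_ring_closed:
  assumes "ideal I local_ring"
  shows "x \<in> I \<Longrightarrow> convergent_series x" "0 \<in> I" "x \<in> I \<Longrightarrow> y \<in> I \<Longrightarrow> x + y \<in> I"
    "x \<in> I \<Longrightarrow> convergent_series r \<Longrightarrow> r * x \<in> I" "x \<in> I \<Longrightarrow> - x \<in> I"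
    "x \<in> I \<Longrightarrow> y \<in> I \<Longrightarrow> x - y \<in> I"
proof -
  note cl = convergent.ideal_closed[OF assms[unfolded local_ring_def], unfolded mem_Collect_eq]
  show "x \<in> I \<Longrightarrow> convergent_series x" by (rule cl(1))
  show "0 \<in> I" by (rule cl(2))
  show "x \<in> I \<Longrightarrow> y \<in> I \<Longrightarrow> x + y \<in> I" by (rule cl(3))
  show "x \<in> I \<Longrightarrow> convergent_series r \<Longrightarrow> r * x \<in> I" by (rule cl(4))
  show "x \<in> I \<Longrightarrow> - x \<in> I" by (rule cl(5))
  show "x \<in> I \<Longrightarrow> y \<in> I \<Longrightarrow> x - y \<in> I" by (rule cl(6))
qed

lemma ideal_local_ring_sum:
  assumes "ideal I local_ring"
  shows "(\<And>x. x \<in> A \<Longrightarrow> f x \<in> I) \<Longrightarrow> sum f A \<in> I"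
  by (rule convergent.ideal_sum[OF assms[unfolded local_ring_def]])

lemma local_ring_minus: "convergent_series a \<Longrightarrow> \<ominus>\<^bsub>local_ring\<^esub> a = - a"
  by (rule local_ring.minus_equality) (auto simp: local_ring_simps convergent_uminus)

lemma ideal_local_ringI:
  assumes "\<And>x. x \<in> I \<Longrightarrow> convergent_series x" "0 \<in> I" "\<And>x y. x \<in> I \<Longrightarrow> y \<in> I \<Longrightarrow> x + y \<in> I"
    "\<And>x r. x \<in> I \<Longrightarrow> convergent_series r \<Longrightarrow> r * x \<in> I"
  shows "ideal I local_ring"
  unfolding local_ring_def by (rule convergent.idealI_type) (auto intro: assms)

lemma coset_local_ring_eq:
  assumes "ideal I local_ring" "convergent_series x" "convergent_series y"
  shows "I +>\<^bsub>local_ring\<^esub> x = I +>\<^bsub>local_ring\<^esub> y \<longleftrightarrow> x - y \<in> I"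
  unfolding local_ring_def
  by (rule convergent.coset_eq_iff[OF assms(1)[unfolded local_ring_def]]) (simp_all add: assms)

definition supported_on :: "(nat \<times> nat) set \<Rightarrow> series2 \<Rightarrow> bool" where
  "supported_on S g \<longleftrightarrow> (\<forall>i j. cf g i j \<noteq> 0 \<longrightarrow> (i, j) \<in> S)"

text \<open>The series supported on B form a complement of I. Since (0, 0) lies in B, the unit is
  not in I and the scalars embed as a subfield; the dimension is then built up inductively by
  adjoining the class of one monomial at a time.\<close>

lemma quotient_dim_eq_card:
  fixes G :: "series2 set"
  defines "I \<equiv> genideal local_ring G"
  assumes G: "\<And>g. g \<in> G \<Longrightarrow> convergent_series g"
    and B: "finite B" "(0, 0) \<in> B"
    and span: "\<And>g. convergent_series g \<Longrightarrow> \<exists>r. supported_on B r \<and> g - r \<in> I"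
    and indep: "\<And>r. r \<in> I \<Longrightarrow> supported_on B r \<Longrightarrow> r = 0"
  shows "quotient_dim G = card B"
proof -
  have "G \<subseteq> carrier local_ring" using G by (auto simp: local_ring_simps)
  then have I: "ideal I local_ring" unfolding I_def by (rule local_ring.genideal_ideal)
  note cl = ideal_local_ring_closed[OF I]
  define A where "A = local_ring Quot I"
  define p where "p = (\<lambda>x. I +>\<^bsub>local_ring\<^esub> x)"
  interpret ring_hom_ring local_ring A p
    unfolding A_def p_def using ideal.rcos_ring_hom_ring[OF I] .
  have p_eq: "p x = p y \<longleftrightarrow> x - y \<in> I" if "convergent_series x" "convergent_series y" for x y
    unfolding p_def using coset_local_ring_eq[OF I that] .
  have p_zero: "p 0 = \<zero>\<^bsub>A\<^esub>" using hom_zero by (simp add: local_ring_simps)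
  have p_hom: "p (x + y) = p x \<oplus>\<^bsub>A\<^esub> p y" "p (x * y) = p x \<otimes>\<^bsub>A\<^esub> p y"
    if "convergent_series x" "convergent_series y" for x y
    using hom_add[of x y] hom_mult[of x y] that by (simp_all add: local_ring_simps)
  have supp_conv: "convergent_series r" if "supported_on S r" "S \<subseteq> B" for r S
    using that B(1) by (intro convergent_series_finite_support[of B]) (auto simp: supported_on_def)
  have "1 \<notin> I"
  proof
    assume "1 \<in> I"
    moreover have "supported_on B 1" using B(2) by (simp add: supported_on_def cf_one)
    ultimately have "(1 :: series2) = 0" by (rule indep)
    then show False by simp
  qed
  then have one: "\<one>\<^bsub>A\<^esub> \<noteq> \<zero>\<^bsub>A\<^esub>"
    using p_eq[of 1 0] hom_one hom_zero by (auto simp: local_ring_simps convergent_intros)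
  have "subring (range const_series) local_ring"
    by (rule local_ring.subringI)
      (auto simp: local_ring_simps local_ring_minus convergent_const simp flip: const_series.simps)
  then have "subfield (range const_series) local_ring"
  proof (intro local_ring.subfieldI local_ring.subcringI)
    show "Units (local_ring\<lparr>carrier := range const_series\<rparr>) = range const_series - {\<zero>\<^bsub>local_ring\<^esub>}"
    proof (intro Set.equalityI subsetI)
      fix x assume "x \<in> Units (local_ring\<lparr>carrier := range const_series\<rparr>)"
      then obtain y where "x \<in> range const_series" "x * y = 1"
        unfolding Units_def by (auto simp: local_ring_simps)
      then show "x \<in> range const_series - {\<zero>\<^bsub>local_ring\<^esub>}" by (auto simp: local_ring_simps)
    next
      fix x assume "x \<in> range const_series - {\<zero>\<^bsub>local_ring\<^esub>}"
      then obtain e where "x = const_series e" "x \<noteq> 0" by (auto simp: local_ring_simps)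
      then have x: "x = const_series e" "e \<noteq> 0" by (auto simp: const_series.zero)
      then have "const_series (inverse e) * x = 1"
        by (simp flip: const_series.simps)
      then show "x \<in> Units (local_ring\<lparr>carrier := range const_series\<rparr>)"
        unfolding Units_def using x(1)
        by (auto simp: local_ring_simps mult.commute intro!: bexI[of _ "const_series (inverse e)"])
    qed
  qed (auto simp: local_ring_simps mult.commute)
  then have K: "subfield (p ` range const_series) A"
    using img_is_subfield(2)[OF _ one] by blast
  have dim: "S.dimension (card S) (p ` range const_series) (p ` {x. supported_on S x})" if "S \<subseteq> B" for S
    using finite_subset[OF that B(1)] that
  proof (induction S rule: finite_induct)
    case empty
    have "{x. supported_on {} x} = {0}" by (auto simp: supported_on_def series2_eq_iff)
    then show ?case by (simp add: p_zero)
  next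
    case (insert ij S)
    obtain i j where ij: "ij = (i, j)" by (cases ij)
    let ?E = "p ` {x. supported_on S x}"
    have "p (mono i j) \<notin> ?E"
    proof
      assume "p (mono i j) \<in> ?E"
      then obtain x where x: "supported_on S x" "p (mono i j) = p x" by blast
      then have "mono i j - x \<in> I"
        using p_eq[OF convergent_mono supp_conv] insert by blast
      moreover have "supported_on B (mono i j - x)"
        using x(1) insert(4) unfolding supported_on_def ij by (auto simp: cf_mono split: if_splits)
      ultimately have "mono i j - x = 0" by (rule indep)
      then have "x = mono i j" by simp
      then have "cf x i j = 1" by (simp only: cf_mono) simp
      then show False using x(1) insert(2) unfolding ij supported_on_def by force
    qed
    moreover have "S.line_extension (p ` range const_series) (p (mono i j)) ?E = p ` {x. supported_on (insert ij S) x}"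
    proof (intro Set.equalityI subsetI)
      fix y assume "y \<in> S.line_extension (p ` range const_series) (p (mono i j)) ?E"
      then obtain c x where x: "supported_on S x" and y: "y = p (const_series c) \<otimes>\<^bsub>A\<^esub> p (mono i j) \<oplus>\<^bsub>A\<^esub> p x"
        unfolding S.line_extension_def set_add_def' r_coset_def by auto
      have "convergent_series x" using supp_conv[OF x] insert by blast
      then have "y = p (const_series c * mono i j + x)"
        unfolding y by (simp add: p_hom convergent_intros)
      moreover have "supported_on (insert ij S) (const_series c * mono i j + x)"
        using x unfolding ij supported_on_def by (auto simp: cf_mono split: if_splits)
      ultimately show "y \<in> p ` {x. supported_on (insert ij S) x}" by blast
    next
      fix y assume "y \<in> p ` {x. supported_on (insert ij S) x}"
      then obtain x where x: "supported_on (insert ij S) x" "y = p x" by blast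
      define x' where "x' = x - const_series (cf x i j) * mono i j"
      have "convergent_series x" using supp_conv[OF x(1)] insert by blast
      then have conv: "convergent_series x'" unfolding x'_def by (intro convergent_intros)
      have x': "supported_on S x'"
        using x(1) unfolding ij supported_on_def x'_def by (auto simp: cf_mono split: if_splits)
      have "x = const_series (cf x i j) * mono i j + x'" by (simp add: x'_def)
      then have "y = p (const_series (cf x i j)) \<otimes>\<^bsub>A\<^esub> p (mono i j) \<oplus>\<^bsub>A\<^esub> p x'"
        unfolding x(2) using p_hom conv convergent_const convergent_mono convergent_mult by metis
      then show "y \<in> S.line_extension (p ` range const_series) (p (mono i j)) ?E"
        unfolding S.line_extension_def set_add_def' r_coset_def using x' by auto
    qed
    moreover have "p (mono i j) \<in> carrier A"
      by (intro hom_closed) (simp add: local_ring_simps convergent_mono)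
    ultimately show ?case
      using S.dimension.Suc_dim[of "p (mono i j)" ?E "card S" "p ` range const_series"] insert by simp
  qed
  have "carrier A = p ` {x. supported_on B x}"
  proof (intro Set.equalityI subsetI)
    fix y assume "y \<in> carrier A"
    then obtain g where g: "convergent_series g" "y = p g"
      unfolding A_def p_def FactRing_def A_RCOSETS_def' by (auto simp: local_ring_simps)
    then obtain r where r: "supported_on B r" "g - r \<in> I" using span by blast
    then have "p g = p r" using p_eq[OF g(1) supp_conv] by blast
    with r g show "y \<in> p ` {x. supported_on B x}" by blast
  next
    fix y assume "y \<in> p ` {x. supported_on B x}"
    then show "y \<in> carrier A" using supp_conv by (auto intro!: hom_closed simp: local_ring_simps)
  qed
  then have "S.dimension (card B) (p ` range const_series) (carrier A)" using dim[of B] by simp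
  from S.dimI[OF K this] have "S.dim (p ` range const_series) (carrier A) = card B"
    unfolding over_def .
  then show ?thesis
    unfolding quotient_dim_def Let_def I_def[symmetric] A_def[symmetric] p_def
    by (simp add: image_image)
qed

section \<open>Standard bases with respect to a weighted order\<close>

context
  fixes \<alpha> \<beta> :: nat
begin

text \<open>The weights of u and v are \<alpha> and \<beta>. The order is local: leading terms are
  those of least weight.\<close>

definition order_ge :: "nat \<Rightarrow> series2 \<Rightarrow> bool" where
  "order_ge n g \<longleftrightarrow> (\<forall>i j. cf g i j \<noteq> 0 \<longrightarrow> n \<le> \<alpha> * i + \<beta> * j)"

lemma order_geD: "order_ge n g \<Longrightarrow> cf g i j \<noteq> 0 \<Longrightarrow> n \<le> \<alpha> * i + \<beta> * j"
  by (simp add: order_ge_def)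

lemma order_ge_0: "order_ge n 0"
  by (simp add: order_ge_def)

lemma order_ge_add: "order_ge n g \<Longrightarrow> order_ge n h \<Longrightarrow> order_ge n (g + h)"
  unfolding order_ge_def by (metis add_0 cf_simps(3))

lemma order_ge_uminus: "order_ge n g \<Longrightarrow> order_ge n (- g)"
  by (simp add: order_ge_def)

lemma order_ge_diff: "order_ge n g \<Longrightarrow> order_ge n h \<Longrightarrow> order_ge n (g - h)"
  using order_ge_add[of n g "- h"] order_ge_uminus[of n h] by simp

lemma order_ge_sum: "(\<And>x. x \<in> A \<Longrightarrow> order_ge n (f x)) \<Longrightarrow> order_ge n (sum f A)"
  by (induction A rule: infinite_finite_induct) (auto intro: order_ge_0 order_ge_add)

lemma order_ge_const_mult: "order_ge n g \<Longrightarrow> order_ge n (const_series c * g)"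
  by (simp add: order_ge_def)

lemma order_ge_mono: "n \<le> \<alpha> * i + \<beta> * j \<Longrightarrow> order_ge n (mono i j)"
  by (auto simp: order_ge_def cf_mono split: if_splits)

lemma order_ge_weaken: "order_ge n g \<Longrightarrow> m \<le> n \<Longrightarrow> order_ge m g"
  unfolding order_ge_def by fastforce

lemma cf_mult_nonzero:
  assumes "cf (g * h) i j \<noteq> 0"
  obtains p q where "p \<le> i" "q \<le> j" "cf g p q \<noteq> 0" "cf h (i - p) (j - q) \<noteq> 0"
proof -
  obtain p where p: "p \<in> {..i}" "(\<Sum>q\<le>j. cf g p q * cf h (i - p) (j - q)) \<noteq> 0"
    using assms unfolding cf_mult by (rule sum.not_neutral_contains_not_neutral)
  obtain q where "q \<in> {..j}" "cf g p q * cf h (i - p) (j - q) \<noteq> 0"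
    using p(2) by (rule sum.not_neutral_contains_not_neutral)
  with p(1) show ?thesis by (intro that[of p q]) auto
qed

text \<open>Premultiplication with \<open>mono a b\<close> expresses that g has order at least n
  minus the weight of (a, b), a difference that could be negative.\<close>

lemma order_ge_mult:
  assumes "order_ge n (mono a b * g)" "order_ge (\<alpha> * a + \<beta> * b + m) h"
  shows "order_ge (n + m) (g * h)"
  unfolding order_ge_def
proof (intro allI impI)
  fix i j assume "cf (g * h) i j \<noteq> 0"
  then obtain p q where pq: "p \<le> i" "q \<le> j" "cf g p q \<noteq> 0" "cf h (i - p) (j - q) \<noteq> 0"
    by (rule cf_mult_nonzero)
  have "cf (mono a b * g) (p + a) (q + b) \<noteq> 0" using pq(3) by (simp add: cf_mono_mult)
  then have "n \<le> \<alpha> * (p + a) + \<beta> * (q + b)" using assms(1) by (rule order_geD[rotated])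
  moreover have "\<alpha> * a + \<beta> * b + m \<le> \<alpha> * (i - p) + \<beta> * (j - q)" using assms(2) pq(4) by (rule order_geD)
  moreover have "\<alpha> * p + \<alpha> * (i - p) = \<alpha> * i" "\<beta> * q + \<beta> * (j - q) = \<beta> * j"
    using pq by (simp_all flip: add_mult_distrib2)
  ultimately show "n + m \<le> \<alpha> * i + \<beta> * j" by (simp add: add_mult_distrib2)
qed

lemma order_ge_mult':
  assumes "order_ge n g" "order_ge m h"
  shows "order_ge (n + m) (g * h)"
  using order_ge_mult[of n 0 0 g m h] assms by (simp add: mono_def)

text \<open>The exponents below the staircase of the monomial ideal generated by u^a, v^b and u^c
  v^d.\<close>

definition std_box :: "nat \<Rightarrow> nat \<Rightarrow> nat \<Rightarrow> nat \<Rightarrow> (nat \<times> nat) set" where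
  "std_box a b c d = {(i, j). \<not> a \<le> i \<and> \<not> b \<le> j \<and> \<not> (c \<le> i \<and> d \<le> j)}"

text \<open>Says that in g1 h1 + g2 h2 + g3 h3 no summand has order below n, where the h's have
  leading monomials u^a, v^b and u^c v^d; only these monomials enter.\<close>

definition order_rep :: "nat \<Rightarrow> nat \<Rightarrow> nat \<Rightarrow> nat \<Rightarrow> nat \<Rightarrow> series2 \<Rightarrow> series2 \<Rightarrow> series2 \<Rightarrow> bool" where
  "order_rep a b c d n g1 g2 g3 \<longleftrightarrow>
    order_ge n (mono a 0 * g1) \<and> order_ge n (mono 0 b * g2) \<and> order_ge n (mono c d * g3)"

context
  fixes a b c d :: nat and h1 h2 h3 t1 t2 t3 :: series2
  assumes h: "h1 = mono a 0 + t1" "h2 = mono 0 b + t2" "h3 = mono c d + t3"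
    and t: "order_ge (\<alpha> * a + 1) t1" "order_ge (\<beta> * b + 1) t2" "order_ge (\<alpha> * c + \<beta> * d + 1) t3"
begin

lemma order_rep_add: "order_rep a b c d n f1 f2 f3 \<Longrightarrow> order_rep a b c d n g1 g2 g3 \<Longrightarrow> order_rep a b c d n (f1 + g1) (f2 + g2) (f3 + g3)"
  unfolding order_rep_def by (simp add: distrib_left order_ge_add)

lemma order_rep_mult:
  assumes "order_ge n (mono p q * g)" "order_rep a b c d (\<alpha> * p + \<beta> * q + m) g1 g2 g3"
  shows "order_rep a b c d (n + m) (g * g1) (g * g2) (g * g3)"
  using assms order_ge_mult[OF assms(1)] unfolding order_rep_def by (simp add: mult.left_commute[of _ g])

text \<open>
  Given the liftings of the syzygies S1 and S2 of the leading monomials, a representation of a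
  series supported on the box can be replaced by one of higher and higher order.
\<close>

lemma std_basis_independent:
  assumes cd: "c \<le> a" "d \<le> b"
    and S1: "mono 0 d * h1 - mono (a - c) 0 * h3 = p1 * h1 + p2 * h2 + p3 * h3"
      "order_rep a b c d (\<alpha> * a + \<beta> * d + 1) p1 p2 p3"
    and S2: "mono c 0 * h2 - mono 0 (b - d) * h3 = q1 * h1 + q2 * h2 + q3 * h3"
      "order_rep a b c d (\<alpha> * c + \<beta> * b + 1) q1 q2 q3"
    and x: "x = g1 * h1 + g2 * h2 + g3 * h3" "supported_on (std_box a b c d) x"
  shows "x = 0"
proof -
  have order: "order_ge (n + 1) (f1 * t1 + f2 * t2 + f3 * t3)" if "order_rep a b c d n f1 f2 f3" for n f1 f2 f3
    using that t unfolding order_rep_def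
    by (intro order_ge_add order_ge_mult[of n a 0] order_ge_mult[of n 0 b] order_ge_mult[of n c d]) auto
  have expand: "f1 * h1 + f2 * h2 + f3 * h3 =
      mono a 0 * f1 + mono 0 b * f2 + mono c d * f3 + (f1 * t1 + f2 * t2 + f3 * t3)" for f1 f2 f3
    unfolding h by (simp add: algebra_simps)
  have "\<exists>f1 f2 f3. x = f1 * h1 + f2 * h2 + f3 * h3 \<and> order_rep a b c d n f1 f2 f3" for n
  proof (induction n)
    case 0
    show ?case using x(1) unfolding order_rep_def order_ge_def by blast
  next
    case (Suc n)
    then obtain f1 f2 f3 where f: "x = f1 * h1 + f2 * h2 + f3 * h3" and rep: "order_rep a b c d n f1 f2 f3" by blast
    \<comment> \<open>The parts of the cofactors whose products with the leading monomials have
      weight exactly n.\<close>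
    define e1 where "e1 = part {(i, j). \<alpha> * i + \<beta> * j + \<alpha> * a = n} f1"
    define e2 where "e2 = part {(i, j). \<alpha> * i + \<beta> * j + \<beta> * b = n} f2"
    define e3 where "e3 = part {(i, j). \<alpha> * i + \<beta> * j + (\<alpha> * c + \<beta> * d) = n} f3"
    have rest: "order_ge (n + 1) (mono p q * (f - part {(i, j). \<alpha> * i + \<beta> * j + (\<alpha> * p + \<beta> * q) = n} f))"
      if fo: "order_ge n (mono p q * f)" for f p q
      unfolding order_ge_def
    proof (intro allI impI)
      fix i j assume nz: "cf (mono p q * (f - part {(i, j). \<alpha> * i + \<beta> * j + (\<alpha> * p + \<beta> * q) = n} f)) i j \<noteq> 0"
      then have pq: "p \<le> i" "q \<le> j" and ne: "\<alpha> * (i - p) + \<beta> * (j - q) + (\<alpha> * p + \<beta> * q) \<noteq> n"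
        and "cf f (i - p) (j - q) \<noteq> 0"
        by (auto simp: cf_mono_mult split: if_splits)
      then have "cf (mono p q * f) i j \<noteq> 0" by (simp add: cf_mono_mult)
      with fo have "n \<le> \<alpha> * i + \<beta> * j" by (rule order_geD)
      moreover have "\<alpha> * (i - p) + \<beta> * (j - q) + (\<alpha> * p + \<beta> * q) = \<alpha> * i + \<beta> * j"
        using pq by (metis (no_types, lifting) add.assoc add.commute add.left_commute add_mult_distrib2 le_add_diff_inverse2)
      ultimately show "n + 1 \<le> \<alpha> * i + \<beta> * j" using ne by linarith
    qed
    have rep': "order_rep a b c d (n + 1) (f1 - e1) (f2 - e2) (f3 - e3)"
      using rep rest[of a 0 f1] rest[of 0 b f2] rest[of c d f3]
      unfolding order_rep_def e1_def e2_def e3_def by simp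
    define e where "e = mono a 0 * e1 + mono 0 b * e2 + mono c d * e3"
    have "x - e = (mono a 0 * (f1 - e1) + mono 0 b * (f2 - e2) + mono c d * (f3 - e3)) + (f1 * t1 + f2 * t2 + f3 * t3)"
      unfolding f expand e_def by (simp add: algebra_simps)
    moreover have "order_ge (n + 1) (mono a 0 * (f1 - e1) + mono 0 b * (f2 - e2) + mono c d * (f3 - e3))"
      using rep' unfolding order_rep_def by (intro order_ge_add) auto
    ultimately have xe: "order_ge (n + 1) (x - e)" using order_ge_add order[OF rep] by metis
    have cf_e: "cf e i j = (if a \<le> i then cf e1 (i - a) j else 0) + (if b \<le> j then cf e2 i (j - b) else 0) +
        (if c \<le> i \<and> d \<le> j then cf e3 (i - c) (j - d) else 0)" for i j
      unfolding e_def by (simp add: cf_mono_mult)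
    \<comment> \<open>e is the part of x of weight n; it is supported off the box while x is
      supported on it, so e vanishes.\<close>
    have "cf e i j = 0" for i j
    proof (rule ccontr)
      assume nz: "cf e i j \<noteq> 0"
      have "\<not> (\<not> a \<le> i \<and> \<not> b \<le> j \<and> \<not> (c \<le> i \<and> d \<le> j))"
      proof
        assume "\<not> a \<le> i \<and> \<not> b \<le> j \<and> \<not> (c \<le> i \<and> d \<le> j)"
        then show False using nz cf_e[of i j] by auto
      qed
      then have "(i, j) \<notin> std_box a b c d" unfolding std_box_def by blast
      then have "cf x i j = 0" using x(2) unfolding supported_on_def by blast
      then have "cf (x - e) i j \<noteq> 0" using nz by simp
      then have "n + 1 \<le> \<alpha> * i + \<beta> * j" using xe by (rule order_geD[rotated])
      moreover have w: "\<alpha> * (i - p) + \<beta> * (j - q) + (\<alpha> * p + \<beta> * q) = \<alpha> * i + \<beta> * j"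
        if "p \<le> i" "q \<le> j" for p q
        using that by (metis (no_types, lifting) add.assoc add.commute add.left_commute add_mult_distrib2 le_add_diff_inverse2)
      moreover have "\<alpha> * i + \<beta> * j = n"
      proof -
        consider "a \<le> i" "cf e1 (i - a) j \<noteq> 0" | "b \<le> j" "cf e2 i (j - b) \<noteq> 0"
          | "c \<le> i" "d \<le> j" "cf e3 (i - c) (j - d) \<noteq> 0"
        proof -
          have "(if a \<le> i then cf e1 (i - a) j else 0) \<noteq> 0 \<or> (if b \<le> j then cf e2 i (j - b) else 0) \<noteq> 0 \<or>
              (if c \<le> i \<and> d \<le> j then cf e3 (i - c) (j - d) else 0) \<noteq> 0"
          proof -
            have "x \<noteq> 0 \<or> y \<noteq> 0 \<or> z \<noteq> 0" if "x + y + z \<noteq> 0" for x y z :: complex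
              using that by auto
            from this[OF nz[unfolded cf_e]] show ?thesis .
          qed
          then show thesis using that by (auto split: if_splits)
        qed
        then show ?thesis
          using w[of a 0] w[of 0 b] w[of c d]
          by cases (auto simp: e1_def e2_def e3_def split: if_splits)
      qed
      ultimately show False by linarith
    qed
    then have e0: "e = 0" by (simp add: series2_eq_iff)
    \<comment> \<open>In e = 0 the terms of u^a e1 with v-exponent below d cannot be cancelled by
      the other two summands, so v^d divides e1; similarly u^c divides e2. Hence the relation
      between the leading monomials is a combination of the two S-pairs.\<close>
    have "d \<le> j" if "cf e1 i j \<noteq> 0" for i j
      using cf_e[of "i + a" j] that cd unfolding e0 by (auto split: if_splits)
    then have e1: "e1 = mono 0 d * series (\<lambda>i j. cf e1 (i + 0) (j + d))" by (intro series_divide_mono) auto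
    have "c \<le> i" if "cf e2 i j \<noteq> 0" for i j
      using cf_e[of i "j + b"] that cd unfolding e0 by (auto split: if_splits)
    then have e2: "e2 = mono c 0 * series (\<lambda>i j. cf e2 (i + c) (j + 0))" by (intro series_divide_mono) auto
    obtain r1 r2 where r: "e1 = mono 0 d * r1" "e2 = mono c 0 * r2" using e1 e2 by blast
    have ac: "mono a d = mono c d * mono (a - c) 0" "mono c b = mono c d * mono 0 (b - d)"
      using cd by (simp_all add: mono_mult)
    have "mono c d * (mono (a - c) 0 * r1 + mono 0 (b - d) * r2 + e3) = e"
      unfolding e_def r by (simp only: mult.assoc[symmetric] mono_mult distrib_left) (use ac in \<open>simp add: mono_mult mult.assoc\<close>)
    moreover have "mono c d \<noteq> 0" using cf_mono[of c d c d] by auto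
    ultimately have e3: "e3 = - (mono (a - c) 0 * r1 + mono 0 (b - d) * r2)"
      using e0 by (simp add: add_eq_0_iff2 add.commute)
    have o1: "order_ge n (mono a d * r1)" and o2: "order_ge n (mono c b * r2)"
    proof -
      have w: "\<gamma> * (i - p) + \<gamma> * p = \<gamma> * i" if "p \<le> i" for p i \<gamma> :: nat
        using that by (simp flip: add_mult_distrib2)
      have "order_ge n (mono a 0 * e1)" "order_ge n (mono 0 b * e2)"
        unfolding order_ge_def e1_def e2_def
        by (auto simp: cf_mono_mult w add.assoc add.commute[of "\<beta> * _" "\<alpha> * a"] split: if_splits)
      then show "order_ge n (mono a d * r1)" "order_ge n (mono c b * r2)"
        unfolding r by (simp_all add: mult.assoc[symmetric] mono_mult)
    qed
    \<comment> \<open>Replacing the S-pairs by their liftings raises the order of the representation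
      from n to n + 1.\<close>
    define k1 where "k1 = (f1 - e1) + (r1 * p1 + r2 * q1)"
    define k2 where "k2 = (f2 - e2) + (r1 * p2 + r2 * q2)"
    define k3 where "k3 = (f3 - e3) + (r1 * p3 + r2 * q3)"
    have "x = (f1 - e1) * h1 + (f2 - e2) * h2 + (f3 - e3) * h3 +
        (r1 * (mono 0 d * h1 - mono (a - c) 0 * h3) + r2 * (mono c 0 * h2 - mono 0 (b - d) * h3))"
      unfolding f e3 unfolding r by (simp add: algebra_simps)
    also have "\<dots> = k1 * h1 + k2 * h2 + k3 * h3"
      unfolding S1(1) S2(1) k1_def k2_def k3_def by (simp add: algebra_simps)
    finally have "x = k1 * h1 + k2 * h2 + k3 * h3" .
    moreover have "order_rep a b c d (n + 1) k1 k2 k3"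
      unfolding k1_def k2_def k3_def
      by (intro order_rep_add rep' order_rep_mult[OF o1 S1(2)] order_rep_mult[OF o2 S2(2)])
    ultimately show ?case by (metis Suc_eq_plus1)
  qed
  then have "order_ge n x" for n
  proof -
    obtain f1 f2 f3 where f: "x = f1 * h1 + f2 * h2 + f3 * h3" and rep: "order_rep a b c d n f1 f2 f3"
      using \<open>\<And>n. \<exists>f1 f2 f3. x = f1 * h1 + f2 * h2 + f3 * h3 \<and> order_rep a b c d n f1 f2 f3\<close> by blast
    show "order_ge n x"
      unfolding f expand using rep unfolding order_rep_def
      by (intro order_ge_add[of n "_ + _ + _"] order_ge_weaken[OF order[OF rep]] order_ge_add) simp_all
  qed
  then have "cf x i j = 0" for i j
    using order_geD[of "\<alpha> * i + \<beta> * j + 1" x i j] by force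
  then show "x = 0" by (simp add: series2_eq_iff)
qed

text \<open>Weight by weight, monomials in the box are moved to the remainder and all others are
  replaced by terms of larger weight. The process stops because all convergent series of large order
  lie in I.\<close>

lemma std_basis_spanning:
  assumes ab: "\<alpha> > 0" "\<beta> > 0" and I: "ideal I local_ring"
    and hI: "h1 \<in> I" "h2 \<in> I" "h3 \<in> I" and N: "mono N 0 \<in> I" "mono 0 N \<in> I"
    and g: "convergent_series g"
  shows "\<exists>r. supported_on (std_box a b c d) r \<and> g - r \<in> I"
proof -
  note cl = ideal_local_ring_closed[OF I]
  \<comment> \<open>A monomial of weight at least \<alpha> N + \<beta> N is divisible by u^N or by
    v^N; dividing by these only shifts coefficients and keeps the geometric bound.\<close>
  have high: "g \<in> I" if g: "convergent_series g" and o: "order_ge (\<alpha> * N + \<beta> * N) g" for g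
  proof -
    define g1 where "g1 = series (\<lambda>i j. cf g (i + N) j)"
    define g2 where "g2 = series (\<lambda>i j. if i < N then cf g i (j + N) else 0)"
    have "N \<le> j" if "cf g i j \<noteq> 0" "i < N" for i j
    proof (rule ccontr)
      assume "\<not> N \<le> j"
      then have "\<alpha> * i < \<alpha> * N" "\<beta> * j < \<beta> * N" using that ab by auto
      with order_geD[OF o that(1)] show False by linarith
    qed
    then have "g = mono N 0 * g1 + mono 0 N * g2"
      unfolding series2_eq_iff g1_def g2_def by (auto simp: cf_mono_mult) (meson not_le)
    moreover obtain C R where C: "C \<ge> 0" "R \<ge> 1" "\<forall>i j. norm (cf g i j) \<le> C * R ^ (i + j)"
      using convergent_seriesD[OF g] by blast
    have "norm (cf g (i + N) j) \<le> C * R ^ N * R ^ (i + j)" "norm (cf g i (j + N)) \<le> C * R ^ N * R ^ (i + j)" for i j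
      using C(3)[rule_format, of "i + N" j] C(3)[rule_format, of i "j + N"] by (simp_all add: power_add mult_ac)
    then have "convergent_series g1" "convergent_series g2"
      unfolding convergent_series_iff g1_def g2_def using C
      by (intro exI[of _ "C * R ^ N"] exI[of _ R], simp)+
    ultimately show ?thesis
      using cl(3)[OF cl(4)[OF N(1)] cl(4)[OF N(2)]] by (simp add: mult.commute)
  qed
  have convt: "convergent_series t1" "convergent_series t2" "convergent_series t3"
    using hI[THEN cl(1)] convergent_diff[OF _ convergent_mono] h by (metis add_diff_cancel_left')+
  have reduce: "\<exists>y\<in>I. order_ge (\<alpha> * i + \<beta> * j + 1) (mono i j - y)" if "(i, j) \<notin> std_box a b c d" for i j
  proof -
    have *: "\<exists>y\<in>I. order_ge (\<alpha> * i + \<beta> * j + 1) (mono i j - y)"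
      if "p \<le> i" "q \<le> j" "mono p q + t \<in> I" "order_ge (\<alpha> * p + \<beta> * q + 1) t" for p q t
    proof
      show "mono (i - p) (j - q) * (mono p q + t) \<in> I" using that by (intro cl(4) convergent_mono)
      have "mono i j - mono (i - p) (j - q) * (mono p q + t) = - (mono (i - p) (j - q) * t)"
        using that(1,2) by (simp add: distrib_left mono_mult)
      moreover have "order_ge ((\<alpha> * i + \<beta> * j) + 1) (mono (i - p) (j - q) * t)"
      proof (rule order_ge_mult[OF _ that(4)])
        show "order_ge (\<alpha> * i + \<beta> * j) (mono p q * mono (i - p) (j - q))"
          using that(1,2) by (simp add: mono_mult order_ge_mono)
      qed
      ultimately show "order_ge (\<alpha> * i + \<beta> * j + 1) (mono i j - mono (i - p) (j - q) * (mono p q + t))"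
        by (simp add: order_ge_uminus)
    qed
    from that consider "a \<le> i" | "b \<le> j" | "c \<le> i" "d \<le> j" unfolding std_box_def by auto
    then show ?thesis
      using *[of a 0 t1] *[of 0 b t2] *[of c d t3] t hI unfolding h by cases auto
  qed
  have "\<exists>r. supported_on (std_box a b c d) r \<and> g - r \<in> I"
    if "order_ge (\<alpha> * N + \<beta> * N - m) g" "convergent_series g" for m g
    using that
  proof (induction m arbitrary: g)
    case 0
    then have "g \<in> I" by (intro high) auto
    then show ?case by (intro exI[of _ 0]) (simp add: supported_on_def)
  next
    case (Suc m)
    define n where "n = \<alpha> * N + \<beta> * N - Suc m"
    have n: "order_ge n g" using Suc.prems(1) unfolding n_def .
    \<comment> \<open>Subtraction is truncated: once m reaches the threshold, n is 0 and the
      induction hypothesis applies directly. Otherwise n increases by one.\<close>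
    show ?case
    proof (cases "n + 1 = \<alpha> * N + \<beta> * N - m")
      case False
      then have "\<alpha> * N + \<beta> * N - m = n" unfolding n_def by linarith
      then show ?thesis using Suc.IH n Suc.prems(2) by simp
    next
      case True
      define W where "W = {(i, j). \<alpha> * i + \<beta> * j = n}"
      have "W \<subseteq> {..n} \<times> {..n}"
        unfolding W_def using ab
        by (auto intro: order.trans[OF _ le_add1] order.trans[OF _ le_add2])
      then have W: "finite W" by (rule finite_subset) simp
      define W1 where "W1 = W \<inter> std_box a b c d"
      define W2 where "W2 = W - std_box a b c d"
      have fin: "finite W1" "finite W2" and disj: "W1 \<inter> W2 = {}" "W = W1 \<union> W2"
        unfolding W1_def W2_def using W by auto
      have "\<forall>x\<in>W2. \<exists>y\<in>I. order_ge (n + 1) (mono (fst x) (snd x) - y)"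
        using reduce unfolding W2_def W_def by auto
      then obtain Y where Y: "\<And>x. x \<in> W2 \<Longrightarrow> Y x \<in> I"
        "\<And>x. x \<in> W2 \<Longrightarrow> order_ge (n + 1) (mono (fst x) (snd x) - Y x)" by metis
      define y where "y = (\<Sum>x\<in>W2. const_series (cf g (fst x) (snd x)) * Y x)"
      have y: "y \<in> I" unfolding y_def by (intro ideal_local_ring_sum[OF I] cl(4) Y convergent_const)
      define r where "r = part W1 g"
      have rs: "supported_on (std_box a b c d) r" unfolding r_def supported_on_def W1_def by simp
      have rc: "convergent_series r" unfolding r_def
        by (rule convergent_series_finite_support[OF fin(1)]) (simp split: if_splits)
      have "g - r - y = (g - part W g) + (part W2 g - y)"
      proof -
        have "part W g = r + part W2 g"
          unfolding series2_eq_iff r_def using disj by auto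
        then show ?thesis by simp
      qed
      moreover have "order_ge (n + 1) (g - part W g)"
        unfolding order_ge_def
      proof (intro allI impI)
        fix i j assume "cf (g - part W g) i j \<noteq> 0"
        then have "cf g i j \<noteq> 0" "\<alpha> * i + \<beta> * j \<noteq> n" unfolding W_def by (auto split: if_splits)
        then show "n + 1 \<le> \<alpha> * i + \<beta> * j" using order_geD[OF n] by fastforce
      qed
      moreover have "part W2 g - y = (\<Sum>x\<in>W2. const_series (cf g (fst x) (snd x)) * (mono (fst x) (snd x) - Y x))"
        unfolding part_finite[OF fin(2)] y_def by (simp add: case_prod_unfold right_diff_distrib sum_subtractf)
      then have "order_ge (n + 1) (part W2 g - y)"
        using Y(2) by (auto intro!: order_ge_sum order_ge_const_mult)
      ultimately have "order_ge (n + 1) (g - r - y)" using order_ge_add by metis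
      moreover have "convergent_series (g - r - y)"
        using Suc.prems(2) rc cl(1)[OF y] by (intro convergent_diff)
      ultimately obtain r' where r': "supported_on (std_box a b c d) r'" "g - r - y - r' \<in> I"
        using Suc.IH True by metis
      have "g - (r + r') = (g - r - y - r') + y" by simp
      then have "g - (r + r') \<in> I" using cl(3)[OF r'(2) y] by (simp only:)
      moreover have "supported_on (std_box a b c d) (r + r')"
        using rs r'(1) unfolding supported_on_def by (metis add_0 cf_simps(3))
      ultimately show ?thesis by blast
    qed
  qed
  from this[of "\<alpha> * N + \<beta> * N" g] show ?thesis using g by (simp add: order_ge_def)
qed

end

end

lemma const_series_inverse: "c \<noteq> 0 \<Longrightarrow> const_series (inverse c) * const_series c = 1"
  by (simp add: const_series.one flip: const_series.mult)

lemma const_series_inverse_of_nat: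
  assumes "n > 0"
  shows "const_series (inverse (of_nat n)) * of_nat n = 1"
  using const_series_inverse[of "of_nat n"] assms unfolding const_series.of_nat by simp

lemma of_nat_mult_const_series:
  assumes "n > 0"
  shows "of_nat n * const_series (of_nat m / of_nat n) = of_nat m"
proof -
  have "of_nat n * (of_nat m / of_nat n) = (of_nat m :: complex)" using assms by simp
  then show ?thesis by (metis const_series.mult const_series.of_nat)
qed

text \<open>The ideal generated by G is enclosed in J, whose elements converge but may have formal
  cofactors. Independence holds for all of J, so the convergence of the cofactors never has to be
  controlled.\<close>

lemma quotient_dim_std_basis:
  assumes ab: "\<alpha> > 0" "\<beta> > 0" "a > 0" "b > 0" "c + d > 0"
    and h: "h1 = mono a 0 + t1" "h2 = mono 0 b + t2" "h3 = mono c d + t3"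
    and t: "order_ge \<alpha> \<beta> (\<alpha> * a + 1) t1" "order_ge \<alpha> \<beta> (\<beta> * b + 1) t2"
      "order_ge \<alpha> \<beta> (\<alpha> * c + \<beta> * d + 1) t3"
    and cd: "c \<le> a" "d \<le> b"
    and S1: "mono 0 d * h1 - mono (a - c) 0 * h3 = p1 * h1 + p2 * h2 + p3 * h3"
      "order_rep \<alpha> \<beta> a b c d (\<alpha> * a + \<beta> * d + 1) p1 p2 p3"
    and S2: "mono c 0 * h2 - mono 0 (b - d) * h3 = q1 * h1 + q2 * h2 + q3 * h3"
      "order_rep \<alpha> \<beta> a b c d (\<alpha> * c + \<beta> * b + 1) q1 q2 q3"
    and G: "\<And>g. g \<in> G \<Longrightarrow> convergent_series g"
      "\<And>g. g \<in> G \<Longrightarrow> \<exists>g1 g2 g3. g = g1 * h1 + g2 * h2 + g3 * h3"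
    and I: "\<And>I. ideal I local_ring \<Longrightarrow> G \<subseteq> I \<Longrightarrow> h1 \<in> I \<and> h2 \<in> I \<and> h3 \<in> I \<and> mono N 0 \<in> I \<and> mono 0 N \<in> I"
  shows "quotient_dim G = card (std_box a b c d)"
proof (rule quotient_dim_eq_card[OF G(1)])
  define J where "J = {x. convergent_series x \<and> (\<exists>g1 g2 g3. x = g1 * h1 + g2 * h2 + g3 * h3)}"
  have sub: "G \<subseteq> carrier local_ring" using G(1) by (auto simp: local_ring_simps)
  have id: "ideal (genideal local_ring G) local_ring" using sub by (rule local_ring.genideal_ideal)
  have "G \<subseteq> genideal local_ring G" using sub by (rule local_ring.genideal_self)
  note gen = I[OF id this]
  have "ideal J local_ring"
  proof (rule ideal_local_ringI)
    show "0 \<in> J" unfolding J_def by (auto simp: convergent_0 intro!: exI[of _ 0])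
    show "x + y \<in> J" if J: "x \<in> J" "y \<in> J" for x y
    proof -
      obtain f1 f2 f3 where "x = f1 * h1 + f2 * h2 + f3 * h3" using J(1) unfolding J_def by blast
      moreover obtain g1 g2 g3 where "y = g1 * h1 + g2 * h2 + g3 * h3" using J(2) unfolding J_def by blast
      ultimately have "x + y = (f1 + g1) * h1 + (f2 + g2) * h2 + (f3 + g3) * h3" by (simp add: algebra_simps)
      then show ?thesis using that unfolding J_def by (blast intro: convergent_add)
    qed
    show "r * x \<in> J" if J: "x \<in> J" "convergent_series r" for x r
    proof -
      obtain f1 f2 f3 where "x = f1 * h1 + f2 * h2 + f3 * h3" using J unfolding J_def by blast
      then have "r * x = (r * f1) * h1 + (r * f2) * h2 + (r * f3) * h3" by (simp add: algebra_simps)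
      then show ?thesis using that unfolding J_def by (blast intro: convergent_mult)
    qed
  qed (simp add: J_def)
  then have IJ: "genideal local_ring G \<subseteq> J"
    using G unfolding J_def by (intro local_ring.genideal_minimal) auto
  show "x = 0" if x: "x \<in> genideal local_ring G" "supported_on (std_box a b c d) x" for x
  proof -
    obtain g1 g2 g3 where "x = g1 * h1 + g2 * h2 + g3 * h3" using x(1) IJ unfolding J_def by blast
    from std_basis_independent[OF h t cd S1 S2 this x(2)] show ?thesis .
  qed
  show "\<exists>r. supported_on (std_box a b c d) r \<and> g - r \<in> genideal local_ring G" if "convergent_series g" for g
    using gen by (intro std_basis_spanning[OF h t ab(1,2) id _ _ _ _ _ that]) auto
  show "finite (std_box a b c d)"
    by (rule finite_subset[of _ "{..a} \<times> {..b}"]) (auto simp: std_box_def)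
  show "(0, 0) \<in> std_box a b c d" using ab by (auto simp: std_box_def)
qed

text \<open>The product criterion: the leading monomials u^a and v^b are coprime, and their S-pair
  equals t2 h1 - t1 h2. The third basis element is a copy of h1, with c = a and d = 0.\<close>

lemma quotient_dim_two_generators:
  assumes ab: "\<alpha> > 0" "\<beta> > 0" "a > 0" "b > 0"
    and h: "h1 = mono a 0 + t1" "h2 = mono 0 b + t2"
    and t: "order_ge \<alpha> \<beta> (\<alpha> * a + 1) t1" "order_ge \<alpha> \<beta> (\<beta> * b + 1) t2"
    and G: "\<And>g. g \<in> G \<Longrightarrow> convergent_series g"
      "\<And>g. g \<in> G \<Longrightarrow> \<exists>g1 g2. g = g1 * h1 + g2 * h2"
    and I: "\<And>I. ideal I local_ring \<Longrightarrow> G \<subseteq> I \<Longrightarrow> h1 \<in> I \<and> h2 \<in> I \<and> mono N 0 \<in> I \<and> mono 0 N \<in> I"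
  shows "quotient_dim G = a * b"
proof -
  have "quotient_dim G = card (std_box a b a 0)"
  proof (rule quotient_dim_std_basis[OF ab _ h h(1) t _ _ _ _ _ _ _ G(1), where N = N])
    show "order_ge \<alpha> \<beta> (\<alpha> * a + \<beta> * 0 + 1) t1" using t(1) by simp
    show "mono 0 0 * h1 - mono (a - a) 0 * h1 = 0 * h1 + 0 * h2 + 0 * h1" by simp
    show "order_rep \<alpha> \<beta> a b a 0 (\<alpha> * a + \<beta> * 0 + 1) 0 0 0"
      by (simp add: order_rep_def order_ge_0)
    show "mono a 0 * h2 - mono 0 (b - 0) * h1 = t2 * h1 + (- t1) * h2 + 0 * h1"
      unfolding h by (simp add: algebra_simps)
    show "order_rep \<alpha> \<beta> a b a 0 (\<alpha> * a + \<beta> * b + 1) t2 (- t1) 0"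
      using order_ge_mult'[OF order_ge_mono[of "\<alpha> * a" \<alpha> a \<beta> 0] t(2)]
        order_ge_mult'[OF order_ge_mono[of "\<beta> * b" \<alpha> 0 \<beta> b] t(1)]
      by (simp add: order_rep_def order_ge_0 order_ge_uminus add_ac)
    show "\<exists>g1 g2 g3. g = g1 * h1 + g2 * h2 + g3 * h1" if "g \<in> G" for g
      using G(2)[OF that] by (metis add.right_neutral mult_zero_left)
    show "h1 \<in> I \<and> h2 \<in> I \<and> h1 \<in> I \<and> mono N 0 \<in> I \<and> mono 0 N \<in> I"
      if "ideal I local_ring" "G \<subseteq> I" for I using I[OF that] by blast
  qed (use ab in auto)
  also have "std_box a b a 0 = {..<a} \<times> {..<b}" by (auto simp: std_box_def)
  finally show ?thesis by simp
qed

section \<open>Milnor and Tjurina numbers of the two cusps\<close>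

interpretation deriv_u: derivation deriv_u
  by unfold_locales (simp_all add: deriv_u_def)

interpretation deriv_v: derivation deriv_v
proof
  fix g h :: series2
  show "deriv_v (g + h) = deriv_v g + deriv_v h"
    by (simp add: fps_eq_iff deriv_v_def algebra_simps)
  have "fps_nth (deriv_v (g * h)) i = fps_nth (deriv_v g * h + g * deriv_v h) i" for i
    by (simp add: deriv_v_def fps_mult_nth fps_deriv_sum sum.distrib)
  then show "deriv_v (g * h) = deriv_v g * h + g * deriv_v h" by (simp add: fps_eq_iff)
qed

lemma deriv_ser:
  "deriv_u ser_u = 1" "deriv_u ser_v = 0" "deriv_v ser_u = 0" "deriv_v ser_v = 1"
  by (auto simp: deriv_u_def deriv_v_def ser_u_def ser_v_def fps_eq_iff fps_X_def)

context
  fixes k :: nat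
  assumes k: "k \<ge> 2"
begin

lemma deriv_eq_q:
  "deriv_u (eq_q k) = of_nat (2 * k) * ser_u ^ (k - 1) * (ser_v + ser_u ^ k) - of_nat (2 * k + 1) * mono (2 * k) 0"
  "deriv_v (eq_q k) = 2 * (ser_v + ser_u ^ k)"
  unfolding eq_q_def deriv_u.simps deriv_v.simps deriv_ser mono_def by (simp_all add: algebra_simps)

text \<open>An A_(2k) singularity: the derivatives generate the ideal (u^(2k), v + u^k), which
  already contains the equation, so both numbers are 2k.\<close>

lemma quotient_dim_q:
  assumes "G = {deriv_u (eq_q k), deriv_v (eq_q k)} \<or> G = {eq_q k, deriv_u (eq_q k), deriv_v (eq_q k)}"
  shows "quotient_dim G = 2 * k"
proof -
  define h1 where "h1 = mono (2 * k) 0"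
  define h2 where "h2 = ser_v + ser_u ^ k"
  define c where "c = const_series (inverse (of_nat (2 * k + 1)))"
  have c: "c * of_nat (2 * k + 1) = 1"
    unfolding c_def by (rule const_series_inverse_of_nat) simp
  have uu: "ser_u ^ k * ser_u ^ k = h1" unfolding h1_def mono_def by (simp add: mult_2 power_add)
  have du: "deriv_u (eq_q k) = (- of_nat (2 * k + 1)) * h1 + (of_nat (2 * k) * ser_u ^ (k - 1)) * h2"
    and dv: "deriv_v (eq_q k) = 0 * h1 + 2 * h2"
    unfolding deriv_eq_q h1_def h2_def by (simp_all add: algebra_simps)
  have eq: "eq_q k = (- ser_u) * h1 + h2 * h2"
    unfolding eq_q_def h1_def h2_def mono_def by (simp add: power2_eq_square)
  have "quotient_dim G = (2 * k) * 1"
  \<comment> \<open>With these weights v, and not u^k, is the leading monomial of h2.\<close>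
  proof (rule quotient_dim_two_generators[where \<alpha> = 2 and \<beta> = 1 and N = "2 * k"])
    show "h1 = mono (2 * k) 0 + 0" by (simp add: h1_def)
    show "h2 = mono 0 1 + mono k 0" by (simp add: h2_def mono_def)
    show "order_ge 2 1 (2 * (2 * k) + 1) 0" by (rule order_ge_0)
    show "order_ge 2 1 (1 * 1 + 1) (mono k 0)" using k by (intro order_ge_mono) simp
    show "convergent_series g" if "g \<in> G" for g
    proof -
      have "convergent_series (deriv_u (eq_q k))" "convergent_series (deriv_v (eq_q k))"
        unfolding deriv_eq_q by (intro convergent_intros)+
      then show ?thesis using that assms convergent_eq(2)[of k] by blast
    qed
    show "\<exists>g1 g2. g = g1 * h1 + g2 * h2" if "g \<in> G" for g
      using that assms du dv eq by blast
    show "h1 \<in> I \<and> h2 \<in> I \<and> mono (2 * k) 0 \<in> I \<and> mono 0 (2 * k) \<in> I"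
      if I: "ideal I local_ring" and GI: "G \<subseteq> I" for I
    proof -
      note cl = ideal_local_ring_closed[OF I]
      have d: "deriv_u (eq_q k) \<in> I" "deriv_v (eq_q k) \<in> I" using GI assms by auto
      have "const_series (inverse 2) * 2 = 1"
        using const_series_inverse[of 2] by (simp add: const_series.numeral)
      then have "h2 = const_series (inverse 2) * deriv_v (eq_q k)"
        unfolding dv by (simp only: mult_zero_left add_0_left mult.assoc[symmetric] mult_1_left)
      then have h2: "h2 \<in> I" using cl(4)[OF d(2) convergent_const] by simp
      have "h1 = c * of_nat (2 * k + 1) * h1" unfolding c by simp
      also have "\<dots> = c * ((of_nat (2 * k) * ser_u ^ (k - 1)) * h2 - deriv_u (eq_q k))"
        unfolding du by (simp add: algebra_simps)
      finally have h1: "h1 \<in> I"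
        using cl(4)[OF cl(6)[OF cl(4)[OF h2] d(1)]] unfolding c_def by (simp add: convergent_intros)
      have "ser_v * ser_v = (ser_v - ser_u ^ k) * h2 + h1"
        unfolding h2_def uu[symmetric] by (simp add: algebra_simps)
      then have "ser_v * ser_v \<in> I" using cl(3)[OF cl(4)[OF h2] h1] by (simp add: convergent_intros)
      then have "ser_v ^ (2 * k - 2) * (ser_v * ser_v) \<in> I" by (rule cl(4)) (intro convergent_intros)
      moreover have "ser_v ^ (2 * k - 2) * (ser_v * ser_v) = ser_v ^ ((2 * k - 2) + 2)"
        unfolding power_add by (simp add: power2_eq_square)
      moreover have "2 * k - 2 + 2 = 2 * k" using k by simp
      ultimately have "mono 0 (2 * k) \<in> I" unfolding mono_def by (simp only: power_0 mult_1_left)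
      then show ?thesis using h1 h2 unfolding h1_def by simp
    qed
  qed (use k in auto)
  then show ?thesis by simp
qed

text \<open>Here h1 and h2 are the derivatives of \<open>eq_p k\<close> divided by constants, and h3
  is, up to a constant, the remainder of the equation itself modulo h1 and h2. The constants r and t
  come from making the leading coefficients 1.\<close>

context
  fixes u v U U1 V V2 G r t h1 h2 h3 :: series2
  defines "u \<equiv> ser_u" and "v \<equiv> ser_v" and "U \<equiv> ser_u ^ k" and "U1 \<equiv> ser_u ^ (k - 1)"
    and "V \<equiv> ser_v ^ (k - 1)" and "V2 \<equiv> ser_v ^ (k - 2)" and "G \<equiv> ser_v ^ (k - 1) + ser_u ^ k"
    and "r \<equiv> const_series (of_nat (2 * k) / of_nat (2 * k + 1))"
    and "t \<equiv> const_series (1 / of_nat (2 * k - 1))"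
  defines "h1 \<equiv> U * U - r * U1 * G * v" and "h2 \<equiv> G * (V + t * U)" and "h3 \<equiv> U * v * G"
begin

lemma p_powers: "U = u * U1" "V = v * V2" "G = V + U"
  "mono (2 * k) 0 = U * U" "mono 0 (2 * k - 2) = V * V" "mono k k = U * v * V"
proof -
  obtain n where n: "k = Suc (Suc n)" using le_Suc_ex[OF k] by auto
  show "G = V + U" unfolding U_def V_def G_def ..
  show "U = u * U1" "V = v * V2" unfolding U_def U1_def V_def V2_def u_def v_def n by simp_all
  have "ser_u ^ (2 * k) = U * U" unfolding U_def mult_2 power_add ..
  then show "mono (2 * k) 0 = U * U" unfolding mono_def by simp
  have "ser_v ^ k = v * V" unfolding v_def V_def by (simp add: n)
  then show "mono k k = U * v * V" unfolding mono_def U_def by (simp add: mult.assoc)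
  have "2 * k - 2 = (k - 1) + (k - 1)" by simp
  then show "mono 0 (2 * k - 2) = V * V" unfolding V_def mono_def by (simp only: power_add) simp
qed

lemma const_nonzero: "of_nat (2 * k + 1) \<noteq> (0 :: complex)" "of_nat (2 * k - 1) \<noteq> (0 :: complex)"
  using k by (simp_all only: of_nat_eq_0_iff)

lemma rt: "of_nat (2 * k + 1) * r = of_nat (2 * k)" "of_nat (2 * k - 1) * t = 1"
  unfolding r_def t_def using of_nat_mult_const_series[of "2 * k + 1" "2 * k"]
    of_nat_mult_const_series[of "2 * k - 1" 1] k by simp_all

lemma deriv_eq_p: "deriv_u (eq_p k) = - of_nat (2 * k + 1) * h1" "deriv_v (eq_p k) = of_nat (2 * k - 1) * h2"
proof -
  have "deriv_u (eq_p k) = 2 * G * (of_nat k * U1) * v - of_nat (2 * k + 1) * ser_u ^ (2 * k)"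
    unfolding eq_p_def deriv_u.simps deriv_ser G_def U1_def v_def by simp
  also have "ser_u ^ (2 * k) = U * U" unfolding U_def by (simp add: mult_2 power_add)
  also have "2 * G * (of_nat k * U1) * v = (of_nat (2 * k + 1) * r) * U1 * G * v"
    unfolding rt by (simp add: mult_ac)
  finally show "deriv_u (eq_p k) = - of_nat (2 * k + 1) * h1"
    unfolding h1_def by (simp only: right_diff_distrib minus_mult_left[symmetric] mult.assoc) simp
  have "deriv_v (eq_p k) = 2 * G * (of_nat (k - 1) * V2) * v + G * G"
    unfolding eq_p_def deriv_v.simps deriv_ser G_def V2_def v_def
    by (simp add: power2_eq_square numeral_2_eq_2)
  also have "\<dots> = G * (of_nat (2 * (k - 1) + 1) * V + U)"
    unfolding p_powers(2,3) of_nat_add of_nat_mult by (simp add: algebra_simps)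
  also have "2 * (k - 1) + 1 = 2 * k - 1" using k by simp
  also have "of_nat (2 * k - 1) * V + U = of_nat (2 * k - 1) * V + (of_nat (2 * k - 1) * t) * U"
    unfolding rt by simp
  finally show "deriv_v (eq_p k) = of_nat (2 * k - 1) * h2"
    unfolding h2_def by (simp only: distrib_left mult_ac)
qed

lemma convergent_h: "convergent_series h1" "convergent_series h2" "convergent_series h3"
  "convergent_series u" "convergent_series v" "convergent_series U" "convergent_series U1"
  "convergent_series V" "convergent_series G" "convergent_series r" "convergent_series t"
  unfolding h1_def h2_def h3_def u_def v_def U_def U1_def V_def G_def r_def t_def
  by (intro convergent_intros)+

lemma convergent_deriv_eq_p: "convergent_series (deriv_u (eq_p k))" "convergent_series (deriv_v (eq_p k))"
  unfolding deriv_eq_p by (intro convergent_intros convergent_h)+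

lemma h_leading:
  "h1 = mono (2 * k) 0 + (- (r * (mono (k - 1) k + mono (2 * k - 1) 1)))"
  "h2 = mono 0 (2 * k - 2) + ((1 + t) * mono k (k - 1) + t * mono (2 * k) 0)"
  "h3 = mono k k + mono (2 * k) 1"
proof -
  obtain n where n: "k = Suc n" using k by (metis Suc_le_D numeral_2_eq_2)
  have "mono (k - 1) k = U1 * V * v" "mono (2 * k - 1) 1 = U1 * U * v"
    unfolding mono_def U1_def V_def v_def U_def by (simp_all add: n mult_2 power_add)
  then show "h1 = mono (2 * k) 0 + (- (r * (mono (k - 1) k + mono (2 * k - 1) 1)))"
    unfolding h1_def p_powers(4) p_powers(3) by (simp add: algebra_simps)
  have "mono k (k - 1) = U * V" unfolding mono_def U_def V_def by simp
  then show "h2 = mono 0 (2 * k - 2) + ((1 + t) * mono k (k - 1) + t * mono (2 * k) 0)"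
    unfolding h2_def p_powers(4,5) p_powers(3) by (simp add: algebra_simps)
  have "mono (2 * k) 1 = U * U * v"
    unfolding mono_def U_def v_def by (simp add: mult_2 power_add)
  then show "h3 = mono k k + mono (2 * k) 1"
    unfolding h3_def p_powers(6) p_powers(3) by (simp add: algebra_simps)
qed

lemma order_ge_rt: "order_ge \<alpha> \<beta> n g \<Longrightarrow> order_ge \<alpha> \<beta> n (r * g)" "order_ge \<alpha> \<beta> n g \<Longrightarrow> order_ge \<alpha> \<beta> n (t * g)"
  "order_ge \<alpha> \<beta> n g \<Longrightarrow> order_ge \<alpha> \<beta> n ((1 + t) * g)"
  unfolding r_def t_def by (auto simp: distrib_right intro!: order_ge_const_mult order_ge_add)

text \<open>The weights 2k-1 and 2k+1 are the orders of u and v along the branch. The bounds are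
  tight: each of h1, h2 and h3 has a tail term whose weight exceeds that of the leading monomial by
  exactly 1.\<close>

lemma h_tails:
  "order_ge (2 * k - 1) (2 * k + 1) ((2 * k - 1) * (2 * k) + 1) (- (r * (mono (k - 1) k + mono (2 * k - 1) 1)))"
  "order_ge (2 * k - 1) (2 * k + 1) ((2 * k + 1) * (2 * k - 2) + 1) ((1 + t) * mono k (k - 1) + t * mono (2 * k) 0)"
  "order_ge (2 * k - 1) (2 * k + 1) ((2 * k - 1) * k + (2 * k + 1) * k + 1) (mono (2 * k) 1)"
proof -
  obtain n where n: "k = Suc (Suc n)" using le_Suc_ex[OF k] by auto
  show "order_ge (2 * k - 1) (2 * k + 1) ((2 * k - 1) * (2 * k) + 1) (- (r * (mono (k - 1) k + mono (2 * k - 1) 1)))"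
    by (intro order_ge_uminus order_ge_rt order_ge_add order_ge_mono) (simp_all add: n algebra_simps)
  show "order_ge (2 * k - 1) (2 * k + 1) ((2 * k + 1) * (2 * k - 2) + 1) ((1 + t) * mono k (k - 1) + t * mono (2 * k) 0)"
    by (intro order_ge_rt order_ge_add order_ge_mono) (simp_all add: n algebra_simps)
  show "order_ge (2 * k - 1) (2 * k + 1) ((2 * k - 1) * k + (2 * k + 1) * k + 1) (mono (2 * k) 1)"
    by (intro order_ge_mono) (simp add: n algebra_simps)
qed

lemma h_in_ideal:
  assumes I: "ideal I local_ring" and d: "deriv_u (eq_p k) \<in> I" "deriv_v (eq_p k) \<in> I"
  shows "h1 \<in> I" "h2 \<in> I"
proof -
  note cl = ideal_local_ring_closed[OF I]
  have "const_series (inverse (of_nat (2 * k + 1))) * of_nat (2 * k + 1) = 1"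
    "const_series (inverse (of_nat (2 * k - 1))) * of_nat (2 * k - 1) = 1"
    using k by (intro const_series_inverse_of_nat; simp)+
  then have "h1 = - const_series (inverse (of_nat (2 * k + 1))) * deriv_u (eq_p k)"
    "h2 = const_series (inverse (of_nat (2 * k - 1))) * deriv_v (eq_p k)"
    unfolding deriv_eq_p by (simp_all add: mult.assoc[symmetric] del: of_nat_add of_nat_mult of_nat_Suc)
  then show "h1 \<in> I" "h2 \<in> I"
    using cl(4)[OF d(1)] cl(4)[OF d(2)] convergent_const convergent_uminus by metis+
qed

text \<open>The leading monomials u^(2k) and v^(2k-2) are coprime. The work lies in finding pure
  powers of u and v in the ideal: eliminating v yields a unit times u^(4k-1), and a power of v
  follows from h2.\<close>

lemma milnor_p: "quotient_dim {deriv_u (eq_p k), deriv_v (eq_p k)} = 2 * k * (2 * k - 2)"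
proof (rule quotient_dim_two_generators[OF _ _ _ _ h_leading(1,2) h_tails(1,2), where N = "8 * k"])
  show "convergent_series g" if "g \<in> {deriv_u (eq_p k), deriv_v (eq_p k)}" for g
    using that convergent_deriv_eq_p by auto
  show "\<exists>g1 g2. g = g1 * h1 + g2 * h2" if "g \<in> {deriv_u (eq_p k), deriv_v (eq_p k)}" for g
    using that unfolding deriv_eq_p by (metis add.left_neutral add.right_neutral insertE mult_zero_left singletonD)
  fix I assume I: "ideal I local_ring" and "{deriv_u (eq_p k), deriv_v (eq_p k)} \<subseteq> I"
  then have h: "h1 \<in> I" "h2 \<in> I" using h_in_ideal by auto
  note cl = ideal_local_ring_closed[OF I]
  note ci = convergent_intros convergent_h
  have E1: "U * U * (V + t * U) \<in> I"
  proof -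
    have "U * U * (V + t * U) = (V + t * U) * h1 + (r * U1 * v) * h2"
      unfolding h1_def h2_def by (simp add: algebra_simps)
    also have "\<dots> \<in> I" by (intro cl(3) cl(4) h ci)
    finally show ?thesis .
  qed
  \<comment> \<open>After multiplication by U^2 or by G, V may be replaced by -t U and hence G by (1
    - t) U; this turns h1 into the rule that u acts as w on U^3.\<close>
  define w where "w = r * (1 - t) * v"
  have w: "convergent_series w" unfolding w_def by (intro ci)
  have E2: "(u - w) * (U * U * U) \<in> I"
  proof -
    have "(u - w) * ((1 - t) * (U * U * U)) = (u * G) * h1 + (r * U * v) * h2 - (u - w) * (U * U * (V + t * U))"
      unfolding h1_def h2_def w_def p_powers(3) unfolding p_powers(1) by (simp add: algebra_simps)
    also have "\<dots> \<in> I" by (intro cl(6) cl(3) cl(4) h E1 ci w)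
    finally have "(u - w) * ((1 - t) * (U * U * U)) \<in> I" .
    then have "const_series (of_nat (2 * k - 1) / of_nat (2 * k - 2)) * ((u - w) * ((1 - t) * (U * U * U))) \<in> I"
      by (rule cl(4)) (rule convergent_const)
    \<comment> \<open>The constant 1 - t = (2k-2)/(2k-1) is nonzero because k is at least 2.\<close>
    moreover have "const_series (of_nat (2 * k - 1) / of_nat (2 * k - 2)) * (1 - t) = 1"
    proof -
      have "of_nat (2 * k - 2) = of_nat (2 * k - 1) - (1 :: complex)"
        using k by (simp add: of_nat_diff)
      moreover have "of_nat (2 * k - 2) \<noteq> (0 :: complex)" using k by (simp only: of_nat_eq_0_iff)
      moreover have "b / (b - 1) * (1 - 1 / b) = 1" if "b \<noteq> 0" "b - 1 \<noteq> 0" for b :: complex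
        using that by (simp add: field_simps)
      ultimately have "(of_nat (2 * k - 1) / of_nat (2 * k - 2)) * (1 - 1 / of_nat (2 * k - 1)) = (1 :: complex)"
        using const_nonzero(2) by (simp only:)
      then show ?thesis
        unfolding t_def by (metis const_series.diff const_series.mult const_series.one)
    qed
    then have "const_series (of_nat (2 * k - 1) / of_nat (2 * k - 2)) * ((u - w) * ((1 - t) * (U * U * U))) = (u - w) * (U * U * U)"
      by (metis (no_types, lifting) mult.assoc mult.left_commute mult_1_left)
    ultimately show ?thesis by (simp only:)
  qed
  have E3: "(u ^ m - w ^ m) * (U * U * U) \<in> I" for m
  proof (induction m)
    case 0
    show ?case by (simp add: cl(2))
  next
    case (Suc m)
    have "(u ^ Suc m - w ^ Suc m) * (U * U * U) = u * ((u ^ m - w ^ m) * (U * U * U)) + w ^ m * ((u - w) * (U * U * U))"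
      by (simp add: algebra_simps)
    also have "\<dots> \<in> I" by (intro cl(3) cl(4) Suc E2 ci w)
    finally show ?case .
  qed
  define m where "m = (r * (1 - t)) ^ (k - 1)"
  have m: "convergent_series m" unfolding m_def by (intro ci)
  \<comment> \<open>E3 with exponent k - 1: u^(k-1) is U1, and w^(k-1) is a constant times V, which
    E1 trades for -t U. What remains is a unit times u^(4k-1).\<close>
  have E4: "(1 + m * t * u) * (U1 * U * U * U) \<in> I"
  proof -
    have "u ^ (k - 1) = U1" "w ^ (k - 1) = m * V"
      unfolding u_def U1_def w_def m_def V_def v_def by (simp_all add: power_mult_distrib)
    then have "(1 + m * t * u) * (U1 * U * U * U) = (u ^ (k - 1) - w ^ (k - 1)) * (U * U * U) + m * U * (U * U * (V + t * U))"
      using p_powers(1) by (simp add: algebra_simps)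
    also have "\<dots> \<in> I" by (intro cl(3) cl(4) E3 E1 ci m)
    finally show ?thesis .
  qed
  have "cf (1 + m * t * u) 0 0 = 1"
    by (simp add: cf_one u_def cf_mult) (simp add: cf_def ser_u_def)
  then obtain e where e: "convergent_series e" "(1 + m * t * u) * e = 1"
    using convergent_unit[of "1 + m * t * u"] m ci by (metis zero_neq_one)
  have "u * (e * ((1 + m * t * u) * (U1 * U * U * U))) \<in> I" by (intro cl(4) E4 ci e)
  moreover have "u * (e * ((1 + m * t * u) * (U1 * U * U * U))) = ((1 + m * t * u) * e) * (U * U * U * U)"
    unfolding p_powers(1) by (simp only: mult_ac)
  ultimately have U4: "U * U * U * U \<in> I" unfolding e by simp
  define s where "s = - ((1 + t) * V + t * U)"
  have s: "convergent_series s" unfolding s_def by (intro ci)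
  \<comment> \<open>As h2 = V^2 - U s, the power V^8 is congruent to (U s)^4.\<close>
  have "V ^ 8 = ((V * V) * (V * V) + (U * s) * (U * s)) * (V * V + U * s) * h2 + s ^ 4 * (U * U * U * U)"
  proof -
    have hv: "h2 = V * V - U * s" unfolding h2_def s_def p_powers(3) by (simp add: algebra_simps)
    have "V ^ 8 = (V * V) * (V * V) * (V * V) * (V * V)" by (simp add: numeral_eq_Suc mult_ac)
    moreover have "s ^ 4 = s * s * s * s" by (simp add: numeral_eq_Suc mult_ac)
    ultimately show ?thesis unfolding hv by (simp add: algebra_simps)
  qed
  also have "\<dots> \<in> I" by (intro cl(3) cl(4) h U4 ci s)
  finally have "V ^ 8 \<in> I" .
  then have "v ^ 8 * V ^ 8 \<in> I" by (rule cl(4)) (intro ci)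
  moreover have "v ^ 8 * V ^ 8 = mono 0 (8 * k)"
  proof -
    have "8 * k = 8 + (k - 1) * 8" using k by simp
    then show ?thesis unfolding mono_def V_def v_def by (simp only: power_add power_mult) simp
  qed
  moreover have "mono (8 * k) 0 = (U * U * U * U) * (U * U * U * U)"
  proof -
    have "8 * k = k + k + k + k + (k + k + k + k)" by simp
    then show ?thesis unfolding mono_def U_def by (simp only: power_add) simp
  qed
  moreover have "(U * U * U * U) * (U * U * U * U) \<in> I" by (intro cl(4) U4 ci)
  ultimately show "h1 \<in> I \<and> h2 \<in> I \<and> mono (8 * k) 0 \<in> I \<and> mono 0 (8 * k) \<in> I"
    using h by simp
qed (use k in auto)

lemma card_std_box_p: "card (std_box (2 * k) (2 * k - 2) k k) = 3 * k ^ 2 - 2 * k"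
proof -
  have box: "std_box (2 * k) (2 * k - 2) k k = {..<2 * k} \<times> {..<2 * k - 2} - {k..<2 * k} \<times> {k..<2 * k - 2}"
    by (auto simp: std_box_def)
  have "card (std_box (2 * k) (2 * k - 2) k k) = 2 * k * (2 * k - 2) - k * (k - 2)"
    unfolding box by (subst card_Diff_subset) (auto simp: card_cartesian_product)
  also obtain n where n: "k = n + 2" using k by (metis add.commute le_Suc_ex)
  have "2 * k * (2 * k - 2) - k * (k - 2) = 3 * k ^ 2 - 2 * k"
    unfolding n by (simp add: algebra_simps power2_eq_square)
  finally show ?thesis .
qed

text \<open>The equation adds the leading monomial u^k v^k, carried by h3, which removes a k by k-2
  rectangle from the staircase of the Milnor algebra. The liftings of both S-pairs are
  explicit.\<close>

lemma tjurina_p: "quotient_dim {eq_p k, deriv_u (eq_p k), deriv_v (eq_p k)} = 3 * k ^ 2 - 2 * k"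
proof -
  let ?G = "{eq_p k, deriv_u (eq_p k), deriv_v (eq_p k)}"
  obtain n where n: "k = Suc (Suc n)" using le_Suc_ex[OF k] by auto
  have eq: "eq_p k = (- u) * h1 + v * h2 + (1 - t - r) * h3"
  proof -
    have "eq_p k = G * G * v - u * (U * U)"
      unfolding eq_p_def G_def v_def u_def U_def by (simp add: power2_eq_square mult_2 power_add)
    then show ?thesis unfolding h1_def h2_def h3_def p_powers(3) unfolding p_powers(1) by (simp add: algebra_simps)
  qed
  have mono_p: "mono 0 k = v * V" "mono (2 * k - k) 0 = U" "mono k 0 = U" "mono 0 (2 * k - 2 - k) = V2"
    unfolding mono_def v_def V_def U_def V2_def by (simp_all add: n)
  have "quotient_dim ?G = card (std_box (2 * k) (2 * k - 2) k k)"
  proof (rule quotient_dim_std_basis[OF _ _ _ _ _ h_leading h_tails, where N = "8 * k"])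
    show "mono 0 k * h1 - mono (2 * k - k) 0 * h3 =
        (- (U * v)) * h1 + (- (r * U1 * v * v)) * h2 + ((r * t - r) * U1 * v) * h3"
      unfolding mono_p h1_def h2_def h3_def p_powers(3) unfolding p_powers(1) by (simp add: algebra_simps)
    show "mono k 0 * h2 - mono 0 (2 * k - 2 - k) * h3 =
        (t * G) * h1 + (t * r * U1 * v) * h2 + (t * r * (1 - t) * U1) * h3"
      unfolding mono_p h1_def h2_def h3_def p_powers(3) unfolding p_powers(2) unfolding p_powers(1) by (simp add: algebra_simps)
    let ?o = "order_ge (2 * k - 1) (2 * k + 1)"
    have rep: "order_rep (2 * k - 1) (2 * k + 1) (2 * k) (2 * k - 2) k k m f1 f2 f3 \<longleftrightarrow>
      ?o m (mono (2 * k) 0 * f1) \<and> ?o m (mono 0 (2 * k - 2) * f2) \<and> ?o m (mono k k * f3)" for m f1 f2 f3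
      by (rule order_rep_def)
    have e: "U * v = mono k 1" "U1 * v * v = mono (k - 1) 2" "U1 * v = mono (k - 1) 1" "U1 = mono (k - 1) 0"
        "G = mono 0 (k - 1) + mono k 0"
      unfolding mono_def U_def U1_def v_def G_def by (simp_all add: power2_eq_square mult.assoc)
    have x: "mono (2 * k) 0 * (- (U * v)) = - mono (3 * k) 1"
      "mono 0 (2 * k - 2) * (- (r * U1 * v * v)) = - (r * mono (k - 1) (2 * k))"
      "mono k k * ((r * t - r) * U1 * v) = r * (t * mono (2 * k - 1) (k + 1)) - r * mono (2 * k - 1) (k + 1)"
    proof -
      have "mono (2 * k) 0 * (- (U * v)) = - (mono (2 * k) 0 * mono k 1)" unfolding e(1) by simp
      also have "mono (2 * k) 0 * mono k 1 = mono (3 * k) 1" unfolding mono_mult by simp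
      finally show "mono (2 * k) 0 * (- (U * v)) = - mono (3 * k) 1" .
      have "mono 0 (2 * k - 2) * (- (r * U1 * v * v)) = - (r * (mono 0 (2 * k - 2) * (U1 * v * v)))" by simp
      also have "mono 0 (2 * k - 2) * (U1 * v * v) = mono (k - 1) (2 * k)" unfolding e(2) mono_mult by (simp add: n mult_2)
      finally show "mono 0 (2 * k - 2) * (- (r * U1 * v * v)) = - (r * mono (k - 1) (2 * k))" .
      have "mono k k * ((r * t - r) * U1 * v) = r * (t * (mono k k * (U1 * v))) - r * (mono k k * (U1 * v))"
        by (simp add: algebra_simps)
      also have "mono k k * (U1 * v) = mono (2 * k - 1) (k + 1)" unfolding e(3) mono_mult by (simp add: n mult_2)
      finally show "mono k k * ((r * t - r) * U1 * v) = r * (t * mono (2 * k - 1) (k + 1)) - r * mono (2 * k - 1) (k + 1)" .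
    qed
    show "order_rep (2 * k - 1) (2 * k + 1) (2 * k) (2 * k - 2) k k ((2 * k - 1) * (2 * k) + (2 * k + 1) * k + 1)
        (- (U * v)) (- (r * U1 * v * v)) ((r * t - r) * U1 * v)"
      unfolding rep x
      by (intro conjI order_ge_uminus order_ge_rt order_ge_diff order_ge_mono) (simp_all add: n algebra_simps)
    have y: "mono (2 * k) 0 * (t * G) = t * (mono (2 * k) (k - 1) + mono (3 * k) 0)"
      "mono 0 (2 * k - 2) * (t * r * U1 * v) = t * (r * mono (k - 1) (2 * k - 1))"
      "mono k k * (t * r * (1 - t) * U1) = t * (r * (mono (2 * k - 1) k - t * mono (2 * k - 1) k))"
    proof -
      have "mono (2 * k) 0 * (t * G) = t * (mono (2 * k) 0 * G)" by simp
      also have "mono (2 * k) 0 * G = mono (2 * k) (k - 1) + mono (3 * k) 0"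
        unfolding e(5) distrib_left mono_mult by simp
      finally show "mono (2 * k) 0 * (t * G) = t * (mono (2 * k) (k - 1) + mono (3 * k) 0)" .
      have "mono 0 (2 * k - 2) * (t * r * U1 * v) = t * (r * (mono 0 (2 * k - 2) * (U1 * v)))" by simp
      also have "mono 0 (2 * k - 2) * (U1 * v) = mono (k - 1) (2 * k - 1)" unfolding e(3) mono_mult by (simp add: n mult_2)
      finally show "mono 0 (2 * k - 2) * (t * r * U1 * v) = t * (r * mono (k - 1) (2 * k - 1))" .
      have "mono k k * (t * r * (1 - t) * U1) = t * (r * ((mono k k * U1) - t * (mono k k * U1)))"
        by (simp add: algebra_simps)
      also have "mono k k * U1 = mono (2 * k - 1) k" unfolding e(4) mono_mult by (simp add: n mult_2)
      finally show "mono k k * (t * r * (1 - t) * U1) = t * (r * (mono (2 * k - 1) k - t * mono (2 * k - 1) k))" .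
    qed
    show "order_rep (2 * k - 1) (2 * k + 1) (2 * k) (2 * k - 2) k k ((2 * k - 1) * k + (2 * k + 1) * (2 * k - 2) + 1)
        (t * G) (t * r * U1 * v) (t * r * (1 - t) * U1)"
      unfolding rep y
      by (intro conjI order_ge_rt order_ge_diff order_ge_add order_ge_mono) (simp_all add: n algebra_simps)
    show "convergent_series g" if "g \<in> ?G" for g
      using that convergent_deriv_eq_p convergent_eq(1) by auto
    show "\<exists>g1 g2 g3. g = g1 * h1 + g2 * h2 + g3 * h3" if "g \<in> ?G" for g
    proof -
      have "deriv_u (eq_p k) = (- of_nat (2 * k + 1)) * h1 + 0 * h2 + 0 * h3"
        "deriv_v (eq_p k) = 0 * h1 + of_nat (2 * k - 1) * h2 + 0 * h3"
        unfolding deriv_eq_p by simp_all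
      then show ?thesis using that eq by blast
    qed
    fix I assume I: "ideal I local_ring" and GI: "?G \<subseteq> I"
    then have h: "h1 \<in> I" "h2 \<in> I" using h_in_ideal by auto
    note cl = ideal_local_ring_closed[OF I]
    note ci = convergent_intros convergent_h
    define c :: complex where "c = 1 - 1 / of_nat (2 * k - 1) - of_nat (2 * k) / of_nat (2 * k + 1)"
    \<comment> \<open>For a = 2k - 1 the first factor is the coefficient 1 - t - r of h3 in the
      equation; the nonzero product shows that h3 can be recovered from the equation.\<close>
    have gen: "(1 - 1 / a - (a + 1) / (a + 2)) * (a * (a + 2)) = - 2" if "a \<noteq> 0" "a + 2 \<noteq> 0" for a :: complex
    proof -
      have "(1 - x - y) * (a * (a + 2)) = a * (a + 2) - (x * a) * (a + 2) - (y * (a + 2)) * a" for x y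
        by (simp add: algebra_simps)
      moreover have "1 / a * a = 1" "(a + 1) / (a + 2) * (a + 2) = a + 1" using that by simp_all
      ultimately show ?thesis by (simp only:) (simp add: algebra_simps)
    qed
    have "of_nat (2 * k) = of_nat (2 * k - 1) + (1 :: complex)" "of_nat (2 * k + 1) = of_nat (2 * k - 1) + (2 :: complex)"
      using k by (simp_all add: of_nat_diff)
    then have "c * (of_nat (2 * k - 1) * (of_nat (2 * k - 1) + 2)) = - 2"
      unfolding c_def using gen[of "of_nat (2 * k - 1)"] const_nonzero by metis
    then have "c \<noteq> 0" by auto
    then have c1: "const_series (inverse c) * const_series c = 1"
      by (simp flip: const_series.mult add: const_series.one)
    have c2: "const_series c = 1 - t - r"
      unfolding c_def t_def r_def by (simp only: const_series.diff const_series.one)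
    have "h3 = const_series (inverse c) * (const_series c * h3)"
      by (simp only: mult.assoc[symmetric] c1 mult_1_left)
    also have "const_series c * h3 = eq_p k - ((- u) * h1 + v * h2)" unfolding eq c2 by simp
    also have "const_series (inverse c) * (eq_p k - ((- u) * h1 + v * h2)) \<in> I"
      using GI by (intro cl(4) cl(6) cl(3) h ci) auto
    finally have h3: "h3 \<in> I" .
    \<comment> \<open>In u h1 + r h3 the terms containing G cancel and u U^2 is left.\<close>
    have "U * U * U = U1 * (u * h1 + r * h3)"
      unfolding h1_def h3_def unfolding p_powers(1) by (simp add: algebra_simps)
    also have "\<dots> \<in> I" by (intro cl(3) cl(4) h h3 ci)
    finally have U3: "U * U * U \<in> I" .
    \<comment> \<open>x is v^(2k-1); it is congruent to y, and y^3 is a multiple of U^3, so x^3 lies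
      in the ideal.\<close>
    define x where "x = v * V * V"
    define y where "y = - (U * v * V)"
    have xy: "convergent_series x" "convergent_series y" unfolding x_def y_def by (intro ci)+
    have "x - y = v * h2 - t * h3"
      unfolding x_def y_def h2_def h3_def p_powers(3) by (simp add: algebra_simps)
    also have "\<dots> \<in> I" by (intro cl(6) cl(4) h h3 ci)
    finally have "x - y \<in> I" .
    have "x * x * x = (x * x + x * y + y * y) * (x - y) + (- (v * v * v * V * V * V)) * (U * U * U)"
      unfolding y_def by (simp add: algebra_simps)
    also have "\<dots> \<in> I" by (intro cl(3) cl(4) \<open>x - y \<in> I\<close> U3 ci xy)
    finally have x3: "x * x * x \<in> I" .
    have "ser_v ^ (2 * k + 3) * (x * x * x) \<in> I" by (intro cl(4) x3 ci)
    moreover have "ser_v ^ (2 * k + 3) * (x * x * x) = mono 0 (8 * k)"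
    proof -
      have "8 * k = (2 * k + 3) + ((1 + (k - 1) + (k - 1)) + (1 + (k - 1) + (k - 1)) + (1 + (k - 1) + (k - 1)))"
        using k by simp
      then show ?thesis unfolding mono_def x_def V_def v_def by (simp only: power_add) (simp add: mult_ac)
    qed
    moreover have "mono (8 * k) 0 = (ser_u ^ (5 * k)) * (U * U * U)"
    proof -
      have "8 * k = 5 * k + (k + k + k)" by simp
      then show ?thesis unfolding mono_def U_def by (simp only: power_add) simp
    qed
    moreover have "(ser_u ^ (5 * k)) * (U * U * U) \<in> I" by (intro cl(4) U3 ci)
    ultimately show "h1 \<in> I \<and> h2 \<in> I \<and> h3 \<in> I \<and> mono (8 * k) 0 \<in> I \<and> mono 0 (8 * k) \<in> I"
      using h h3 by simp
  qed (use k in auto)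
  then show ?thesis unfolding card_std_box_p .
qed

end

lemma total_milnor_curve_C: "total_milnor (curve_C k) = 2 * k * (2 * k - 1)"
proof -
  have "total_milnor (curve_C k) = 2 * k * (2 * k - 2) + 2 * k"
    unfolding total_milnor_def singular_points_curve_C[OF k]
    by (simp add: milnor_number_def local_equation_p local_equation_q milnor_p quotient_dim_q)
  also obtain n where "k = n + 2" using k by (metis add.commute le_Suc_ex)
  then have "2 * k * (2 * k - 2) + 2 * k = 2 * k * (2 * k - 1)" by (simp add: algebra_simps)
  finally show ?thesis .
qed

lemma total_tjurina_curve_C: "total_tjurina (curve_C k) = 3 * k ^ 2"
proof -
  have "total_tjurina (curve_C k) = (3 * k ^ 2 - 2 * k) + 2 * k"
    unfolding total_tjurina_def singular_points_curve_C[OF k]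
    by (simp add: tjurina_number_def local_equation_p local_equation_q tjurina_p quotient_dim_q)
  moreover have "2 * k \<le> 3 * k ^ 2" using k by (simp add: power2_eq_square)
  ultimately show ?thesis by simp
qed

end

section \<open>The topological types of the cusps\<close>

text \<open>By invariance of domain a continuous injection of an open set suffices. F runs from the
  model B to the curve A, where the formula is explicit; the required homeomorphism is its
  inverse.\<close>

lemma top_equivalent_germsI:
  fixes F :: "complex \<times> complex \<Rightarrow> complex \<times> complex"
  assumes N: "open N" "(0, 0) \<in> N" and F: "continuous_on N F" "inj_on F N" "F (0, 0) = (0, 0)"
    and AB: "\<And>p. p \<in> N \<Longrightarrow> F p \<in> A \<longleftrightarrow> p \<in> B"
  shows "top_equivalent_germs A B"
proof -
  obtain g where g: "homeomorphism N (F ` N) F g"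
    using invariance_of_domain_homeomorphism[OF N(1) F(1) _ F(2)] by blast
  have gF: "g (F p) = p" if "p \<in> N" for p
    using g that by (rule homeomorphism_apply1)
  have "g ` (A \<inter> F ` N) = B \<inter> N"
  proof (intro Set.equalityI subsetI)
    fix q assume "q \<in> g ` (A \<inter> F ` N)"
    then obtain p where "p \<in> N" "F p \<in> A" "q = g (F p)" by blast
    then show "q \<in> B \<inter> N" using AB gF by simp
  next
    fix q assume "q \<in> B \<inter> N"
    then have "F q \<in> A \<inter> F ` N" "q = g (F q)" using AB gF by auto
    then show "q \<in> g ` (A \<inter> F ` N)" by blast
  qed
  moreover have "open (F ` N)" using F(1) N(1) F(2) by (rule invariance_of_domain)
  moreover have "homeomorphism (F ` N) N g F" using g by (rule homeomorphism_symD)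
  moreover have "(0, 0) \<in> F ` N" using N(2) F(3) by (metis imageI)
  moreover have "g (0, 0) = (0, 0)" using gF[OF N(2)] F(3) by simp
  ultimately show ?thesis unfolding top_equivalent_germs_def using N by blast
qed

text \<open>In this chart the curve is (v + u^k)^2 = u^(2k+1). A polynomial automorphism straightens
  the square, and replacing u by -u changes the sign of the odd power.\<close>

lemma top_type_q:
  assumes "k \<ge> 2"
  shows "top_equivalent_germs {(u, v). value3 (curve_C k) (affine_chart (\<lambda>c. c) (0, 1, 0) u v) = 0}
    {(u, v). u ^ (2 * k + 1) + v ^ 2 = 0}"
proof (rule top_equivalent_germsI)
  let ?F = "\<lambda>p :: complex \<times> complex. (- fst p, snd p - (- fst p) ^ k)"
  show "continuous_on UNIV ?F" by (intro continuous_intros)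
  show "inj_on ?F UNIV" by (rule inj_onI) (auto simp: prod_eq_iff)
  show "?F (0, 0) = (0, 0)" using assms by (simp add: power_0_left)
  show "?F p \<in> {(u, v). value3 (curve_C k) (affine_chart (\<lambda>c. c) (0, 1, 0) u v) = 0} \<longleftrightarrow>
      p \<in> {(u, v). u ^ (2 * k + 1) + v ^ 2 = 0}" for p
    by (cases p) (simp add: affine_chart_def value3_curve_C add.commute power_minus_odd eq_neg_iff_add_eq_0)
qed simp_all

text \<open>
  Near (0, 0, 1) the curve is parametrized by $(s^{2k-1}/(1-s), s^{2k+1}/(1-s))$ and the model by
  $(s^{2k-1}, s^{2k+1})$.  The function \<open>param\<close> extends the parameter s of the model to a
  neighbourhood of the origin: on the line through (u, v) the parameter is $u^k / v^{k-1}$, and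
  this is truncated to the disc of radius $|v/u|^{1/2}$, on whose boundary the model lies.
\<close>

definition trunc :: "real \<Rightarrow> complex \<Rightarrow> complex" where
  "trunc R w = of_real (min 1 (R / norm w)) * w"

definition param :: "nat \<Rightarrow> complex \<times> complex \<Rightarrow> complex" where
  "param k = (\<lambda>(u, v). if u = 0 \<or> v = 0 then 0
     else trunc (sqrt (norm (v / u))) (u ^ k / v ^ (k - 1)))"

lemma norm_trunc: "R \<ge> 0 \<Longrightarrow> w \<noteq> 0 \<Longrightarrow> norm (trunc R w) = min (norm w) R"
  by (simp add: trunc_def norm_mult min_def field_simps)

lemma trunc_id: "norm w \<le> R \<Longrightarrow> trunc R w = w"
  by (cases "w = 0") (simp_all add: trunc_def min_def field_simps)

lemma trunc_large: "R < norm w \<Longrightarrow> trunc R w = of_real (R / norm w) * w"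
  by (cases "w = 0") (simp_all add: trunc_def min_def field_simps)

text \<open>The equation says that w - w' is a difference of scaling factors times w w'. For
  truncations of modulus at most 1/4 the right side is at most a quarter of the distance of the
  moduli, hence of |w - w'|, which forces w = w'.\<close>

lemma trunc_inj_wlog:
  assumes "R > 0" "norm w \<le> norm w'" "norm (trunc R w) \<le> 1 / 4"
    and eq: "w * (1 - trunc R w') = w' * (1 - trunc R w)"
  shows "w = w'"
proof (cases "norm w' \<le> R")
  case True
  then show ?thesis using eq assms(2) by (simp add: trunc_id algebra_simps)
next
  case False
  then have w': "trunc R w' = of_real (R / norm w') * w'" and nw': "norm w' > 0"
    using assms(1) by (auto simp: trunc_large)
  define a where "a = min 1 (R / norm w)"
  have tw: "trunc R w = of_real a * w" unfolding trunc_def a_def ..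
  have "w - w' = of_real (R / norm w' - a) * (w * w')"
    using eq unfolding w' tw by (simp add: algebra_simps)
  then have n: "norm (w - w') = \<bar>R / norm w' - a\<bar> * (norm w * norm w')"
    by (simp only: norm_mult norm_of_real)
  have "\<bar>R / norm w' - a\<bar> * (norm w * norm w') \<le> 1 / 4 * (norm w' - norm w)"
  proof (cases "norm w \<le> R")
    case True
    then have a1: "a = 1 \<or> w = 0" and "norm w \<le> 1 / 4"
      using assms(3) by (auto simp: a_def min_def field_simps trunc_id)
    have "\<bar>R / norm w' - 1\<bar> * (norm w * norm w') = norm w * (norm w' - R)"
      using False nw' by (simp add: abs_if field_simps)
    also have "\<dots> \<le> 1 / 4 * (norm w' - norm w)"
      using False True \<open>norm w \<le> 1 / 4\<close> by (intro mult_mono) auto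
    finally have "\<bar>R / norm w' - 1\<bar> * (norm w * norm w') \<le> 1 / 4 * (norm w' - norm w)" .
    moreover have "w = 0 \<Longrightarrow> ?thesis" using nw' by simp
    ultimately show ?thesis using a1 by metis
  next
    case w: False
    then have nw: "norm w > 0" using assms(1) by linarith
    have a: "a = R / norm w" using w nw by (simp add: a_def min_def)
    have "R \<le> 1 / 4" using assms(3) w nw assms(1) by (subst (asm) norm_trunc) auto
    have "\<bar>R / norm w' - R / norm w\<bar> = R / norm w - R / norm w'"
      using assms(1,2) nw by (simp add: frac_le)
    then have "\<bar>R / norm w' - a\<bar> * (norm w * norm w') = (R / norm w - R / norm w') * (norm w * norm w')"
      unfolding a by (simp only:)
    also have "\<dots> = R * (norm w' - norm w)"
      using nw nw' by (simp add: field_simps)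
    also have "\<dots> \<le> 1 / 4 * (norm w' - norm w)"
      using \<open>R \<le> 1 / 4\<close> assms(2) by (intro mult_right_mono) auto
    finally show ?thesis .
  qed
  moreover have "norm w' - norm w \<le> norm (w - w')"
    using norm_triangle_ineq2[of w' w] by (simp add: norm_minus_commute)
  moreover have "x \<le> 1 / 4 * y \<Longrightarrow> y \<le> x \<Longrightarrow> x \<le> 1 / 4 * x" for x y :: real
    by linarith
  ultimately have "norm (w - w') \<le> 1 / 4 * norm (w - w')" unfolding n by blast
  then show ?thesis by simp
qed

lemma trunc_inj:
  assumes "R > 0" "norm (trunc R w) \<le> 1 / 4" "norm (trunc R w') \<le> 1 / 4"
    and "w * (1 - trunc R w') = w' * (1 - trunc R w)"
  shows "w = w'"
proof (cases "norm w \<le> norm w'")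
  case True
  then show ?thesis using trunc_inj_wlog assms by blast
next
  case False
  then show ?thesis using trunc_inj_wlog[of R w' w] assms by simp
qed

text \<open>Guarantees that the deformed curve equation has no solutions where the truncation is
  active: there |w| = |1 - s + w| R with R at most 1/4, while |1 - s + w| is at most 1 + |w| - R, so
  |w| - R would be at most a quarter of itself.\<close>

lemma trunc_fixed:
  assumes "norm (trunc R w) \<le> 1 / 4" "R > 0" and sq: "(1 - trunc R w + w) ^ 2 * m = w ^ 2"
    and R: "norm m = R ^ 2"
  shows "norm w \<le> R"
proof (rule ccontr)
  assume "\<not> norm w \<le> R"
  then have w: "norm w > R" "norm w > 0" using assms(2) by auto
  then have "R \<le> 1 / 4" using assms(1,2) by (subst (asm) norm_trunc) auto
  have "norm ((1 - trunc R w + w) ^ 2 * m) = norm (w ^ 2)" using sq by simp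
  then have "(norm (1 - trunc R w + w) * R) ^ 2 = norm w ^ 2"
    unfolding norm_mult norm_power R power_mult_distrib .
  then have e: "norm (1 - trunc R w + w) * R = norm w"
    by (rule power2_eq_imp_eq) (use assms(2) in simp_all)
  have "1 - trunc R w + w = 1 + of_real (1 - R / norm w) * w"
    using w by (simp add: trunc_large algebra_simps)
  then have "norm (1 - trunc R w + w) \<le> 1 + norm (of_real (1 - R / norm w) * w)"
    using norm_triangle_ineq[of 1 "of_real (1 - R / norm w) * w"] by (simp only: norm_one)
  also have "norm (of_real (1 - R / norm w) * w) = norm w - R"
    using w unfolding norm_mult norm_of_real by (simp add: field_simps)
  finally have "norm w \<le> (1 + (norm w - R)) * R"
    unfolding e[symmetric] using assms(2) by (intro mult_right_mono) auto
  then have "norm w - R \<le> (norm w - R) * R" by (simp add: algebra_simps)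
  also have "\<dots> \<le> (norm w - R) * (1 / 4)" using w \<open>R \<le> 1 / 4\<close> by (intro mult_left_mono) auto
  finally show False using w by simp
qed

section \<open>Continuity of the extended parameter and the homeomorphism at (0, 0, 1)\<close>

context
  fixes k :: nat
  assumes k: "k \<ge> 2"
begin

text \<open>One of the 2k-1 factors is bounded by |u^k / v^(k-1)| and the other 2k-2 by |v/u|^(1/2);
  the product of these bounds is |u|.\<close>

lemma param_power_le: "norm (param k (u, v)) ^ (2 * k - 1) \<le> norm u"
proof (cases "u = 0 \<or> v = 0")
  case True
  then show ?thesis using k by (auto simp: param_def power_0_left)
next
  case False
  define R where "R = sqrt (norm (v / u))"
  define w where "w = u ^ k / v ^ (k - 1)"
  have "w \<noteq> 0" "R \<ge> 0" using False by (auto simp: w_def R_def)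
  then have s: "norm (param k (u, v)) = min (norm w) R"
    using False by (simp add: param_def norm_trunc R_def w_def)
  have e: "2 * k - 1 = 1 + 2 * (k - 1)" using k by simp
  have "min (norm w) R ^ (2 * k - 1) = min (norm w) R * (min (norm w) R ^ 2) ^ (k - 1)"
    unfolding e power_add power_mult by simp
  also have "\<dots> \<le> norm w * (R ^ 2) ^ (k - 1)"
    using \<open>R \<ge> 0\<close> by (intro mult_mono power_mono) auto
  also have "R ^ 2 = norm v / norm u" by (simp add: R_def norm_divide)
  also have "norm w * (norm v / norm u) ^ (k - 1) = norm u"
  proof -
    have "norm u ^ k = norm u * norm u ^ (k - 1)" using k by (simp flip: power_Suc)
    then show ?thesis using False by (simp add: w_def norm_divide norm_power power_divide)
  qed
  finally show ?thesis unfolding s .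
qed

lemma param_square_le: "u \<noteq> 0 \<Longrightarrow> norm (param k (u, v)) \<le> sqrt (norm v / norm u)"
proof (cases "v = 0")
  case False
  assume "u \<noteq> 0"
  then show ?thesis using False
    by (simp add: param_def norm_trunc norm_divide)
qed (simp add: param_def)

text \<open>Only the axes need care: on u = 0 the parameter is squeezed by a root of |u|, elsewhere
  on v = 0 by the truncation radius |v/u|^(1/2).\<close>

lemma continuous_param: "continuous_on UNIV (param k)"
proof -
  have "isCont (param k) p" for p
  proof -
    obtain u v where p: "p = (u, v)" by (cases p)
    consider "u = 0" | "u \<noteq> 0" "v = 0" | "u \<noteq> 0" "v \<noteq> 0" by blast
    then show ?thesis
    proof cases
      case 1
      have "((\<lambda>q. root (2 * k - 1) (norm (fst q))) \<longlongrightarrow> root (2 * k - 1) (norm (fst p))) (at p)"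
        by (intro tendsto_intros)
      then have "((\<lambda>q. root (2 * k - 1) (norm (fst q))) \<longlongrightarrow> 0) (at p)" unfolding p 1 by simp
      moreover have "norm (param k q) \<le> root (2 * k - 1) (norm (fst q))" for q
      proof -
        have "norm (param k q) = root (2 * k - 1) (norm (param k q) ^ (2 * k - 1))"
          using k by (intro real_root_power_cancel[symmetric]) auto
        also have "\<dots> \<le> root (2 * k - 1) (norm (fst q))"
          using param_power_le[of "fst q" "snd q"] k by (intro real_root_le_mono) auto
        finally show ?thesis .
      qed
      ultimately have "((param k) \<longlongrightarrow> 0) (at p)"
        by (intro Lim_null_comparison[of "param k"]) auto
      then show ?thesis unfolding isCont_def p 1 by (simp add: param_def)
    next
      case 2
      have "((\<lambda>q. sqrt (norm (snd q) / norm (fst q))) \<longlongrightarrow> sqrt (norm (snd p) / norm (fst p))) (at p)"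
        using 2 by (intro tendsto_intros) (simp add: p)
      then have "((\<lambda>q. sqrt (norm (snd q) / norm (fst q))) \<longlongrightarrow> 0) (at p)" unfolding p 2 by simp
      moreover have "\<forall>\<^sub>F q in at p. norm (param k q) \<le> sqrt (norm (snd q) / norm (fst q))"
      proof -
        have "open {q :: complex \<times> complex. fst q \<noteq> 0}"
          by (intro open_Collect_neq continuous_intros)
        then have "\<forall>\<^sub>F q in at p. q \<in> {q :: complex \<times> complex. fst q \<noteq> 0}"
          using 2 by (intro eventually_at_in_open') (auto simp: p)
        then show ?thesis
          by (rule eventually_mono) (use param_square_le in \<open>auto simp: split_paired_all\<close>)
      qed
      ultimately have "((param k) \<longlongrightarrow> 0) (at p)"
        by (rule Lim_null_comparison[rotated])
      then show ?thesis unfolding isCont_def p 2 by (simp add: param_def)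
    next
      case 3
      define S where "S = {q :: complex \<times> complex. fst q \<noteq> 0 \<and> snd q \<noteq> 0}"
      have S: "open S" unfolding S_def
        by (intro open_Collect_conj open_Collect_neq continuous_intros)
      have "continuous_on S (\<lambda>q. trunc (sqrt (norm (snd q / fst q))) (fst q ^ k / snd q ^ (k - 1)))"
        unfolding trunc_def by (intro continuous_intros) (auto simp: S_def)
      then have "continuous_on S (param k)"
        by (rule continuous_on_eq) (auto simp: S_def param_def)
      then show ?thesis
        using continuous_on_interior[of S "param k" p] S 3 by (simp add: interior_open) (simp add: S_def p)
    qed
  qed
  then show ?thesis by (simp add: continuous_at_imp_continuous_on)
qed

text \<open>The map divides each point by 1 - s, where s is the extended parameter. It preserves
  every line through the origin, so injectivity is a question on one line at a time, settled by
  \<open>trunc_inj\<close>. On the model s is the true parameter, so the model goes to the curve,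
  and \<open>trunc_fixed\<close> shows that nothing else does. The reflection \<open>neg\<close>
  adjusts the sign.\<close>

lemma top_type_p:
  "top_equivalent_germs {(u, v). value3 (curve_C k) (affine_chart (\<lambda>c. c) (0, 0, 1) u v) = 0}
    {(u, v). u ^ (2 * k + 1) + v ^ (2 * k - 1) = 0}"
proof (rule top_equivalent_germsI)
  \<comment> \<open>Turns the bound of \<open>param_power_le\<close> into a parameter of modulus at
    most 1/4.\<close>
  define \<delta> :: real where "\<delta> = (1 / 4) ^ (2 * k - 1)"
  define F where "F = (\<lambda>p. (fst p / (1 - param k p), snd p / (1 - param k p)))"
  define N where "N = {p :: complex \<times> complex. norm (fst p) < \<delta>}"
  define neg where "neg = (\<lambda>p :: complex \<times> complex. (- fst p, snd p))"
  show "open N" unfolding N_def by (intro open_Collect_less continuous_intros)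
  show "(0, 0) \<in> N" by (simp add: N_def \<delta>_def)
  have small: "norm (param k p) \<le> 1 / 4" if "p \<in> N" for p
  proof -
    have "norm (param k p) ^ (2 * k - 1) \<le> (1 / 4) ^ (2 * k - 1)"
      using param_power_le[of "fst p" "snd p"] that unfolding N_def \<delta>_def by simp
    then show ?thesis by (rule power_mono_iff[THEN iffD1, rotated -1]) (use k in auto)
  qed
  have D: "1 - param k p \<noteq> 0" if "p \<in> N" for p
    using small[OF that] by auto
  have negN: "neg p \<in> N" if "p \<in> N" for p using that by (simp add: N_def neg_def)
  have "continuous_on N F"
    unfolding F_def using D
    by (intro continuous_intros continuous_on_subset[OF continuous_param]) auto
  moreover have "continuous_on N neg" unfolding neg_def by (intro continuous_intros)
  ultimately show "continuous_on N (F \<circ> neg)"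
    using negN by (intro continuous_on_compose) (auto intro: continuous_on_subset)
  have ratio: "fst p / snd p ^ (k - 1) * 0 = 0" for p :: "complex \<times> complex" by simp
  have scale: "fst p ^ k / snd p ^ (k - 1) = fst p / (snd p / fst p) ^ (k - 1)" if "fst p \<noteq> 0" for p :: "complex \<times> complex"
  proof -
    have "fst p ^ k = fst p * fst p ^ (k - 1)" using k by (simp flip: power_Suc)
    then show ?thesis by (simp add: power_divide)
  qed
  have "inj_on F N"
  proof (rule inj_onI)
    fix p p' assume pN: "p \<in> N" "p' \<in> N" and eq: "F p = F p'"
    have e1: "fst p * (1 - param k p') = fst p' * (1 - param k p)"
      and e2: "snd p * (1 - param k p') = snd p' * (1 - param k p)"
      using eq D[OF pN(1)] D[OF pN(2)] unfolding F_def by (simp_all add: frac_eq_eq)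
    have z: "fst p = 0 \<longleftrightarrow> fst p' = 0" "snd p = 0 \<longleftrightarrow> snd p' = 0"
      using e1 e2 D[OF pN(1)] D[OF pN(2)] by (auto simp del: right_minus_eq)
    have "param k p = param k p'"
    proof (cases "fst p = 0 \<or> snd p = 0")
      case True
      then have "fst p' = 0 \<or> snd p' = 0" using z by simp
      with True show ?thesis by (simp add: param_def split_beta)
    next
      case False
      then have nz: "fst p \<noteq> 0" "snd p \<noteq> 0" "fst p' \<noteq> 0" "snd p' \<noteq> 0" using z by auto
      \<comment> \<open>Points with the same image lie on the same line v = m u, so the truncation
        radius agrees and only u^k / v^(k-1) remains to be compared.\<close>
      define m where "m = snd p / fst p"
      have m: "snd p' / fst p' = m"
      proof -
        have "(snd p' * fst p) * ((1 - param k p) * (1 - param k p')) = (snd p * fst p') * ((1 - param k p) * (1 - param k p'))"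
          using e1 e2 by (metis (no_types, lifting) mult.assoc mult.commute)
        then have "snd p' * fst p = snd p * fst p'" using D[OF pN(1)] D[OF pN(2)] by simp
        then show ?thesis unfolding m_def using nz by (simp add: frac_eq_eq)
      qed
      define R where "R = sqrt (norm m)"
      have "R > 0" using nz by (simp add: R_def m_def)
      have w: "fst q ^ k / snd q ^ (k - 1) = fst q / m ^ (k - 1)" "param k q = trunc R (fst q / m ^ (k - 1))"
        if "q = p \<or> q = p'" for q
      proof -
        show 1: "fst q ^ k / snd q ^ (k - 1) = fst q / m ^ (k - 1)"
          using that scale[of q] nz m m_def by metis
        have "param k q = trunc (sqrt (norm (snd q / fst q))) (fst q ^ k / snd q ^ (k - 1))"
          using that nz by (auto simp: param_def split_beta)
        also have "snd q / fst q = m" using that m m_def by auto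
        finally show "param k q = trunc R (fst q / m ^ (k - 1))" unfolding 1 R_def .
      qed
      have "fst p / m ^ (k - 1) = fst p' / m ^ (k - 1)"
      proof (rule trunc_inj[OF \<open>R > 0\<close>])
        show "norm (trunc R (fst p / m ^ (k - 1))) \<le> 1 / 4" "norm (trunc R (fst p' / m ^ (k - 1))) \<le> 1 / 4"
          using small[OF pN(1)] small[OF pN(2)] w(2) by auto
        show "fst p / m ^ (k - 1) * (1 - trunc R (fst p' / m ^ (k - 1))) = fst p' / m ^ (k - 1) * (1 - trunc R (fst p / m ^ (k - 1)))"
          using e1 w(2)[of p] w(2)[of p'] by (simp add: divide_simps)
      qed
      then show ?thesis using w(2) by metis
    qed
    then show "p = p'" using e1 e2 D[OF pN(1)] by (simp add: prod_eq_iff)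
  qed
  moreover have "inj_on neg N" by (rule inj_onI) (simp add: neg_def prod_eq_iff)
  ultimately show "inj_on (F \<circ> neg) N"
    using negN by (intro comp_inj_on) (auto intro: inj_on_subset)
  show "(F \<circ> neg) (0, 0) = (0, 0)" by (simp add: F_def neg_def)
  have curve: "((v / D) ^ (k - 1) + (u / D) ^ k) ^ 2 * (v / D) - (u / D) ^ (2 * k + 1) = 0 \<longleftrightarrow>
      (v ^ (k - 1) * D + u ^ k) ^ 2 * v = u ^ (2 * k + 1)" if "D \<noteq> 0" for u v D :: complex
  proof -
    have "D ^ k = D ^ (k - 1) * D" using k by (simp flip: power_Suc2)
    then have "(v / D) ^ (k - 1) + (u / D) ^ k = (v ^ (k - 1) * D + u ^ k) / D ^ k"
      using that by (simp add: power_divide add_divide_distrib)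
    then have "((v / D) ^ (k - 1) + (u / D) ^ k) ^ 2 * (v / D) - (u / D) ^ (2 * k + 1) =
        ((v ^ (k - 1) * D + u ^ k) ^ 2 * v - u ^ (2 * k + 1)) / D ^ (2 * k + 1)"
      by (simp add: power_divide diff_divide_distrib mult.commute[of k 2] mult.commute[of D] flip: power_mult)
    then show ?thesis using that by simp
  qed
  \<comment> \<open>Multiplying by m = v/u and cancelling v^(2k-1) turns both equations into
    conditions on w = u^k / v^(k-1): (1 - s + w)^2 m = w^2 and w^2 = m.\<close>
  have key: "(v ^ (k - 1) * (1 - param k (u, v)) + u ^ k) ^ 2 * v = u ^ (2 * k + 1) \<longleftrightarrow> u ^ (2 * k + 1) = v ^ (2 * k - 1)"
    if "(u, v) \<in> N" for u v
  proof -
    have e: "2 * k - 1 = (k - 1) * 2 + 1" using k by simp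
    show ?thesis
    proof (cases "u = 0 \<or> v = 0")
      case True
      then show ?thesis using k unfolding e by (auto simp: param_def power_0_left power_mult)
    next
      case False
      define m where "m = v / u"
      define w where "w = u ^ k / v ^ (k - 1)"
      define R where "R = sqrt (norm m)"
      have nz: "u \<noteq> 0" "v \<noteq> 0" "m \<noteq> 0" "w \<noteq> 0" using False by (auto simp: m_def w_def)
      have "R > 0" "norm m = R ^ 2" using nz by (simp_all add: R_def)
      have pw: "param k (u, v) = trunc R w" using False by (simp add: param_def R_def m_def w_def)
      have V: "v ^ (2 * k - 1) = (v ^ (k - 1)) ^ 2 * v" unfolding e by (simp add: power_mult)
      have uk: "u ^ k = w * v ^ (k - 1)" using nz by (simp add: w_def)
      have U: "u ^ (2 * k + 1) * m = w ^ 2 * v ^ (2 * k - 1)"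
      proof -
        have "u ^ (2 * k + 1) * m = (u ^ k) ^ 2 * (u * m)" by (simp add: mult.commute[of 2 k] power_mult)
        also have "u * m = v" using nz by (simp add: m_def)
        finally show ?thesis unfolding uk V by (simp add: power_mult_distrib)
      qed
      have vnz: "v ^ (2 * k - 1) \<noteq> 0" using nz by simp
      have "(v ^ (k - 1) * (1 - trunc R w) + u ^ k) ^ 2 * v = (1 - trunc R w + w) ^ 2 * v ^ (2 * k - 1)"
        unfolding uk V by (simp add: power2_eq_square algebra_simps)
      then have "(v ^ (k - 1) * (1 - param k (u, v)) + u ^ k) ^ 2 * v = u ^ (2 * k + 1) \<longleftrightarrow>
          (1 - trunc R w + w) ^ 2 * v ^ (2 * k - 1) * m = u ^ (2 * k + 1) * m"
        unfolding pw using nz by simp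
      also have "\<dots> \<longleftrightarrow> (1 - trunc R w + w) ^ 2 * m = w ^ 2"
      proof -
        have "(1 - trunc R w + w) ^ 2 * v ^ (2 * k - 1) * m = ((1 - trunc R w + w) ^ 2 * m) * v ^ (2 * k - 1)"
          by simp
        then show ?thesis unfolding U using vnz by (metis mult_right_cancel)
      qed
      also have "\<dots> \<longleftrightarrow> w ^ 2 = m"
      proof
        assume sq: "(1 - trunc R w + w) ^ 2 * m = w ^ 2"
        have "norm w \<le> R"
          using trunc_fixed[OF _ \<open>R > 0\<close> sq \<open>norm m = R ^ 2\<close>] small[OF that] unfolding pw .
        then show "w ^ 2 = m" using sq by (simp add: trunc_id)
      next
        assume "w ^ 2 = m"
        then have "norm w ^ 2 = R ^ 2" using \<open>norm m = R ^ 2\<close> by (simp add: norm_power[symmetric])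
        then have "norm w = R" by (rule power2_eq_imp_eq) (use \<open>R > 0\<close> in simp_all)
        then show "(1 - trunc R w + w) ^ 2 * m = w ^ 2" using \<open>w ^ 2 = m\<close> by (simp add: trunc_id)
      qed
      also have "\<dots> \<longleftrightarrow> u ^ (2 * k + 1) = v ^ (2 * k - 1)"
      proof -
        have "u ^ (2 * k + 1) = v ^ (2 * k - 1) \<longleftrightarrow> u ^ (2 * k + 1) * m = m * v ^ (2 * k - 1)"
          using nz by (simp add: mult.commute)
        then show ?thesis unfolding U using vnz by (metis mult_right_cancel)
      qed
      finally show ?thesis .
    qed
  qed
  show "(F \<circ> neg) p \<in> {(u, v). value3 (curve_C k) (affine_chart (\<lambda>c. c) (0, 0, 1) u v) = 0} \<longleftrightarrow>
      p \<in> {(u, v). u ^ (2 * k + 1) + v ^ (2 * k - 1) = 0}" if "p \<in> N" for p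
  proof -
    obtain u v where p: "p = (u, v)" by (cases p)
    have uv: "(- u, v) \<in> N" using negN[OF that] by (simp add: p neg_def)
    define D where "D = 1 - param k (- u, v)"
    have "D \<noteq> 0" using D[OF uv] by (simp add: D_def)
    have chart: "affine_chart (\<lambda>c. c) (0, 0, 1) a b = (a, b, 1)" for a b :: complex
      by (simp add: affine_chart_def)
    have "(F \<circ> neg) p = (- u / D, v / D)" by (simp add: F_def neg_def p D_def)
    then have "(F \<circ> neg) p \<in> {(u, v). value3 (curve_C k) (affine_chart (\<lambda>c. c) (0, 0, 1) u v) = 0} \<longleftrightarrow>
        ((v / D) ^ (k - 1) + (- u / D) ^ k) ^ 2 * (v / D) - (- u / D) ^ (2 * k + 1) = 0"
      by (simp only: mem_Collect_eq prod.case chart value3_curve_C mult_1_right)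
    also have "\<dots> \<longleftrightarrow> (- u) ^ (2 * k + 1) = v ^ (2 * k - 1)"
      unfolding curve[OF \<open>D \<noteq> 0\<close>] unfolding D_def by (rule key[OF uv])
    also have "\<dots> \<longleftrightarrow> u ^ (2 * k + 1) + v ^ (2 * k - 1) = 0"
      by (simp add: power_minus_odd add_eq_0_iff) (metis minus_minus)
    finally show ?thesis unfolding p by simp
  qed
qed

end

section \<open>Evaluation of polynomials with many variables\<close>

definition pm_eval :: "('s::comm_ring_1 \<Rightarrow> 'b::comm_ring_1) \<Rightarrow> ('v \<Rightarrow> 'b) \<Rightarrow> (('v \<Rightarrow>\<^sub>0 nat) \<Rightarrow>\<^sub>0 's) \<Rightarrow> 'b" where
  "pm_eval \<iota> \<phi> p = (\<Sum>m\<in>Poly_Mapping.keys p. \<iota> (Poly_Mapping.lookup p m) *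
     (\<Prod>j\<in>Poly_Mapping.keys m. \<phi> j ^ Poly_Mapping.lookup m j))"

lemma poly_mapping_sum_single:
  "p = (\<Sum>m\<in>Poly_Mapping.keys p. Poly_Mapping.single m (Poly_Mapping.lookup p m))"
proof (rule poly_mapping_eqI)
  fix m
  have "Poly_Mapping.lookup (\<Sum>m\<in>Poly_Mapping.keys p. Poly_Mapping.single m (Poly_Mapping.lookup p m)) m =
      (\<Sum>n\<in>Poly_Mapping.keys p. if n = m then Poly_Mapping.lookup p m else 0)"
    unfolding lookup_sum by (intro sum.cong) (auto simp: lookup_single when_def)
  then show "Poly_Mapping.lookup p m =
      Poly_Mapping.lookup (\<Sum>m\<in>Poly_Mapping.keys p. Poly_Mapping.single m (Poly_Mapping.lookup p m)) m"
    by (simp add: sum.delta in_keys_iff)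
qed

context
  fixes \<iota> :: "'s::comm_ring_1 \<Rightarrow> 'b::comm_ring_1" and \<phi> :: "'v \<Rightarrow> 'b"
  assumes \<iota>: "comm_ring_hom \<iota>"
begin

interpretation \<iota>: comm_ring_hom \<iota> by (rule \<iota>)

definition pm_monom :: "('v \<Rightarrow>\<^sub>0 nat) \<Rightarrow> 'b" where
  "pm_monom m = (\<Prod>j\<in>Poly_Mapping.keys m. \<phi> j ^ Poly_Mapping.lookup m j)"

lemma pm_monom_superset:
  assumes "finite S" "Poly_Mapping.keys m \<subseteq> S"
  shows "pm_monom m = (\<Prod>j\<in>S. \<phi> j ^ Poly_Mapping.lookup m j)"
  unfolding pm_monom_def using assms
  by (intro prod.mono_neutral_left) (auto simp: in_keys_iff)

lemma pm_monom_add: "pm_monom (m + n) = pm_monom m * pm_monom n"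
proof -
  let ?S = "Poly_Mapping.keys m \<union> Poly_Mapping.keys n"
  have "pm_monom (m + n) = (\<Prod>j\<in>?S. \<phi> j ^ Poly_Mapping.lookup (m + n) j)"
    "pm_monom m = (\<Prod>j\<in>?S. \<phi> j ^ Poly_Mapping.lookup m j)"
    "pm_monom n = (\<Prod>j\<in>?S. \<phi> j ^ Poly_Mapping.lookup n j)"
    by (intro pm_monom_superset; use Poly_Mapping.keys_add[of m n] in auto)+
  then show ?thesis by (simp add: lookup_add power_add prod.distrib)
qed

lemma pm_eval_superset:
  assumes "finite S" "Poly_Mapping.keys p \<subseteq> S"
  shows "pm_eval \<iota> \<phi> p = (\<Sum>m\<in>S. \<iota> (Poly_Mapping.lookup p m) * pm_monom m)"
  unfolding pm_eval_def pm_monom_def using assms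
  by (intro sum.mono_neutral_left) (auto simp: in_keys_iff \<iota>.zero)

lemma pm_eval_add: "pm_eval \<iota> \<phi> (p + q) = pm_eval \<iota> \<phi> p + pm_eval \<iota> \<phi> q"
proof -
  let ?S = "Poly_Mapping.keys p \<union> Poly_Mapping.keys q"
  have "pm_eval \<iota> \<phi> (p + q) = (\<Sum>m\<in>?S. \<iota> (Poly_Mapping.lookup (p + q) m) * pm_monom m)"
    "pm_eval \<iota> \<phi> p = (\<Sum>m\<in>?S. \<iota> (Poly_Mapping.lookup p m) * pm_monom m)"
    "pm_eval \<iota> \<phi> q = (\<Sum>m\<in>?S. \<iota> (Poly_Mapping.lookup q m) * pm_monom m)"
    by (intro pm_eval_superset; use Poly_Mapping.keys_add[of p q] in auto)+
  then show ?thesis by (simp add: lookup_add \<iota>.add distrib_right sum.distrib)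
qed

lemma pm_eval_0: "pm_eval \<iota> \<phi> 0 = 0"
  by (simp add: pm_eval_def)

lemma pm_eval_sum: "pm_eval \<iota> \<phi> (sum f A) = (\<Sum>x\<in>A. pm_eval \<iota> \<phi> (f x))"
  by (induction A rule: infinite_finite_induct) (simp_all add: pm_eval_0 pm_eval_add)

lemma pm_eval_single: "pm_eval \<iota> \<phi> (Poly_Mapping.single m c) = \<iota> c * pm_monom m"
  by (simp add: pm_eval_superset[of "{m}"])

lemma pm_eval_mult: "pm_eval \<iota> \<phi> (p * q) = pm_eval \<iota> \<phi> p * pm_eval \<iota> \<phi> q"
proof -
  let ?s = "\<lambda>p m. Poly_Mapping.single m (Poly_Mapping.lookup p m)"
  have "p * q = (\<Sum>m\<in>Poly_Mapping.keys p. ?s p m) * (\<Sum>n\<in>Poly_Mapping.keys q. ?s q n)"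
    using poly_mapping_sum_single[of p] poly_mapping_sum_single[of q] by simp
  also have "\<dots> = (\<Sum>m\<in>Poly_Mapping.keys p. \<Sum>n\<in>Poly_Mapping.keys q. ?s p m * ?s q n)"
    by (rule sum_product)
  also have "pm_eval \<iota> \<phi> \<dots> = (\<Sum>m\<in>Poly_Mapping.keys p. \<Sum>n\<in>Poly_Mapping.keys q.
      (\<iota> (Poly_Mapping.lookup p m) * pm_monom m) * (\<iota> (Poly_Mapping.lookup q n) * pm_monom n))"
    by (simp add: pm_eval_sum mult_single pm_eval_single pm_monom_add \<iota>.mult mult_ac)
  also have "\<dots> = pm_eval \<iota> \<phi> p * pm_eval \<iota> \<phi> q"
    by (simp add: sum_product pm_eval_superset[OF finite_keys order.refl])
  finally show ?thesis .
qed

lemma comm_ring_hom_pm_eval: "comm_ring_hom (pm_eval \<iota> \<phi>)"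
proof
  show "pm_eval \<iota> \<phi> 1 = 1"
    using pm_eval_single[of 0 1] by (simp add: \<iota>.one pm_monom_def)
qed (simp_all add: pm_eval_add pm_eval_mult)

lemma pm_eval_const: "pm_eval \<iota> \<phi> (Poly_Mapping.single 0 c) = \<iota> c"
  by (simp add: pm_eval_single pm_monom_def)

lemma pm_eval_var: "pm_eval \<iota> \<phi> (Poly_Mapping.single (Poly_Mapping.single j 1) 1) = \<phi> j"
  by (simp add: pm_eval_single pm_monom_def \<iota>.one)

end

lemma comm_ring_hom_const_poly: "comm_ring_hom (\<lambda>c. [:c:])"
  by unfold_locales (simp_all add: one_pCons)

lemma comm_ring_hom_sym_const: "comm_ring_hom sym_const"
  by unfold_locales (simp_all add: sym_const_def single_add mult_single)

interpretation sym_const: comm_ring_hom sym_const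
  by (rule comm_ring_hom_sym_const)

lemma pm_eval_identity: "pm_eval sym_const sym_var p = p"
proof -
  have pow: "sym_var j ^ n = Poly_Mapping.single (Poly_Mapping.single j n) 1" for j n
    by (induction n) (simp_all add: sym_var_def mult_single flip: single_add)
  have "(\<Prod>j\<in>S. sym_var j ^ Poly_Mapping.lookup m j) =
      Poly_Mapping.single (\<Sum>j\<in>S. Poly_Mapping.single j (Poly_Mapping.lookup m j)) 1" for m S
    by (induction S rule: infinite_finite_induct) (simp_all add: pow mult_single)
  then have "(\<Prod>j\<in>Poly_Mapping.keys m. sym_var j ^ Poly_Mapping.lookup m j) = Poly_Mapping.single m 1" for m
    using poly_mapping_sum_single[of m] by simp
  then show ?thesis
    unfolding pm_eval_def sym_const_def using poly_mapping_sum_single[of p] by (simp add: mult_single)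
qed

lemma sym_eval_pm_eval: "sym_eval = pm_eval (\<lambda>c. [:c:]) (\<lambda>j. Polynomial.monom j 1)"
  by (rule ext) (simp add: sym_eval_def pm_eval_def)

interpretation sym_eval: comm_ring_hom sym_eval
  unfolding sym_eval_pm_eval by (rule comm_ring_hom_pm_eval[OF comm_ring_hom_const_poly])

lemma sym_eval_const: "sym_eval (sym_const s) = [:s:]"
  unfolding sym_eval_pm_eval sym_const_def by (rule pm_eval_const[OF comm_ring_hom_const_poly])

lemma sym_eval_var: "sym_eval (sym_var j) = Polynomial.monom j 1"
  unfolding sym_eval_pm_eval sym_var_def by (rule pm_eval_var[OF comm_ring_hom_const_poly])

section \<open>The Rees algebra and the symmetric algebra\<close>

lemma S_ring_ideal: "ideal J S_ring \<Longrightarrow> a \<in> J \<Longrightarrow> b \<in> J \<Longrightarrow> a + b \<in> J"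
  "ideal J S_ring \<Longrightarrow> a \<in> J \<Longrightarrow> r * a \<in> J" "ideal J S_ring \<Longrightarrow> 0 \<in> J" "ideal J S_ring \<Longrightarrow> a \<in> J \<Longrightarrow> - a \<in> J"
  using type_ring.ideal_closed[of J] unfolding ring_of_type_algebra_UNIV by auto

context
  fixes J :: "poly3 set"
  assumes J: "ideal J S_ring"
begin

lemma ideal_ideal_power: "ideal (ideal_power J n) S_ring"
proof -
  interpret ring S_ring by (rule ring_from_type_algebra)
  show ?thesis
    by (induction n) (auto intro: oneideal ideal_prod_is_ideal J)
qed

lemma ideal_power_mult:
  assumes "a \<in> ideal_power J m" "b \<in> ideal_power J n"
  shows "a * b \<in> ideal_power J (m + n)"
  using assms(1)
proof (induction m arbitrary: a)
  case 0
  then show ?case using S_ring_ideal(2)[OF ideal_ideal_power assms(2)] by simp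
next
  case (Suc m)
  from Suc.prems have "a \<in> ideal_prod S_ring J (ideal_power J m)" by simp
  then show ?case
  proof (induction a rule: ideal_prod.induct)
    case (prod i j)
    have "i \<otimes>\<^bsub>S_ring\<^esub> (j * b) \<in> ideal_prod S_ring J (ideal_power J (m + n))"
      using prod Suc.IH by (intro ideal_prod.prod) auto
    then show ?case by (simp add: type_algebra_simps mult.assoc)
  next
    case (sum s1 s2)
    from S_ring_ideal(1)[OF ideal_ideal_power sum.IH] show ?case
      by (simp only: type_algebra_simps distrib_right)
  qed
qed

lemma ideal_power_1: "j \<in> J \<Longrightarrow> j \<in> ideal_power J 1"
  using ideal_prod.prod[of j J 1 "carrier S_ring" S_ring]
  by (simp add: ring_of_type_algebra_def)

definition rees_carrier :: "poly3 poly set" where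
  "rees_carrier = {p. \<forall>n. Polynomial.coeff p n \<in> ideal_power J n}"

lemma subring_type_rees: "subring_type rees_carrier"
proof
  have UNIV0: "a \<in> ideal_power J 0" for a by (simp add: type_algebra_simps)
  have zero: "0 \<in> ideal_power J n" for n using S_ring_ideal(3)[OF ideal_ideal_power] .
  show "0 \<in> rees_carrier" "1 \<in> rees_carrier"
    using zero UNIV0 by (auto simp: rees_carrier_def coeff_pCons one_pCons simp del: ideal_power.simps split: nat.splits)
  show "x + y \<in> rees_carrier" if "x \<in> rees_carrier" "y \<in> rees_carrier" for x y
    using that S_ring_ideal(1)[OF ideal_ideal_power] by (simp add: rees_carrier_def)
  show "- x \<in> rees_carrier" if "x \<in> rees_carrier" for x
    using that S_ring_ideal(4)[OF ideal_ideal_power] by (simp add: rees_carrier_def)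
  show "x * y \<in> rees_carrier" if "x \<in> rees_carrier" "y \<in> rees_carrier" for x y
    unfolding rees_carrier_def mem_Collect_eq coeff_mult
  proof
    fix n
    have "Polynomial.coeff x i * Polynomial.coeff y (n - i) \<in> ideal_power J n" if "i \<le> n" for i
      using ideal_power_mult[of _ i _ "n - i"] \<open>x \<in> rees_carrier\<close> \<open>y \<in> rees_carrier\<close> that
      by (auto simp: rees_carrier_def)
    moreover have sum: "sum h A \<in> ideal_power J n" if "\<And>i. i \<in> A \<Longrightarrow> h i \<in> ideal_power J n"
      for A :: "nat set" and h
      using that by (induction A rule: infinite_finite_induct) (auto intro: zero S_ring_ideal(1)[OF ideal_ideal_power])
    ultimately show "(\<Sum>i\<le>n. Polynomial.coeff x i * Polynomial.coeff y (n - i)) \<in> ideal_power J n"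
      by (intro sum) auto
  qed
qed

interpretation rees: subring_type rees_carrier
  by (rule subring_type_rees)

definition sym_carrier :: "sym_poly set" where
  "sym_carrier = {p. \<forall>m\<in>Poly_Mapping.keys p. Poly_Mapping.keys m \<subseteq> J}"

lemma subring_type_sym: "subring_type sym_carrier"
proof
  show "0 \<in> sym_carrier" "1 \<in> sym_carrier" by (simp_all add: sym_carrier_def)
  show "x + y \<in> sym_carrier" if "x \<in> sym_carrier" "y \<in> sym_carrier" for x y
    using that Poly_Mapping.keys_add[of x y] unfolding sym_carrier_def by blast
  show "- x \<in> sym_carrier" if "x \<in> sym_carrier" for x
  proof -
    have "Poly_Mapping.keys (- x) = Poly_Mapping.keys x" by (auto simp: in_keys_iff)
    then show ?thesis using that by (simp add: sym_carrier_def)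
  qed
  show "x * y \<in> sym_carrier" if x: "x \<in> sym_carrier" and y: "y \<in> sym_carrier" for x y
    unfolding sym_carrier_def
  proof (intro CollectI ballI)
    fix m assume "m \<in> Poly_Mapping.keys (x * y)"
    then obtain a b where "m = a + b" "a \<in> Poly_Mapping.keys x" "b \<in> Poly_Mapping.keys y"
      using Poly_Mapping.keys_mult[of x y] by blast
    then show "Poly_Mapping.keys m \<subseteq> J"
      using x y Poly_Mapping.keys_add[of a b] unfolding sym_carrier_def by blast
  qed
qed

interpretation sym: subring_type sym_carrier
  by (rule subring_type_sym)

lemma rings_eq: "rees_algebra J = rees.R" "sym_poly_ring J = sym.R"
  by (simp_all add: rees_algebra_def rees_carrier_def sym_poly_ring_def sym_carrier_def)

lemma sym_carrier_gens: "sym_const s \<in> sym_carrier" "j \<in> J \<Longrightarrow> sym_var j \<in> sym_carrier"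
  by (auto simp: sym_carrier_def sym_const_def sym_var_def split: if_splits)

lemma sym_relations_carrier: "sym_relations J \<subseteq> sym_carrier"
  unfolding sym_relations_def
  by (auto intro!: sym.C_diff sym.C_closed sym_carrier_gens S_ring_ideal[OF J])

definition sym_ideal :: "sym_poly set" where
  "sym_ideal = genideal (sym_poly_ring J) (sym_relations J)"

lemma ideal_sym_ideal: "ideal sym_ideal sym.R"
proof -
  interpret cring sym.R by (rule sym.cring_R)
  show ?thesis unfolding sym_ideal_def rings_eq
    by (rule genideal_ideal) (simp add: sym.R_simps sym_relations_carrier)
qed

lemmas sym_ideal_closed = sym.ideal_closed[OF ideal_sym_ideal]

lemma sym_ideal_relations:
  "a \<in> J \<Longrightarrow> b \<in> J \<Longrightarrow> sym_var (a + b) - sym_var a - sym_var b \<in> sym_ideal"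
  "a \<in> J \<Longrightarrow> sym_var (s * a) - sym_const s * sym_var a \<in> sym_ideal"
proof -
  interpret cring sym.R by (rule sym.cring_R)
  have "sym_relations J \<subseteq> sym_ideal" unfolding sym_ideal_def rings_eq
    by (rule genideal_self) (simp add: sym.R_simps sym_relations_carrier)
  then show "a \<in> J \<Longrightarrow> b \<in> J \<Longrightarrow> sym_var (a + b) - sym_var a - sym_var b \<in> sym_ideal"
    "a \<in> J \<Longrightarrow> sym_var (s * a) - sym_const s * sym_var a \<in> sym_ideal"
    unfolding sym_relations_def by blast+
qed

text \<open>The preimage of an ideal is an ideal, so only the defining relations have to be tested.
  Applied to the map into the Rees algebra and to the map into the ring in three variables.\<close>

lemma sym_ideal_induct:
  fixes h :: "sym_poly \<Rightarrow> 'b::comm_ring_1"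
  assumes "comm_ring_hom h" "0 \<in> N" "\<And>x y. x \<in> N \<Longrightarrow> y \<in> N \<Longrightarrow> x + y \<in> N" "\<And>x r. x \<in> N \<Longrightarrow> r * x \<in> N"
    and rel: "\<And>a b. a \<in> J \<Longrightarrow> b \<in> J \<Longrightarrow> h (sym_var (a + b)) - h (sym_var a) - h (sym_var b) \<in> N"
      "\<And>s a. a \<in> J \<Longrightarrow> h (sym_var (s * a)) - h (sym_const s) * h (sym_var a) \<in> N"
    and p: "p \<in> sym_ideal"
  shows "h p \<in> N"
proof -
  interpret h: comm_ring_hom h by fact
  interpret cring sym.R by (rule sym.cring_R)
  have "ideal {p \<in> sym_carrier. h p \<in> N} sym.R"
    by (rule sym.idealI_type) (use assms in \<open>auto simp: h.simps intro!: sym.C_closed\<close>)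
  moreover have "sym_relations J \<subseteq> {p \<in> sym_carrier. h p \<in> N}"
  proof
    fix x assume x: "x \<in> sym_relations J"
    then have "h x \<in> N" using rel unfolding sym_relations_def by (auto simp: h.simps)
    then show "x \<in> {p \<in> sym_carrier. h p \<in> N}" using x sym_relations_carrier by blast
  qed
  ultimately have "sym_ideal \<subseteq> {p \<in> sym_carrier. h p \<in> N}"
    unfolding sym_ideal_def rings_eq by (rule genideal_minimal)
  then show ?thesis using p by blast
qed

lemma sym_eval_ideal: "p \<in> sym_ideal \<Longrightarrow> sym_eval p = 0"
  using sym_ideal_induct[OF sym_eval.comm_ring_hom_axioms, of "{0}" p]
  by (simp add: sym_eval_var sym_eval_const smult_monom flip: add_monom)

lemma sym_to_rees_coset: "sym_to_rees (sym_ideal +>\<^bsub>sym.R\<^esub> p) = sym_eval p"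
proof -
  have "sym_eval ` (sym_ideal +>\<^bsub>sym.R\<^esub> p) = {sym_eval p}"
    using sym_eval_ideal sym_ideal_closed(2)
    unfolding a_r_coset_def' sym.R_simps by (auto simp: sym_eval.simps image_iff intro!: exI[of _ 0])
  then show ?thesis by (simp add: sym_to_rees_def)
qed

lemma sym_eval_in_rees: "p \<in> sym_carrier \<Longrightarrow> sym_eval p \<in> rees_carrier"
proof -
  assume p: "p \<in> sym_carrier"
  have "a \<in> ideal_power J 0" for a by (simp add: type_algebra_simps)
  then have "[:c:] \<in> rees_carrier" for c
    using S_ring_ideal(3)[OF ideal_ideal_power]
    by (auto simp: rees_carrier_def coeff_pCons simp del: ideal_power.simps split: nat.splits)
  moreover have "Polynomial.monom j 1 \<in> rees_carrier" if "j \<in> J" for j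
    using S_ring_ideal(3)[OF ideal_ideal_power] ideal_power_1[OF that] by (auto simp: rees_carrier_def)
  ultimately show ?thesis
    using p unfolding sym_eval_pm_eval pm_eval_def sym_carrier_def
    by (intro rees.C_sum rees.C_closed rees.C_prod rees.C_power) auto
qed

lemma sym_eval_surj:
  assumes "q \<in> rees_carrier"
  shows "\<exists>p\<in>sym_carrier. sym_eval p = q"
proof -
  have mon: "\<exists>p\<in>sym_carrier. sym_eval p = Polynomial.monom a n" if "a \<in> ideal_power J n" for a n
    using that
  proof (induction n arbitrary: a)
    case 0
    show ?case using sym_carrier_gens(1)[of a] sym_eval_const[of a] by (auto simp: monom_0)
  next
    case (Suc n)
    from Suc.prems have "a \<in> ideal_prod S_ring J (ideal_power J n)" by simp
    then show ?case
    proof (induction a rule: ideal_prod.induct)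
      case (prod i j)
      obtain p where "p \<in> sym_carrier" "sym_eval p = Polynomial.monom j n" using Suc.IH[OF prod(2)] by blast
      then show ?case
        by (intro bexI[of _ "sym_var i * p"])
          (auto simp: sym_eval.mult sym_eval_var mult_monom ring_of_type_algebra_def
            intro!: sym.C_closed sym_carrier_gens prod)
    next
      case (sum s1 s2)
      then obtain p1 p2 where "p1 \<in> sym_carrier" "sym_eval p1 = Polynomial.monom s1 (Suc n)"
        "p2 \<in> sym_carrier" "sym_eval p2 = Polynomial.monom s2 (Suc n)" by blast
      then show ?case
        by (intro bexI[of _ "p1 + p2"])
          (auto simp: sym_eval.add ring_of_type_algebra_def add_monom intro!: sym.C_closed)
    qed
  qed
  have "\<forall>n. \<exists>p. p \<in> sym_carrier \<and> sym_eval p = Polynomial.monom (Polynomial.coeff q n) n"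
  proof
    fix n
    have "Polynomial.coeff q n \<in> ideal_power J n" using assms unfolding rees_carrier_def by blast
    from mon[OF this] show "\<exists>p. p \<in> sym_carrier \<and> sym_eval p = Polynomial.monom (Polynomial.coeff q n) n"
      by blast
  qed
  from choice[OF this] obtain P where P: "\<And>n. P n \<in> sym_carrier"
    "\<And>n. sym_eval (P n) = Polynomial.monom (Polynomial.coeff q n) n" by blast
  have "sym_eval (\<Sum>n\<le>Polynomial.degree q. P n) = q"
    using poly_as_sum_of_monoms[of q] by (simp add: sym_eval.sum P)
  then show ?thesis using P(1) by (intro bexI[of _ "\<Sum>n\<le>Polynomial.degree q. P n"] sym.C_sum) auto
qed

lemma sym_algebra_eq: "sym_algebra J = sym.R Quot sym_ideal"
  unfolding sym_algebra_def sym_ideal_def rings_eq ..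

lemma carrier_sym_algebra: "carrier (sym.R Quot sym_ideal) = (\<lambda>p. sym_ideal +>\<^bsub>sym.R\<^esub> p) ` sym_carrier"
  unfolding FactRing_def A_RCOSETS_def' by (auto simp: sym.R_simps)

text \<open>The induced map is always a well-defined surjective homomorphism, so only its kernel
  matters.\<close>

lemma linear_type_iff: "linear_type J \<longleftrightarrow> (\<forall>p\<in>sym_carrier. sym_eval p = 0 \<longrightarrow> p \<in> sym_ideal)"
proof
  assume lin: "linear_type J"
  have inj: "inj_on sym_to_rees (carrier (sym_algebra J))"
    using lin unfolding linear_type_def ring_iso_def bij_betw_def by blast
  show "\<forall>p\<in>sym_carrier. sym_eval p = 0 \<longrightarrow> p \<in> sym_ideal"
  proof (intro ballI impI)
    fix p assume p: "p \<in> sym_carrier" "sym_eval p = 0"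
    have car: "sym_ideal +>\<^bsub>sym.R\<^esub> r \<in> carrier (sym_algebra J)" if "r \<in> sym_carrier" for r
      using that unfolding sym_algebra_eq carrier_sym_algebra by blast
    have "sym_ideal +>\<^bsub>sym.R\<^esub> p = sym_ideal +>\<^bsub>sym.R\<^esub> 0"
      using p by (intro inj_onD[OF inj] car) (simp_all add: sym_to_rees_coset sym_eval.zero sym.C_closed)
    then show "p \<in> sym_ideal"
      using sym.coset_eq_iff[OF ideal_sym_ideal p(1) sym.C_closed(1)] by simp
  qed
next
  assume ker: "\<forall>p\<in>sym_carrier. sym_eval p = 0 \<longrightarrow> p \<in> sym_ideal"
  interpret I: ideal sym_ideal sym.R by (rule ideal_sym_ideal)
  note car = carrier_sym_algebra
  have q: "ring_hom_ring sym.R (sym.R Quot sym_ideal) ((+>\<^bsub>sym.R\<^esub>) sym_ideal)"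
    by (rule I.rcos_ring_hom_ring)
  interpret q: ring_hom_ring sym.R "sym.R Quot sym_ideal" "(+>\<^bsub>sym.R\<^esub>) sym_ideal" by (rule q)
  have "sym_to_rees \<in> ring_hom (sym.R Quot sym_ideal) rees.R"
  proof (rule ring_hom_memI)
    fix x assume "x \<in> carrier (sym.R Quot sym_ideal)"
    then obtain p where p: "p \<in> sym_carrier" "x = sym_ideal +>\<^bsub>sym.R\<^esub> p" unfolding car by blast
    then show "sym_to_rees x \<in> carrier rees.R"
      using sym_eval_in_rees by (simp add: sym_to_rees_coset rees.R_simps)
    fix y assume "y \<in> carrier (sym.R Quot sym_ideal)"
    then obtain r where r: "r \<in> sym_carrier" "y = sym_ideal +>\<^bsub>sym.R\<^esub> r" unfolding car by blast
    have "x \<otimes>\<^bsub>sym.R Quot sym_ideal\<^esub> y = sym_ideal +>\<^bsub>sym.R\<^esub> (p * r)"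
      "x \<oplus>\<^bsub>sym.R Quot sym_ideal\<^esub> y = sym_ideal +>\<^bsub>sym.R\<^esub> (p + r)"
      using q.hom_mult[of p r] q.hom_add[of p r] p r by (simp_all add: sym.R_simps)
    then show "sym_to_rees (x \<otimes>\<^bsub>sym.R Quot sym_ideal\<^esub> y) = sym_to_rees x \<otimes>\<^bsub>rees.R\<^esub> sym_to_rees y"
      "sym_to_rees (x \<oplus>\<^bsub>sym.R Quot sym_ideal\<^esub> y) = sym_to_rees x \<oplus>\<^bsub>rees.R\<^esub> sym_to_rees y"
      unfolding p(2) r(2) by (simp_all add: sym_to_rees_coset sym_eval.simps rees.R_simps)
  next
    have "\<one>\<^bsub>sym.R Quot sym_ideal\<^esub> = sym_ideal +>\<^bsub>sym.R\<^esub> 1"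
      using q.hom_one by (simp add: sym.R_simps)
    then show "sym_to_rees \<one>\<^bsub>sym.R Quot sym_ideal\<^esub> = \<one>\<^bsub>rees.R\<^esub>"
      by (simp add: sym_to_rees_coset sym_eval.one rees.R_simps)
  qed
  moreover have "bij_betw sym_to_rees (carrier (sym.R Quot sym_ideal)) (carrier rees.R)"
  proof (rule bij_betw_imageI)
    show "inj_on sym_to_rees (carrier (sym.R Quot sym_ideal))"
    proof (rule inj_onI)
      fix x y assume "x \<in> carrier (sym.R Quot sym_ideal)" "y \<in> carrier (sym.R Quot sym_ideal)"
        and eq: "sym_to_rees x = sym_to_rees y"
      then obtain p r where p: "p \<in> sym_carrier" "x = sym_ideal +>\<^bsub>sym.R\<^esub> p"
        and r: "r \<in> sym_carrier" "y = sym_ideal +>\<^bsub>sym.R\<^esub> r" unfolding car by blast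
      then have "sym_eval (p - r) = 0" using eq by (simp add: sym_to_rees_coset sym_eval.diff)
      then have "p - r \<in> sym_ideal" using ker sym.C_diff[OF p(1) r(1)] by blast
      then show "x = y" unfolding p(2) r(2) using sym.coset_eq_iff[OF ideal_sym_ideal p(1) r(1)] by blast
    qed
    show "sym_to_rees ` carrier (sym.R Quot sym_ideal) = carrier rees.R"
    proof (intro Set.equalityI subsetI)
      fix x assume "x \<in> sym_to_rees ` carrier (sym.R Quot sym_ideal)"
      then show "x \<in> carrier rees.R"
        unfolding car using sym_eval_in_rees by (auto simp: sym_to_rees_coset rees.R_simps)
    next
      fix x assume "x \<in> carrier rees.R"
      then obtain p where "p \<in> sym_carrier" "sym_eval p = x"
        using sym_eval_surj by (auto simp: rees.R_simps)
      then show "x \<in> sym_to_rees ` carrier (sym.R Quot sym_ideal)"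
        unfolding car by (auto simp: sym_to_rees_coset image_iff intro!: bexI[of _ p])
    qed
  qed
  ultimately show "linear_type J"
    unfolding linear_type_def sym_algebra_eq rings_eq ring_iso_def by blast
qed

end

section \<open>Ideals of linear type generated by three partial derivatives\<close>

text \<open>
  The polynomial ring over S in three variables, corresponding to the three partial derivatives;
  the innermost variable is the one for the partial derivative with respect to z, the outermost
  one for the partial derivative with respect to y.
\<close>

type_synonym spoly = "poly3 poly poly poly"

abbreviation tconst :: "poly3 \<Rightarrow> spoly" where "tconst s \<equiv> [:[:[:s:]:]:]"

definition tX :: spoly where "tX = [:[:0, 1:]:]"
text \<open>Outermost because pseudo-division by the first syzygy, which does not involve
  \<open>tX\<close>, eliminates this variable.\<close>

definition tY :: spoly where "tY = [:0, 1:]"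
definition tZ :: spoly where "tZ = [:[:[:0, 1:]:]:]"

definition spoly_eval :: "(poly3 \<Rightarrow> 'b::comm_ring_1) \<Rightarrow> spoly \<Rightarrow> 'b \<Rightarrow> 'b \<Rightarrow> 'b \<Rightarrow> 'b" where
  "spoly_eval \<iota> F a b c =
     poly (map_poly (\<lambda>q. poly (map_poly (\<lambda>r. poly (map_poly \<iota> r) c) q) a) F) b"

lemma comm_ring_hom_spoly_eval:
  assumes "comm_ring_hom \<iota>"
  shows "comm_ring_hom (\<lambda>F. spoly_eval \<iota> F a b c)"
  unfolding spoly_eval_def by (intro comm_ring_hom.comm_ring_hom_poly assms)

lemma spoly_eval_vars:
  assumes "comm_ring_hom \<iota>"
  shows "spoly_eval \<iota> tX a b c = a" "spoly_eval \<iota> tY a b c = b" "spoly_eval \<iota> tZ a b c = c"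
    "spoly_eval \<iota> (tconst s) a b c = \<iota> s"
proof -
  interpret comm_ring_hom \<iota> by fact
  show "spoly_eval \<iota> tX a b c = a" "spoly_eval \<iota> tY a b c = b" "spoly_eval \<iota> tZ a b c = c"
    "spoly_eval \<iota> (tconst s) a b c = \<iota> s"
    by (simp_all add: spoly_eval_def tX_def tY_def tZ_def map_poly_pCons simps)
qed

lemma comm_ring_hom_tconst: "comm_ring_hom tconst"
  by unfold_locales (simp_all add: one_pCons)

interpretation tconst: comm_ring_hom tconst
  by (rule comm_ring_hom_tconst)

lemma poly_hom_ext:
  assumes "comm_ring_hom \<phi>" "comm_ring_hom \<psi>" "\<And>c. \<phi> [:c:] = \<psi> [:c:]" "\<phi> [:0, 1:] = \<psi> [:0, 1:]"
  shows "\<phi> p = \<psi> p"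
proof (induction p)
  case 0
  show ?case using assms(3)[of 0] by simp
next
  case (pCons a p)
  interpret \<phi>: comm_ring_hom \<phi> by fact
  interpret \<psi>: comm_ring_hom \<psi> by fact
  have e: "pCons a p = [:a:] + [:0, 1:] * p" by simp
  show ?case unfolding e \<phi>.simps \<psi>.simps assms(3,4) pCons ..
qed

lemma spoly_hom_ext:
  fixes \<phi> \<psi> :: "spoly \<Rightarrow> 'b::comm_ring_1"
  assumes h: "comm_ring_hom \<phi>" "comm_ring_hom \<psi>" and c: "\<And>s. \<phi> (tconst s) = \<psi> (tconst s)"
    and v: "\<phi> tX = \<psi> tX" "\<phi> tY = \<psi> tY" "\<phi> tZ = \<psi> tZ"
  shows "\<phi> F = \<psi> F"
proof -
  have 1: "comm_ring_hom (\<lambda>q. \<eta> [:q:])" if "comm_ring_hom \<eta>" for \<eta> :: "'a::comm_ring_1 poly \<Rightarrow> 'b"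
    using comm_ring_hom_compose[OF comm_ring_hom_const_poly that] .
  have "\<phi> [:[:r:]:] = \<psi> [:[:r:]:]" for r
    using poly_hom_ext[OF 1[OF 1[OF h(1)]] 1[OF 1[OF h(2)]]] c v(3) unfolding tZ_def by blast
  then have "\<phi> [:q:] = \<psi> [:q:]" for q
    using poly_hom_ext[OF 1[OF h(1)] 1[OF h(2)]] v(1) unfolding tX_def by blast
  then show ?thesis using poly_hom_ext[OF h] v(2) unfolding tY_def by blast
qed

definition linear_form :: "poly3 \<times> poly3 \<times> poly3 \<Rightarrow> spoly" where
  "linear_form r = tconst (fst r) * tX + tconst (fst (snd r)) * tY + tconst (snd (snd r)) * tZ"

lemma linear_form_add: "linear_form (r + r') = linear_form r + linear_form r'"
  by (simp only: linear_form_def fst_add snd_add tconst.add distrib_right add_ac)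

lemma linear_form_smult: "linear_form (smult_triple s r) = tconst s * linear_form r"
  by (simp only: linear_form_def smult_triple_def case_prod_unfold fst_conv snd_conv tconst.mult
      distrib_left mult.assoc)

lemma linear_form_minus: "linear_form (r - r') = linear_form r - linear_form r'"
  using linear_form_add[of "r - r'" r'] by simp

definition rees_eval :: "poly3 \<Rightarrow> spoly \<Rightarrow> poly3 poly" where
  "rees_eval f F = spoly_eval (\<lambda>s. [:s:]) F (Polynomial.monom (dx f) 1) (Polynomial.monom (dy f) 1)
     (Polynomial.monom (dz f) 1)"

interpretation rees_eval: comm_ring_hom "rees_eval f" for f
  unfolding rees_eval_def by (rule comm_ring_hom_spoly_eval[OF comm_ring_hom_const_poly])

lemma rees_eval_gens:
  "rees_eval f (tconst s) = [:s:]" "rees_eval f tX = Polynomial.monom (dx f) 1"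
  "rees_eval f tY = Polynomial.monom (dy f) 1" "rees_eval f tZ = Polynomial.monom (dz f) 1"
  by (simp_all add: rees_eval_def spoly_eval_vars[OF comm_ring_hom_const_poly])

lemma rees_eval_linear_form:
  "rees_eval f (linear_form (a, b, c)) = Polynomial.monom (a * dx f + b * dy f + c * dz f) 1"
  unfolding linear_form_def rees_eval.add rees_eval.mult rees_eval_gens fst_conv snd_conv
  by (simp add: smult_monom add_monom)

lemma ideal_jacobian: "ideal (jacobian_ideal f) S_ring"
proof -
  interpret ring S_ring by (rule ring_from_type_algebra)
  show ?thesis unfolding jacobian_ideal_def by (rule genideal_ideal) (simp add: type_algebra_simps)
qed

lemma jacobian_ideal_iff: "j \<in> jacobian_ideal f \<longleftrightarrow> (\<exists>a b c. j = a * dx f + b * dy f + c * dz f)"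
proof
  interpret ring S_ring by (rule ring_from_type_algebra)
  have sub: "{dx f, dy f, dz f} \<subseteq> carrier S_ring" by (simp add: type_algebra_simps)
  have gens: "dx f \<in> jacobian_ideal f" "dy f \<in> jacobian_ideal f" "dz f \<in> jacobian_ideal f"
    using genideal_self[OF sub] unfolding jacobian_ideal_def by auto
  note J = S_ring_ideal[OF ideal_jacobian]
  show "j \<in> jacobian_ideal f" if "\<exists>a b c. j = a * dx f + b * dy f + c * dz f"
    using that gens J by metis
  define K where "K = {j. \<exists>a b c. j = a * dx f + b * dy f + c * dz f}"
  have "ideal K (ring_of_type_algebra\<lparr>carrier := UNIV\<rparr>)"
  proof (rule type_ring.idealI_type)
    show "0 \<in> K" unfolding K_def by (auto intro!: exI[of _ 0])
    fix x y r assume "x \<in> K"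
    then obtain a b c where x: "x = a * dx f + b * dy f + c * dz f" unfolding K_def by blast
    have "r * x = (r * a) * dx f + (r * b) * dy f + (r * c) * dz f" unfolding x by (simp add: algebra_simps)
    then show "r * x \<in> K" unfolding K_def by blast
    assume "y \<in> K"
    then obtain a' b' c' where y: "y = a' * dx f + b' * dy f + c' * dz f" unfolding K_def by blast
    have "x + y = (a + a') * dx f + (b + b') * dy f + (c + c') * dz f"
      unfolding x y by (simp add: algebra_simps)
    then show "x + y \<in> K" unfolding K_def by blast
  qed simp
  moreover have "dx f = 1 * dx f + 0 * dy f + 0 * dz f" "dy f = 0 * dx f + 1 * dy f + 0 * dz f"
    "dz f = 0 * dx f + 0 * dy f + 1 * dz f" by simp_all
  then have "{dx f, dy f, dz f} \<subseteq> K" unfolding K_def by blast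
  ultimately have "jacobian_ideal f \<subseteq> K"
    unfolding jacobian_ideal_def ring_of_type_algebra_UNIV by (rule genideal_minimal)
  then show "\<exists>a b c. j = a * dx f + b * dy f + c * dz f" if "j \<in> jacobian_ideal f"
    using that unfolding K_def by blast
qed

text \<open>When r1 and r2 generate all syzygies, the quotient by this ideal is the usual
  presentation of the symmetric algebra of the Jacobian ideal.\<close>

definition syz_ideal :: "poly3 \<times> poly3 \<times> poly3 \<Rightarrow> poly3 \<times> poly3 \<times> poly3 \<Rightarrow> spoly set" where
  "syz_ideal r1 r2 = {A * linear_form r1 + B * linear_form r2 | A B. True}"

lemma syz_ideal_closed:
  "0 \<in> syz_ideal r1 r2" "x \<in> syz_ideal r1 r2 \<Longrightarrow> y \<in> syz_ideal r1 r2 \<Longrightarrow> x + y \<in> syz_ideal r1 r2"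
  "x \<in> syz_ideal r1 r2 \<Longrightarrow> r * x \<in> syz_ideal r1 r2"
proof -
  show "0 \<in> syz_ideal r1 r2" unfolding syz_ideal_def by (force intro: exI[of _ 0])
  assume "x \<in> syz_ideal r1 r2"
  then obtain A B where x: "x = A * linear_form r1 + B * linear_form r2" unfolding syz_ideal_def by blast
  have "r * x = (r * A) * linear_form r1 + (r * B) * linear_form r2" unfolding x by (simp only: distrib_left mult.assoc)
  then show "r * x \<in> syz_ideal r1 r2" unfolding syz_ideal_def by blast
  assume "y \<in> syz_ideal r1 r2"
  then obtain A' B' where y: "y = A' * linear_form r1 + B' * linear_form r2" unfolding syz_ideal_def by blast
  have "x + y = (A + A') * linear_form r1 + (B + B') * linear_form r2" unfolding x y by (simp only: distrib_right add_ac)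
  then show "x + y \<in> syz_ideal r1 r2" unfolding syz_ideal_def by blast
qed

context
  fixes f :: poly3 and r1 r2 :: "poly3 \<times> poly3 \<times> poly3"
  assumes distinct: "dx f \<noteq> dy f" "dx f \<noteq> dz f" "dy f \<noteq> dz f"
    and syz: "r1 \<in> AR f" "r2 \<in> AR f"
      "\<And>r. r \<in> AR f \<Longrightarrow> \<exists>s t. r = smult_triple s r1 + smult_triple t r2"
begin

abbreviation (input) "J \<equiv> jacobian_ideal f"

lemma linear_form_syz:
  assumes "r \<in> AR f"
  shows "linear_form r \<in> syz_ideal r1 r2"
proof -
  obtain s t where r: "r = smult_triple s r1 + smult_triple t r2" using syz(3)[OF assms] by blast
  show ?thesis unfolding r linear_form_add linear_form_smult syz_ideal_def by blast
qed

text \<open>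
  The generators are treated separately so that each of them is sent to a single variable.
\<close>

definition coeffs_of :: "poly3 \<Rightarrow> poly3 \<times> poly3 \<times> poly3" where
  "coeffs_of j = (if j = dx f then (1, 0, 0) else if j = dy f then (0, 1, 0) else if j = dz f then (0, 0, 1)
     else SOME r. j = fst r * dx f + fst (snd r) * dy f + snd (snd r) * dz f)"

lemma coeffs_of:
  assumes "j \<in> J"
  shows "j = fst (coeffs_of j) * dx f + fst (snd (coeffs_of j)) * dy f + snd (snd (coeffs_of j)) * dz f"
proof -
  have "\<exists>r. j = fst r * dx f + fst (snd r) * dy f + snd (snd r) * dz f"
    using assms unfolding jacobian_ideal_iff by auto
  from someI_ex[OF this] show ?thesis unfolding coeffs_of_def by simp
qed

text \<open>Together with \<open>from_spoly\<close> it compares the presentation with one variable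
  for each element of the ideal to the one with three variables; the two maps are inverse to each
  other modulo the relations.\<close>

definition to_spoly :: "sym_poly \<Rightarrow> spoly" where
  "to_spoly = pm_eval tconst (\<lambda>j. linear_form (coeffs_of j))"

definition from_spoly :: "spoly \<Rightarrow> sym_poly" where
  "from_spoly F = spoly_eval sym_const F (sym_var (dx f)) (sym_var (dy f)) (sym_var (dz f))"

interpretation to_spoly: comm_ring_hom to_spoly
  unfolding to_spoly_def by (rule comm_ring_hom_pm_eval[OF comm_ring_hom_tconst])

interpretation from_spoly: comm_ring_hom from_spoly
  unfolding from_spoly_def by (rule comm_ring_hom_spoly_eval[OF comm_ring_hom_sym_const])

lemma to_spoly_gens: "to_spoly (sym_const s) = tconst s" "to_spoly (sym_var j) = linear_form (coeffs_of j)"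
  unfolding to_spoly_def sym_const_def sym_var_def
  by (rule pm_eval_const[OF comm_ring_hom_tconst], rule pm_eval_var[OF comm_ring_hom_tconst])

lemma from_spoly_gens:
  "from_spoly (tconst s) = sym_const s" "from_spoly tX = sym_var (dx f)"
  "from_spoly tY = sym_var (dy f)" "from_spoly tZ = sym_var (dz f)"
  by (simp_all add: from_spoly_def spoly_eval_vars[OF comm_ring_hom_sym_const])

lemma coeffs_of_gens:
  "linear_form (coeffs_of (dx f)) = tX" "linear_form (coeffs_of (dy f)) = tY" "linear_form (coeffs_of (dz f)) = tZ"
  using distinct by (auto simp: coeffs_of_def linear_form_def simp flip: one_pCons)

lemma to_spoly_from_spoly: "to_spoly (from_spoly F) = F"
  by (rule spoly_hom_ext[OF comm_ring_hom_compose[OF from_spoly.comm_ring_hom_axioms to_spoly.comm_ring_hom_axioms]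
        comm_ring_hom_id])
     (simp_all only: from_spoly_gens to_spoly_gens coeffs_of_gens)

lemma sym_eval_from_spoly: "sym_eval (from_spoly F) = rees_eval f F"
  by (rule spoly_hom_ext[OF comm_ring_hom_compose[OF from_spoly.comm_ring_hom_axioms sym_eval.comm_ring_hom_axioms]
        rees_eval.comm_ring_hom_axioms])
     (simp_all only: from_spoly_gens rees_eval_gens sym_eval_const sym_eval_var)

lemma J_gens: "dx f \<in> J" "dy f \<in> J" "dz f \<in> J"
proof -
  have "dx f = 1 * dx f + 0 * dy f + 0 * dz f" "dy f = 0 * dx f + 1 * dy f + 0 * dz f"
    "dz f = 0 * dx f + 0 * dy f + 1 * dz f" by simp_all
  then show "dx f \<in> J" "dy f \<in> J" "dz f \<in> J" unfolding jacobian_ideal_iff by blast+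
qed

interpretation sym: subring_type "sym_carrier J"
  by (rule subring_type_sym[OF ideal_jacobian])

lemma from_spoly_carrier: "from_spoly F \<in> sym_carrier J"
  unfolding from_spoly_def spoly_eval_def
proof -
  have poly_closed: "poly (map_poly h p) a \<in> sym_carrier J"
    if "comm_ring_hom h" "a \<in> sym_carrier J" "\<And>c. h c \<in> sym_carrier J"
    for h :: "'c::comm_ring_1 \<Rightarrow> sym_poly" and a p
    unfolding poly_hom_expand[OF that(1)] using that(2,3)
    by (intro sym.C_sum sym.C_closed sym.C_power)
  note g = sym_carrier_gens[OF ideal_jacobian]
  note h = comm_ring_hom.comm_ring_hom_poly
  show "poly (map_poly (\<lambda>q. poly (map_poly (\<lambda>r. poly (map_poly sym_const r) (sym_var (dz f))) q) (sym_var (dx f))) F) (sym_var (dy f)) \<in> sym_carrier J"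
    by (intro poly_closed h comm_ring_hom_sym_const g J_gens)
qed

text \<open>The chosen coefficients do not depend linearly on the element, but the defect of
  linearity is a syzygy, hence its linear form lies in the target ideal.\<close>

lemma to_spoly_ideal: "p \<in> sym_ideal J \<Longrightarrow> to_spoly p \<in> syz_ideal r1 r2"
proof (rule sym_ideal_induct[OF ideal_jacobian to_spoly.comm_ring_hom_axioms])
  fix s a b
  have AR: "r \<in> AR f \<longleftrightarrow> fst r * dx f + fst (snd r) * dy f + snd (snd r) * dz f = 0" for r
    by (simp add: AR_def case_prod_unfold)
  assume a: "a \<in> J"
  have "coeffs_of (s * a) - smult_triple s (coeffs_of a) \<in> AR f"
  proof -
    have sa: "s * a \<in> J" using S_ring_ideal(2)[OF ideal_jacobian a] .
    have "fst (c - smult_triple s d) * dx f + fst (snd (c - smult_triple s d)) * dy f + snd (snd (c - smult_triple s d)) * dz f =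
        (fst c * dx f + fst (snd c) * dy f + snd (snd c) * dz f) - s * (fst d * dx f + fst (snd d) * dy f + snd (snd d) * dz f)" for c d
      by (simp add: smult_triple_def case_prod_unfold algebra_simps)
    then show ?thesis
      unfolding AR using coeffs_of[OF a] coeffs_of[OF sa] by (simp only: diff_self)
  qed
  then show "to_spoly (sym_var (s * a)) - to_spoly (sym_const s) * to_spoly (sym_var a) \<in> syz_ideal r1 r2"
    using linear_form_syz by (simp only: to_spoly_gens linear_form_minus[symmetric] linear_form_smult[symmetric])
  assume b: "b \<in> J"
  have "coeffs_of (a + b) - coeffs_of a - coeffs_of b \<in> AR f"
  proof -
    have ab: "a + b \<in> J" using S_ring_ideal(1)[OF ideal_jacobian a b] .
    have "fst (c - d - e) * dx f + fst (snd (c - d - e)) * dy f + snd (snd (c - d - e)) * dz f =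
        (fst c * dx f + fst (snd c) * dy f + snd (snd c) * dz f) -
        (fst d * dx f + fst (snd d) * dy f + snd (snd d) * dz f) -
        (fst e * dx f + fst (snd e) * dy f + snd (snd e) * dz f)" for c d e
      by (simp add: algebra_simps)
    then show ?thesis
      unfolding AR using coeffs_of[OF a] coeffs_of[OF b] coeffs_of[OF ab] by simp
  qed
  then show "to_spoly (sym_var (a + b)) - to_spoly (sym_var a) - to_spoly (sym_var b) \<in> syz_ideal r1 r2"
    using linear_form_syz by (simp only: to_spoly_gens linear_form_minus[symmetric])
qed (auto intro: syz_ideal_closed)

lemma from_spoly_linear_form:
  assumes "j = a * dx f + b * dy f + c * dz f"
  shows "sym_var j - from_spoly (linear_form (a, b, c)) \<in> sym_ideal J"
proof -
  note cl = sym_ideal_closed[OF ideal_jacobian]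
  note rel = sym_ideal_relations[OF ideal_jacobian]
  note J = S_ring_ideal[OF ideal_jacobian]
  have ab: "a * dx f \<in> J" "b * dy f \<in> J" "c * dz f \<in> J" "a * dx f + b * dy f \<in> J"
    using J J_gens by blast+
  have "sym_var j - from_spoly (linear_form (a, b, c)) =
      (sym_var (a * dx f + b * dy f + c * dz f) - sym_var (a * dx f + b * dy f) - sym_var (c * dz f)) +
      (sym_var (a * dx f + b * dy f) - sym_var (a * dx f) - sym_var (b * dy f)) +
      (sym_var (a * dx f) - sym_const a * sym_var (dx f)) + (sym_var (b * dy f) - sym_const b * sym_var (dy f)) +
      (sym_var (c * dz f) - sym_const c * sym_var (dz f))"
    unfolding assms linear_form_def from_spoly.add from_spoly.mult from_spoly_gens fst_conv snd_conv by simp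
  also have "\<dots> \<in> sym_ideal J"
    using ab J_gens by (intro cl(3) rel)
  finally show ?thesis .
qed

lemma from_spoly_syz: "(a, b, c) \<in> AR f \<Longrightarrow> from_spoly (linear_form (a, b, c)) \<in> sym_ideal J"
proof -
  assume "(a, b, c) \<in> AR f"
  then have "0 = a * dx f + b * dy f + c * dz f" by (simp add: AR_def)
  from from_spoly_linear_form[OF this] have "sym_var 0 - from_spoly (linear_form (a, b, c)) \<in> sym_ideal J" .
  \<comment> \<open>The variable attached to the element 0 is nonzero in the polynomial ring; the
    scalar relation with s = 0 puts it into the ideal.\<close>
  moreover have "sym_var (0 * dx f) - sym_const 0 * sym_var (dx f) \<in> sym_ideal J"
    by (rule sym_ideal_relations(2)[OF ideal_jacobian J_gens(1)])
  then have "sym_var 0 \<in> sym_ideal J" by (simp add: sym_const.zero)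
  ultimately have "sym_var 0 - (sym_var 0 - from_spoly (linear_form (a, b, c))) \<in> sym_ideal J"
    using sym_ideal_closed(6)[OF ideal_jacobian] by blast
  then show ?thesis by simp
qed

lemma from_spoly_ideal: "F \<in> syz_ideal r1 r2 \<Longrightarrow> from_spoly F \<in> sym_ideal J"
proof -
  assume "F \<in> syz_ideal r1 r2"
  then obtain A B where F: "F = A * linear_form r1 + B * linear_form r2" unfolding syz_ideal_def by blast
  note cl = sym_ideal_closed[OF ideal_jacobian]
  have "from_spoly (linear_form r1) \<in> sym_ideal J" "from_spoly (linear_form r2) \<in> sym_ideal J"
    using from_spoly_syz syz(1,2) by (cases r1, blast, cases r2, blast)
  then show ?thesis
    unfolding F from_spoly.add from_spoly.mult by (intro cl(3) cl(4) from_spoly_carrier)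
qed

text \<open>Each variable is congruent to its image, and congruence passes to powers, products and
  sums. All factors stay in the carrier, as the ideal absorbs only those.\<close>

lemma from_spoly_to_spoly:
  assumes "p \<in> sym_carrier J"
  shows "p - from_spoly (to_spoly p) \<in> sym_ideal J"
proof -
  note cl = sym_ideal_closed[OF ideal_jacobian]
  let ?\<psi> = "\<lambda>j. from_spoly (linear_form (coeffs_of j))"
  have "from_spoly (to_spoly p) = pm_eval sym_const ?\<psi> p"
    unfolding to_spoly_def pm_eval_def from_spoly.sum from_spoly.mult from_spoly.prod from_spoly.power
      from_spoly_gens ..
  moreover have "p = pm_eval sym_const sym_var p" by (rule pm_eval_identity[symmetric])
  ultimately have e: "p - from_spoly (to_spoly p) = (\<Sum>m\<in>Poly_Mapping.keys p. sym_const (Poly_Mapping.lookup p m) *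
      ((\<Prod>j\<in>Poly_Mapping.keys m. sym_var j ^ Poly_Mapping.lookup m j) - (\<Prod>j\<in>Poly_Mapping.keys m. ?\<psi> j ^ Poly_Mapping.lookup m j)))"
    unfolding pm_eval_def by (simp add: right_diff_distrib sum_subtractf)
  have var: "sym_var j - ?\<psi> j \<in> sym_ideal J" if "j \<in> J" for j
  proof -
    obtain a b c where abc: "coeffs_of j = (a, b, c)" by (cases "coeffs_of j")
    show ?thesis using from_spoly_linear_form[of j a b c] coeffs_of[OF that] unfolding abc by simp
  qed
  have mult: "x * y - x' * y' \<in> sym_ideal J"
    if "x - x' \<in> sym_ideal J" "y - y' \<in> sym_ideal J" "x \<in> sym_carrier J" "y' \<in> sym_carrier J" for x x' y y'
  proof -
    have "x * y - x' * y' = x * (y - y') + y' * (x - x')" by (simp add: algebra_simps)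
    also have "\<dots> \<in> sym_ideal J" using that by (intro cl(3) cl(4))
    finally show ?thesis .
  qed
  have pow: "sym_var j ^ n - ?\<psi> j ^ n \<in> sym_ideal J" if "j \<in> J" for j n
  proof (induction n)
    case 0
    show ?case by (simp add: cl(2))
  next
    case (Suc n)
    then show ?case unfolding power_Suc
      using that by (intro mult var sym_carrier_gens[OF ideal_jacobian] sym.C_power from_spoly_carrier)
  qed
  have prod: "(\<Prod>j\<in>A. sym_var j ^ e j) - (\<Prod>j\<in>A. ?\<psi> j ^ e j) \<in> sym_ideal J" if "A \<subseteq> J" for A and e :: "poly3 \<Rightarrow> nat"
    using that
  proof (induction A rule: infinite_finite_induct)
    case (insert j A)
    then show ?case
      unfolding prod.insert[OF insert.hyps]
      by (intro mult pow sym_carrier_gens[OF ideal_jacobian] sym.C_power sym.C_prod from_spoly_carrier) auto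
  qed (simp_all add: cl(2))
  have "Poly_Mapping.keys m \<subseteq> J" if "m \<in> Poly_Mapping.keys p" for m
    using assms that unfolding sym_carrier_def[OF ideal_jacobian] by blast
  then show ?thesis
    unfolding e
    by (intro sym.ideal_sum[OF ideal_sym_ideal[OF ideal_jacobian]] cl(4) prod sym_carrier_gens[OF ideal_jacobian]) auto
qed

theorem linear_type_jacobian_iff:
  "linear_type (jacobian_ideal f) \<longleftrightarrow> (\<forall>F. rees_eval f F = 0 \<longrightarrow> F \<in> syz_ideal r1 r2)"
proof -
  note cl = sym_ideal_closed[OF ideal_jacobian]
  show ?thesis
    unfolding linear_type_iff[OF ideal_jacobian]
  proof (intro iffI allI ballI impI)
    fix F assume lin: "\<forall>p\<in>sym_carrier J. sym_eval p = 0 \<longrightarrow> p \<in> sym_ideal J" and "rees_eval f F = 0"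
    then have "from_spoly F \<in> sym_ideal J" using from_spoly_carrier sym_eval_from_spoly by simp
    then show "F \<in> syz_ideal r1 r2" using to_spoly_ideal to_spoly_from_spoly by metis
  next
    fix p assume ker: "\<forall>F. rees_eval f F = 0 \<longrightarrow> F \<in> syz_ideal r1 r2" and p: "p \<in> sym_carrier J" "sym_eval p = 0"
    have d: "p - from_spoly (to_spoly p) \<in> sym_ideal J" by (rule from_spoly_to_spoly[OF p(1)])
    then have "sym_eval (p - from_spoly (to_spoly p)) = 0" by (rule sym_eval_ideal[OF ideal_jacobian])
    then have "rees_eval f (to_spoly p) = 0" using p(2) by (simp add: sym_eval.diff sym_eval_from_spoly)
    then have "from_spoly (to_spoly p) \<in> sym_ideal J" using ker from_spoly_ideal by blast
    from cl(3)[OF d this] show "p \<in> sym_ideal J" by simp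
  qed
qed

end

section \<open>The Jacobian ideal of the curve\<close>

lemma map_poly_comm_ring_hom:
  assumes "comm_ring_hom \<phi>"
  shows "comm_ring_hom (map_poly \<phi>)"
proof
  interpret comm_ring_hom \<phi> by fact
  show m_add: "map_poly \<phi> (p + q) = map_poly \<phi> p + map_poly \<phi> q" for p q
    by (simp add: poly_eq_iff coeff_map_poly zero add)
  have m_smult: "map_poly \<phi> (Polynomial.smult c p) = Polynomial.smult (\<phi> c) (map_poly \<phi> p)" for c p
    by (simp add: poly_eq_iff coeff_map_poly zero mult)
  show "map_poly \<phi> (p * q) = map_poly \<phi> p * map_poly \<phi> q" for p q
    by (induction p) (simp_all add: map_poly_pCons zero m_add m_smult)
  show "map_poly \<phi> 1 = 1" by (simp add: one)
qed

lemma map_poly_dvd_diff: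
  fixes d :: "'a::idom" and \<phi> :: "'a \<Rightarrow> 'a"
  assumes "\<And>c. d dvd c - \<phi> c" "\<phi> 0 = 0"
  shows "[:d:] dvd p - map_poly \<phi> p"
  unfolding const_poly_dvd_iff using assms by (simp add: coeff_map_poly)

lemma syz_ideal_iff: "F \<in> syz_ideal r1 r2 \<longleftrightarrow> (\<exists>A B. F = A * linear_form r1 + B * linear_form r2)"
  unfolding syz_ideal_def by blast

lemma syz_in_syz_ideal: "linear_form r1 \<in> syz_ideal r1 r2" "linear_form r2 \<in> syz_ideal r1 r2"
  unfolding syz_ideal_iff by (intro exI[of _ 1] exI[of _ 0]; simp) (intro exI[of _ 0] exI[of _ 1]; simp)

lemma two_const3: "(2 :: poly3) = const3 2"
  by (simp add: numeral_poly)

context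
  fixes k :: nat
  assumes k: "k \<ge> 2"
begin

text \<open>At (1, 0, 0) the partial derivatives take the distinct values -(2k+1), 1 and 0.\<close>

lemma partials_distinct:
  "dx (curve_C k) \<noteq> dy (curve_C k)" "dx (curve_C k) \<noteq> dz (curve_C k)" "dy (curve_C k) \<noteq> dz (curve_C k)"
proof -
  let ?v = "\<lambda>f. value3 f (1, 0, 0)"
  have "?v (dx (curve_C k)) = - of_nat (2 * k + 1)"
    unfolding dx_curve_C[OF k] curve_Q_def value3.simps value3_vars by simp
  moreover have "?v (dy (curve_C k)) = 1" using k
    unfolding dy_curve_C[OF k] curve_L_def value3.simps value3_vars value3_curve_g by (simp add: power_0_left)
  moreover have "?v (dz (curve_C k)) = 0" using k
    unfolding dz_curve_C[OF k] value3.simps value3_vars by simp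
  moreover have "- of_nat (2 * k + 1) \<noteq> (1 :: complex)" "- of_nat (2 * k + 1) \<noteq> (0 :: complex)"
  proof -
    have "of_nat (2 * k + 1) + 1 \<noteq> (0 :: complex)" "of_nat (2 * k + 1) \<noteq> (0 :: complex)"
      using of_nat_eq_0_iff[of "2 * k + 2", where ?'a = complex] of_nat_eq_0_iff[of "2 * k + 1", where ?'a = complex]
      by simp_all
    then show "- of_nat (2 * k + 1) \<noteq> (1 :: complex)" "- of_nat (2 * k + 1) \<noteq> (0 :: complex)"
      by (metis add.commute add.right_inverse minus_minus, metis neg_equal_0_iff_equal)
  qed
  ultimately show "dx (curve_C k) \<noteq> dy (curve_C k)" "dx (curve_C k) \<noteq> dz (curve_C k)" "dy (curve_C k) \<noteq> dz (curve_C k)"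
    by (metis, metis, metis zero_neq_one)
qed

lemma rees_eval_syz: "rees_eval (curve_C k) (linear_form (syz1 k)) = 0" "rees_eval (curve_C k) (linear_form (syz2 k)) = 0"
proof -
  have "rees_eval (curve_C k) (linear_form r) = 0" if "r \<in> AR (curve_C k)" for r
    using that by (cases r) (simp add: rees_eval_linear_form AR_def)
  then show "rees_eval (curve_C k) (linear_form (syz1 k)) = 0" "rees_eval (curve_C k) (linear_form (syz2 k)) = 0"
    using syz_in_AR[OF k] by blast+
qed

lemma syz_kappa_nonzero: "syz_kappa k \<noteq> 0"
proof -
  have "(2 * k + 1) * (2 * k - 1) ^ 2 \<noteq> 0" using k by simp
  then show ?thesis unfolding syz_kappa_def by (simp only: of_nat_eq_0_iff divide_eq_0_iff) simp
qed

text \<open>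
  Both syzygies are combinations of the two elements $x^{k-1}$ and $y^{k-2}$, so the determinant
  of the coefficients vanishes in the Rees algebra (a Jacobian dual).
\<close>

lemma not_linear_type:
  assumes k3: "k \<ge> 3"
  shows "\<exists>F. rees_eval (curve_C k) F = 0 \<and> F \<notin> syz_ideal (syz1 k) (syz2 k)"
proof -
  define x y z where "x = tconst var_x" and "y = tconst var_y" and "z = tconst var_z"
  define kap where "kap = tconst (const3 (syz_kappa k))"
  define b11 where "b11 = - (x * tZ)"
  define b12 where "b12 = 2 * y * y * tY - of_nat (2 * k - 1) * y * z * tZ"
  define b21 where "b21 = x * tX + of_nat (2 * k + 1) * x * tY - of_nat (2 * k) * y * tY
    + of_nat (2 * k * (k - 1)) * z * tZ"
  define b22 where "b22 = y * z * tX - of_nat (2 * k + 1) * (of_nat (2 * k - 1) * (y * z)) * tY + kap * z ^ 2 * tZ"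
  define F where "F = b11 * b22 - b12 * b21"
  obtain n where n: "k = Suc (Suc n)" using le_Suc_ex[OF k] by auto
  have pw: "x ^ k = x * x ^ (k - 1)" "y ^ k = y * y * y ^ (k - 2)" "y ^ (k - 1) = y * y ^ (k - 2)"
    by (simp_all add: n mult.assoc)
  have s1: "linear_form (syz1 k) = x ^ (k - 1) * b11 + y ^ (k - 2) * b12"
    unfolding linear_form_def syz1_def curve_L_def fst_conv snd_conv tconst.simps b11_def b12_def
      x_def[symmetric] y_def[symmetric] z_def[symmetric] pw
    by (simp only: mult_zero_left) (simp add: algebra_simps)
  have s2: "linear_form (syz2 k) = x ^ (k - 1) * b21 + y ^ (k - 2) * b22"
    unfolding linear_form_def syz2_def curve_g_def syz_b_def syz_c_def fst_conv snd_conv tconst.simps b21_def b22_def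
      x_def[symmetric] y_def[symmetric] z_def[symmetric] kap_def[symmetric] pw
    by (simp add: algebra_simps del: of_nat_mult of_nat_add of_nat_Suc)
  \<comment> \<open>Cramer's rule; since x^(k-1) is not a zero divisor in the target, F itself is a
    relation.\<close>
  have "x ^ (k - 1) * F = b22 * linear_form (syz1 k) - b12 * linear_form (syz2 k)"
    unfolding F_def s1 s2 by (simp add: algebra_simps)
  then have "rees_eval (curve_C k) (x ^ (k - 1) * F) = 0"
    by (simp only: rees_eval.diff rees_eval.mult rees_eval_syz mult_zero_right diff_self)
  then have "[:var_x:] ^ (k - 1) * rees_eval (curve_C k) F = 0"
    unfolding rees_eval.mult rees_eval.power x_def rees_eval_gens .
  moreover have "[:var_x:] ^ (k - 1) \<noteq> 0" by (simp add: var_x_def)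
  ultimately have "rees_eval (curve_C k) F = 0" by (simp only: mult_eq_0_iff) simp
  moreover have "F \<notin> syz_ideal (syz1 k) (syz2 k)"
  proof
    assume "F \<in> syz_ideal (syz1 k) (syz2 k)"
    then obtain A B where AB: "F = A * linear_form (syz1 k) + B * linear_form (syz2 k)" unfolding syz_ideal_iff by blast
    let ?c = "\<lambda>c. [:c:] :: complex poly"
    let ?t = "[:0, 1:] :: complex poly"
    have c: "comm_ring_hom ?c" by (rule comm_ring_hom_const_poly)
    have e: "comm_ring_hom (\<lambda>s. eval3 ?c s (?t, 0, 1))" by (rule comm_ring_hom_eval3[OF c])
    \<comment> \<open>The specialization y = 0, z = 1, X = Y = 0, Z = 1 with x as free variable. F
      becomes a nonzero multiple of x, whereas both linear forms become multiples of x^(k-1), hence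
      of x^2.\<close>
    define h where "h = (\<lambda>F. spoly_eval (\<lambda>s. eval3 ?c s (?t, 0, 1)) F 0 0 1)"
    interpret h: comm_ring_hom h unfolding h_def by (rule comm_ring_hom_spoly_eval[OF e])
    have g: "h tX = 0" "h tY = 0" "h tZ = 1" "h x = ?t" "h y = 0" "h z = 1" "h kap = ?c (syz_kappa k)"
      unfolding h_def spoly_eval_vars[OF e] x_def y_def z_def kap_def eval3_vars[OF c] by simp_all
    have "h F = - ?t * ?c (syz_kappa k)"
      unfolding F_def b11_def b12_def b21_def b22_def h.simps g by simp
    moreover have "h (linear_form (syz1 k)) = - (?t ^ (k - 1) * ?t)" 
      unfolding s1 h.simps b11_def b12_def g by (simp only: mult_zero_left mult_zero_right mult_1_right
          diff_self add_0_right mult_minus_right)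
    moreover have "h (linear_form (syz2 k)) = ?t ^ (k - 1) * of_nat (2 * k * (k - 1))"
      using k3 unfolding s2 h.simps b21_def b22_def g by (simp only: mult_zero_left mult_zero_right mult_1_right
          diff_self add_0_right add_0_left power_0_left) simp
    ultimately have eq: "- ?t * ?c (syz_kappa k) = h A * - (?t ^ (k - 1) * ?t) + h B * (?t ^ (k - 1) * of_nat (2 * k * (k - 1)))"
      unfolding AB h.simps by (simp only:)
    have "?t ^ 2 dvd ?t ^ (k - 1)" using k3 by (intro le_imp_power_dvd) simp
    then have "?t ^ 2 dvd h A * - (?t ^ (k - 1) * ?t) + h B * (?t ^ (k - 1) * of_nat (2 * k * (k - 1)))"
      by (intro dvd_add dvd_mult dvd_mult2) (simp only: dvd_minus_iff, intro dvd_mult2)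
    then have "?t * ?t dvd ?t * ?c (syz_kappa k)"
      unfolding eq[symmetric] by (simp only: power2_eq_square mult_minus_left dvd_minus_iff)
    then have "?t dvd ?c (syz_kappa k)" by (simp only: dvd_mult_cancel_left) simp
    then have "poly (?c (syz_kappa k)) 0 = 0" using poly_eq_0_iff_dvd[of "?c (syz_kappa k)" 0] by simp
    then show False using syz_kappa_nonzero by simp
  qed
  ultimately show ?thesis by blast
qed

text \<open>f_x = x^(k-1) Q and f_z = 2 g y^k have no common factor: x does not divide f_z, and
  modulo Q the product 2k g y is (2k+1) x^(k+1), so only powers of x and y remain, neither of which
  divides Q.\<close>

lemma dx_dvd_cancel:
  assumes "dx (curve_C k) dvd c * dz (curve_C k)"
  shows "dx (curve_C k) dvd c"
proof -
  have x: "\<not> var_x dvd h" if "value3 h (0, 1, 1) \<noteq> 0" for h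
  proof
    assume "var_x dvd h"
    then obtain h' where "h = var_x * h'" ..
    then show False using that by (simp add: value3.simps value3_vars)
  qed
  have y: "\<not> var_y dvd h" if "value3 h (1, 0, 0) \<noteq> 0" for h
  proof
    assume "var_y dvd h"
    then obtain h' where "h = var_y * h'" ..
    then show False using that by (simp add: value3.simps value3_vars)
  qed
  have "value3 (2 * curve_g k * var_y ^ k) (0, 1, 1) \<noteq> 0"
    using k by (simp add: value3.simps value3_vars value3_curve_g power_0_left)
  then have xz: "\<not> var_x dvd 2 * curve_g k * var_y ^ k" by (rule x)
  have "value3 (curve_Q k) (0, 1, 1) \<noteq> 0"
    using k by (simp add: curve_Q_def value3.simps value3_vars value3_curve_g power_0_left)
  then have xQ: "\<not> var_x dvd curve_Q k" by (rule x)
  have "value3 (curve_Q k) (1, 0, 0) \<noteq> 0"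
  proof -
    have "value3 (curve_Q k) (1, 0, 0) = - of_nat (2 * k + 1)"
      unfolding curve_Q_def value3.simps value3_vars by simp
    then show ?thesis by (simp only: neg_equal_0_iff_equal of_nat_eq_0_iff)
  qed
  then have yQ: "\<not> var_y dvd curve_Q k" by (rule y)
  have "var_x ^ (k - 1) dvd c * (2 * curve_g k * var_y ^ k)"
    using assms unfolding dx_curve_C[OF k] dz_curve_C[OF k] by (rule dvd_mult_left)
  then have "var_x ^ (k - 1) dvd c \<or> var_x ^ 1 dvd 2 * curve_g k * var_y ^ k"
    by (rule prime_elem_power_dvd_cases) (simp_all add: prime_elem_var_x)
  then obtain c1 where c: "c = var_x ^ (k - 1) * c1" using xz by auto
  have "var_x ^ (k - 1) * curve_Q k dvd var_x ^ (k - 1) * (c1 * (2 * curve_g k * var_y ^ k))"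
    using assms unfolding dx_curve_C[OF k] dz_curve_C[OF k] c by (simp only: mult.assoc)
  then have Q: "curve_Q k dvd c1 * (2 * curve_g k * var_y ^ k)"
    unfolding dvd_mult_cancel_left using var_power_nonzero(1)[OF k] by blast
  have "const3 (of_nat (2 * k + 1)) * (c1 * var_y ^ k * var_x ^ (k + 1)) =
      of_nat k * var_y * (c1 * (2 * curve_g k * var_y ^ k)) - (c1 * var_y ^ k) * curve_Q k"
    unfolding of_nat_const3[symmetric] curve_Q_def by (simp add: algebra_simps)
  also have "curve_Q k dvd \<dots>" by (rule dvd_diff[OF dvd_mult[OF Q] dvd_triv_right])
  finally have "curve_Q k dvd const3 (inverse (of_nat (2 * k + 1))) * (const3 (of_nat (2 * k + 1)) * (c1 * var_y ^ k * var_x ^ (k + 1)))"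
    by (rule dvd_mult)
  then have "curve_Q k dvd c1 * var_y ^ k * var_x ^ (k + 1)"
    by (subst (asm) const3_inverse_mult) (simp_all flip: of_nat_Suc)
  from dvd_cancel_prime_power[OF prime_elem_var_y yQ dvd_cancel_prime_power[OF prime_elem_var_x xQ this]]
  have "curve_Q k dvd c1" .
  then show ?thesis unfolding dx_curve_C[OF k] c by (rule mult_dvd_mono[OF dvd_refl])
qed

lemma dx_dvd_power_cancel: "dx (curve_C k) dvd c * dz (curve_C k) ^ n \<Longrightarrow> dx (curve_C k) dvd c"
proof (induction n arbitrary: c)
  case (Suc n)
  have "dx (curve_C k) dvd (c * dz (curve_C k) ^ n) * dz (curve_C k)"
    using Suc.prems by (simp only: power_Suc mult_ac)
  from Suc.IH[OF dx_dvd_cancel[OF this]] show ?case .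
qed simp

end

text \<open>
  F is regarded as a polynomial over S in two variables, evaluated at b t and a t.
\<close>

lemma two_variable_relations:
  fixes a b :: "'a::idom" and F :: "'a poly poly"
  assumes ab: "a \<noteq> 0" "b \<noteq> 0" "\<And>c n. a dvd c * b ^ n \<Longrightarrow> a dvd c"
  defines "E1 \<equiv> (\<lambda>r. poly (map_poly (\<lambda>s. [:s:]) r) (Polynomial.monom b 1))"
  assumes "poly (map_poly E1 F) (Polynomial.monom a 1) = 0"
  shows "[:[:b:]:] * [:0, 1:] - [:[:0, a:]:] dvd F"
  using assms(5)
proof (induction "Polynomial.degree F" arbitrary: F rule: less_induct)
  case less
  have c: "comm_ring_hom (\<lambda>s :: 'a. [:s:])" by (rule comm_ring_hom_const_poly)
  have E1: "comm_ring_hom E1" unfolding E1_def by (rule comm_ring_hom.comm_ring_hom_poly[OF c])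
  interpret E1: comm_ring_hom E1 by (rule E1)
  define E where "E = (\<lambda>F. poly (map_poly E1 F) (Polynomial.monom a 1))"
  have E: "comm_ring_hom E" unfolding E_def by (rule comm_ring_hom.comm_ring_hom_poly[OF E1])
  interpret E: comm_ring_hom E by (rule E)
  have coeff_E1: "Polynomial.coeff (E1 r) n = Polynomial.coeff r n * b ^ n" for r n
  proof -
    have "E1 r = (\<Sum>i\<le>Polynomial.degree r. Polynomial.monom (Polynomial.coeff r i * b ^ i) i)"
      unfolding E1_def poly_hom_expand[OF c] by (simp add: monom_power smult_monom)
    then have "Polynomial.coeff (E1 r) n = (\<Sum>i\<le>Polynomial.degree r. if i = n then Polynomial.coeff r i * b ^ i else 0)"
      by (simp add: coeff_sum)
    then show ?thesis by (simp add: sum.delta coeff_eq_0)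
  qed
  obtain r F1 where F: "F = pCons r F1" by (rule pCons_cases)
  have E0: "E F = 0" using less.prems unfolding E_def .
  show ?case
  proof (cases "F1 = 0")
    case True
    then have "E1 r = 0" using E0 unfolding F E_def by (simp add: map_poly_pCons E1.zero)
    then have "Polynomial.coeff r n * b ^ n = 0" for n using coeff_E1[of r n] by simp
    then have "r = 0" using ab(2) by (simp add: poly_eq_iff)
    then show ?thesis unfolding F True by simp
  next
    case False
    have E_F: "E F = E1 r + Polynomial.monom a 1 * E F1"
      unfolding E_def F by (simp add: map_poly_pCons E1.zero)
    have co: "Polynomial.coeff r n * b ^ n + Polynomial.coeff (Polynomial.monom a 1 * E F1) n = 0" for n
      using arg_cong[OF E0, of "\<lambda>p. Polynomial.coeff p n"] unfolding E_F by (simp add: coeff_E1)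
    obtain r0 r1 where r: "r = pCons r0 r1" by (rule pCons_cases)
    have "r0 = 0" using co[of 0] unfolding r by (simp add: coeff_mult)
    \<comment> \<open>Comparing coefficients in degree n + 1: the part of F containing the outer
      variable contributes a multiple of a, and powers of b can be cancelled.\<close>
    have "a dvd Polynomial.coeff r1 n" for n
    proof -
      have "Polynomial.monom a 1 * E F1 = pCons 0 (Polynomial.smult a (E F1))"
        by (simp add: monom_Suc monom_0)
      then have "Polynomial.coeff r1 n * b ^ Suc n = a * - Polynomial.coeff (E F1) n"
        using co[of "Suc n"] unfolding r by (simp add: add_eq_0_iff2)
      then have "a dvd Polynomial.coeff r1 n * b ^ Suc n" by (simp only: dvd_triv_left)
      then show ?thesis by (rule ab(3))
    qed
    then have "[:a:] dvd r1" unfolding const_poly_dvd_iff by blast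
    then obtain r' where r': "r1 = [:a:] * r'" ..
    \<comment> \<open>Modulo the linear relation the term a r' times the inner variable becomes b r'
      times the outer one, so the outer variable factors out and the cofactor F2 has smaller
      degree.\<close>
    define F2 where "F2 = F1 + [:[:b:] * r':]"
    have F': "F = [:0, 1:] * F2 - ([:[:b:]:] * [:0, 1:] - [:[:0, a:]:]) * [:r':]"
    proof -
      have "[:[:0, a:]:] * [:r':] = [:r:]" unfolding r r' \<open>r0 = 0\<close> by simp
      moreover have "F = [:r:] + [:0, 1:] * F1" unfolding F by simp
      moreover have "[:[:b:]:] * [:r':] = [:[:b:] * r':]" by simp
      ultimately show ?thesis unfolding F2_def by (simp only: left_diff_distrib distrib_left mult_ac) simp
    qed
    have "E ([:[:b:]:] * [:0, 1:] - [:[:0, a:]:]) = 0"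
      unfolding E.diff E.mult by (simp add: E_def E1_def map_poly_pCons E1.simps mult_monom monom_Suc monom_0)
    then have "Polynomial.monom a 1 * E F2 = 0"
      using E0 unfolding F' E.diff E.mult by (simp add: E_def map_poly_pCons E1.zero E1.one)
    then have "E F2 = 0" using ab(1) by simp
    moreover have "Polynomial.degree F2 < Polynomial.degree F"
    proof -
      have "Polynomial.degree F2 \<le> Polynomial.degree F1"
        unfolding F2_def by (intro degree_add_le) simp_all
      then show ?thesis using False unfolding F by simp
    qed
    ultimately have "[:[:b:]:] * [:0, 1:] - [:[:0, a:]:] dvd F2"
      using less.hyps unfolding E_def by blast
    then show ?thesis unfolding F' by (intro dvd_diff dvd_mult dvd_triv_left)
  qed
qed

section \<open>The kernel of the map to the Rees algebra, before and after cancelling y\<close>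

context
  fixes k :: nat
  assumes k: "k \<ge> 2"
begin

lemma linear_form_syz1: "linear_form (syz1 k) = tconst (2 * var_y ^ k) * tY - tconst (curve_L k) * tZ"
  unfolding linear_form_def syz1_def fst_conv snd_conv tconst.zero tconst.uminus by (simp only: mult_zero_left add_0_left
      mult_minus_left diff_conv_add_uminus)

text \<open>The leading coefficient 2 y^k of R1 in the outermost variable is not a unit, so division
  with remainder costs a power of it. The remainder no longer contains that variable.\<close>

lemma pseudo_division:
  "\<exists>N A F'. tconst (2 * var_y ^ k) ^ N * F = A * linear_form (syz1 k) + [:F':]"
proof (induction F)
  case 0
  show ?case by (intro exI[of _ 0]) simp
next
  case (pCons a F)
  then obtain N A F' where IH: "tconst (2 * var_y ^ k) ^ N * F = A * linear_form (syz1 k) + [:F':]" by blast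
  let ?d = "tconst (2 * var_y ^ k)" and ?R = "linear_form (syz1 k)" and ?l = "tconst (curve_L k) * tZ"
  have R: "?d * tY = ?R + ?l" unfolding linear_form_syz1 by (simp only: diff_add_cancel)
  have "pCons a F = [:a:] + tY * F" by (simp add: tY_def)
  moreover have "(d * e) * (b + t * g) = (d * e) * b + (d * t) * (e * g)" for d e b t g :: spoly
    by (simp add: algebra_simps)
  ultimately have "?d ^ Suc N * pCons a F = ?d ^ Suc N * [:a:] + (?d * tY) * (?d ^ N * F)"
    by (simp only: power_Suc)
  also have "\<dots> = ((?R + ?l) * A + [:F':]) * ?R + (?d ^ Suc N * [:a:] + ?l * [:F':])"
  proof -
    have "e + (r + l) * (A * r + h) = ((r + l) * A + h) * r + (e + l * h)" for e r l h :: spoly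
      by (simp add: algebra_simps)
    then show ?thesis unfolding R IH .
  qed
  also have "?d ^ Suc N * [:a:] + ?l * [:F':] = [:[:[:2 * var_y ^ k:]:] ^ Suc N * a + [:[:curve_L k:]:] * [:[:0, 1:]:] * F':]"
  proof -
    interpret c: comm_ring_hom "\<lambda>q :: poly3 poly poly. [:q:]" by (rule comm_ring_hom_const_poly)
    show ?thesis unfolding c.simps tZ_def ..
  qed
  finally show ?case by blast
qed

text \<open>Since f_x and f_z have no common factor, relations between these two alone are multiples
  of the Koszul relation, and this one equals 2 y^k R2 - b R1.\<close>

lemma spoly_const_iff: "rees_eval (curve_C k) [:F:] = 0 \<Longrightarrow> [:F:] \<in> syz_ideal (syz1 k) (syz2 k)"
proof -
  assume "rees_eval (curve_C k) [:F:] = 0"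
  then have eval: "poly (map_poly (\<lambda>r. poly (map_poly (\<lambda>s. [:s:]) r) (Polynomial.monom (dz (curve_C k)) 1)) F)
      (Polynomial.monom (dx (curve_C k)) 1) = 0"
    by (simp add: rees_eval_def spoly_eval_def map_poly_pCons)
  have nonzero: "dx (curve_C k) \<noteq> 0" "dz (curve_C k) \<noteq> 0"
  proof -
    have "value3 (dz (curve_C k)) (0, 1, 1) \<noteq> 0"
      using k by (simp add: dz_curve_C value3.simps value3_vars value3_curve_g power_0_left)
    then show "dz (curve_C k) \<noteq> 0" by (auto simp: value3.zero)
    have "value3 (dx (curve_C k)) (1, 0, 0) = - of_nat (2 * k + 1)"
      unfolding dx_curve_C[OF k] curve_Q_def value3.simps value3_vars by simp
    then have "value3 (dx (curve_C k)) (1, 0, 0) \<noteq> 0"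
      by (simp only: neg_equal_0_iff_equal of_nat_eq_0_iff)
    then show "dx (curve_C k) \<noteq> 0" by (auto simp: value3.zero)
  qed
  have "[:[:dz (curve_C k):]:] * [:0, 1:] - [:[:0, dx (curve_C k):]:] dvd F"
    by (rule two_variable_relations[OF nonzero dx_dvd_power_cancel[OF k] eval])
  then obtain h where h: "F = ([:[:dz (curve_C k):]:] * [:0, 1:] - [:[:0, dx (curve_C k):]:]) * h" ..
  have "tconst (dz (curve_C k)) * tX - tconst (dx (curve_C k)) * tZ =
      tconst (2 * var_y ^ k) * linear_form (syz2 k) - tconst (syz_b k) * linear_form (syz1 k)"
  proof -
    have e: "dx (curve_C k) = - (syz_b k * curve_L k + 2 * syz_c k * var_y ^ k)"
      using syz2_eq[OF k] unfolding dx_curve_C[OF k] by (simp only: add_eq_0_iff2 add.assoc)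
    have gen: "(d * g) * p - (- (b * l + 2 * c * y)) * Z = (2 * y) * (g * p + b * Y + c * Z) - b * ((2 * y) * Y - l * Z)"
      if "d = 2 * y" for d g p b l c y Z Y :: spoly
      unfolding that by (simp add: algebra_simps)
    have z: "dz (curve_C k) = (2 * var_y ^ k) * curve_g k" unfolding dz_curve_C[OF k] by (simp only: mult_ac)
    have l2: "linear_form (syz2 k) = tconst (curve_g k) * tX + tconst (syz_b k) * tY + tconst (syz_c k) * tZ"
      unfolding linear_form_def syz2_def fst_conv snd_conv ..
    show ?thesis
      unfolding e z l2 linear_form_syz1 tconst.simps by (rule gen) (rule refl)
  qed
  moreover have "[:[:[:dz (curve_C k):]:] * [:0, 1:] - [:[:0, dx (curve_C k):]:]:] =
      tconst (dz (curve_C k)) * tX - tconst (dx (curve_C k)) * tZ"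
  proof -
    have "[:[:[:d:]:] * [:0, 1:] - [:[:0, e:]:]:] = tconst d * tX - tconst e * tZ" for d e
      by (simp add: tX_def tZ_def)
    then show ?thesis .
  qed
  moreover have "[:p * h:] = [:h:] * [:p:]" for p :: "poly3 poly poly"
    by (simp add: mult.commute)
  ultimately have "[:F:] = [:h:] * (tconst (2 * var_y ^ k) * linear_form (syz2 k) - tconst (syz_b k) * linear_form (syz1 k))"
    unfolding h by (simp only:)
  also have "\<dots> = ([:h:] * (- tconst (syz_b k))) * linear_form (syz1 k) + ([:h:] * tconst (2 * var_y ^ k)) * linear_form (syz2 k)"
  proof -
    have "g * (a * r - b * s) = (g * (- b)) * s + (g * a) * r" for g a b r s :: spoly
      by (simp add: algebra_simps)
    then show ?thesis .
  qed
  finally show ?thesis unfolding syz_ideal_iff by blast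
qed

lemma rees_kernel_power:
  assumes "rees_eval (curve_C k) F = 0"
  shows "\<exists>N. tconst (2 * var_y ^ k) ^ N * F \<in> syz_ideal (syz1 k) (syz2 k)"
proof -
  obtain N A F' where e: "tconst (2 * var_y ^ k) ^ N * F = A * linear_form (syz1 k) + [:F':]"
    using pseudo_division by blast
  then have "rees_eval (curve_C k) (A * linear_form (syz1 k) + [:F':]) = 0"
    using assms by (metis mult_zero_right rees_eval.mult)
  then have "rees_eval (curve_C k) [:F':] = 0"
    unfolding rees_eval.add rees_eval.mult rees_eval_syz[OF k] by simp
  then have F': "[:F':] \<in> syz_ideal (syz1 k) (syz2 k)" by (rule spoly_const_iff)
  have "A * linear_form (syz1 k) + [:F':] \<in> syz_ideal (syz1 k) (syz2 k)"
    by (rule syz_ideal_closed(2)[OF syz_ideal_closed(3)[OF syz_in_syz_ideal(1)] F'])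
  then show ?thesis unfolding e[symmetric] by blast
qed

text \<open>Reduction modulo y, realized as an endomorphism instead of a quotient map so that an
  element and its reduction can be subtracted.\<close>

definition set_y0 :: "poly3 \<Rightarrow> poly3" where
  "set_y0 = map_poly (\<lambda>q. [:poly q 0:])"

definition sset_y0 :: "spoly \<Rightarrow> spoly" where
  "sset_y0 = map_poly (map_poly (map_poly set_y0))"

lemma comm_ring_hom_set_y0: "comm_ring_hom set_y0"
  unfolding set_y0_def by (rule map_poly_comm_ring_hom) (unfold_locales, simp_all add: one_pCons)

lemma comm_ring_hom_sset_y0: "comm_ring_hom sset_y0"
  unfolding sset_y0_def by (intro map_poly_comm_ring_hom comm_ring_hom_set_y0)

interpretation set_y0: comm_ring_hom set_y0 by (rule comm_ring_hom_set_y0)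
interpretation sset_y0: comm_ring_hom sset_y0 by (rule comm_ring_hom_sset_y0)

lemma set_y0_vars: "set_y0 var_x = var_x" "set_y0 var_y = 0" "set_y0 var_z = var_z" "set_y0 (const3 c) = const3 c"
  by (simp_all add: set_y0_def var_x_def var_y_def var_z_def map_poly_pCons)

lemma sset_y0_vars: "sset_y0 tX = tX" "sset_y0 tY = tY" "sset_y0 tZ = tZ" "sset_y0 (tconst s) = tconst (set_y0 s)"
  by (simp_all add: sset_y0_def tX_def tY_def tZ_def map_poly_pCons set_y0.zero set_y0.one)

lemma sset_y0_dvd: "tconst var_y dvd F - sset_y0 F"
proof -
  have "[:0, 1:] dvd q - [:poly q 0:]" for q :: "complex poly poly"
    using poly_eq_0_iff_dvd[of "q - [:poly q 0:]" 0] by simp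
  then have "var_y dvd s - set_y0 s" for s
    unfolding var_y_def set_y0_def by (intro map_poly_dvd_diff) simp_all
  then show ?thesis
    unfolding sset_y0_def by (intro map_poly_dvd_diff) (simp_all add: set_y0.zero)
qed

text \<open>Modulo y the form R1 is -x^2 Z, and R2 is divisible neither by x nor by Z. A relation A
  R1 + B R2 = 0 modulo y is therefore a multiple of the Koszul relation, and lifting it lets y be
  divided out.\<close>

lemma y_regular:
  assumes k2: "k = 2" and G: "tconst var_y * G \<in> syz_ideal (syz1 k) (syz2 k)"
  shows "G \<in> syz_ideal (syz1 k) (syz2 k)"
proof -
  let ?y = "tconst var_y" and ?x = "tconst var_x" and ?R1 = "linear_form (syz1 k)" and ?R2 = "linear_form (syz2 k)"
  have k1: "k - 1 = 1" "k - 2 = 0" using k2 by simp_all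
  obtain A B where AB: "?y * G = A * ?R1 + B * ?R2" using G unfolding syz_ideal_iff by blast
  define \<rho> where "\<rho> = sset_y0 ?R2"
  have \<rho>: "\<rho> = tconst (set_y0 (curve_g k)) * tX + tconst (set_y0 (syz_b k)) * tY + tconst (set_y0 (syz_c k)) * tZ"
    unfolding \<rho>_def linear_form_def syz2_def fst_conv snd_conv sset_y0.add sset_y0.mult sset_y0_vars ..
  have s: "set_y0 (curve_g k) = var_x ^ 2" "set_y0 (curve_L k) = var_x ^ 2"
    "set_y0 (syz_c k) = of_nat (2 * k * (k - 1)) * var_x * var_z + const3 (syz_kappa k) * var_z ^ 2"
    unfolding curve_g_def curve_L_def syz_c_def k1 set_y0.simps set_y0_vars
    by (simp_all add: k2)
  have R1: "sset_y0 ?R1 = - (?x ^ 2 * tZ)"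
    unfolding linear_form_syz1 sset_y0.diff sset_y0.mult sset_y0_vars s set_y0.mult set_y0_vars set_y0.power tconst.power
    using k by (simp add: zero_power)
  have v: "comm_ring_hom (\<lambda>s. value3 s p)" for p by (rule value3.comm_ring_hom_axioms)
  \<comment> \<open>Here k = 2 is decisive: the term kappa y^(k-2) z^2 survives modulo y, while for
    larger k all coefficients of R2 become divisible by x.\<close>
  have "\<not> ?x dvd \<rho>"
  proof
    assume "?x dvd \<rho>"
    then obtain h where h: "\<rho> = ?x * h" ..
    interpret e: comm_ring_hom "\<lambda>F. spoly_eval (\<lambda>s. value3 s (0, 0, 1)) F 0 0 1"
      by (rule comm_ring_hom_spoly_eval[OF v])
    have "spoly_eval (\<lambda>s. value3 s (0, 0, 1)) \<rho> 0 0 1 = syz_kappa k"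
      unfolding \<rho> e.simps spoly_eval_vars[OF v] s value3.simps value3_vars by simp
    moreover have "spoly_eval (\<lambda>s. value3 s (0, 0, 1)) \<rho> 0 0 1 = 0"
      unfolding h e.mult spoly_eval_vars[OF v] value3_vars by simp
    ultimately show False using syz_kappa_nonzero[OF k] by simp
  qed
  have "\<not> tZ dvd \<rho>"
  proof
    assume "tZ dvd \<rho>"
    then obtain h where h: "\<rho> = tZ * h" ..
    interpret e: comm_ring_hom "\<lambda>F. spoly_eval (\<lambda>s. value3 s (1, 0, 0)) F 1 0 0"
      by (rule comm_ring_hom_spoly_eval[OF v])
    have "spoly_eval (\<lambda>s. value3 s (1, 0, 0)) \<rho> 1 0 0 = 1"
      unfolding \<rho> e.simps spoly_eval_vars[OF v] s value3.simps value3_vars by simp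
    moreover have "spoly_eval (\<lambda>s. value3 s (1, 0, 0)) \<rho> 1 0 0 = 0"
      unfolding h e.mult spoly_eval_vars[OF v] by simp
    ultimately show False by simp
  qed
  have px: "prime_elem ?x" by (intro lift_prime_elem_poly prime_elem_var_x)
  have pZ: "prime_elem tZ"
    unfolding tZ_def by (intro lift_prime_elem_poly prime_elem_linear_poly) simp_all
  have "0 = sset_y0 (?y * G)" unfolding sset_y0.mult sset_y0_vars set_y0_vars by simp
  also have "\<dots> = - (sset_y0 A * (?x ^ 2 * tZ)) + sset_y0 B * \<rho>"
    unfolding AB sset_y0.add sset_y0.mult R1 \<rho>_def[symmetric] by (simp only: mult_minus_right)
  finally have e: "sset_y0 B * \<rho> = ?x ^ 2 * (tZ * sset_y0 A)"
    by (metis (no_types, lifting) add.commute add.right_neutral add_diff_cancel_left' diff_add_cancel mult.assoc mult.commute uminus_add_conv_diff)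
  then have "?x ^ 2 dvd sset_y0 B * \<rho>" by (simp only: dvd_triv_left)
  then have "?x ^ 2 dvd sset_y0 B \<or> ?x ^ 1 dvd \<rho>"
    by (rule prime_elem_power_dvd_cases) (simp, rule px)
  then obtain B1 where B1: "sset_y0 B = ?x ^ 2 * B1" using \<open>\<not> ?x dvd \<rho>\<close> by (metis dvdE power_one_right)
  have x0: "?x ^ 2 \<noteq> 0" by (simp add: var_x_def)
  have "?x ^ 2 * (B1 * \<rho>) = ?x ^ 2 * (tZ * sset_y0 A)" using e unfolding B1 by (simp only: mult.assoc)
  then have e1: "B1 * \<rho> = tZ * sset_y0 A" using x0 by (metis mult_left_cancel)
  then have "tZ dvd B1 * \<rho>" by (simp only: dvd_triv_left)
  then have "tZ dvd B1" using pZ \<open>\<not> tZ dvd \<rho>\<close> prime_elem_dvd_multD by blast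
  then obtain C where C: "B1 = tZ * C" ..
  have "tZ \<noteq> 0" by (simp add: tZ_def)
  moreover have "tZ * (C * \<rho>) = tZ * sset_y0 A" using e1 unfolding C by (simp only: mult.assoc)
  ultimately have A0: "sset_y0 A = C * \<rho>" by (metis mult_left_cancel)
  obtain A' where A': "A = sset_y0 A + ?y * A'" using sset_y0_dvd[of A] by (metis add.commute diff_add_cancel dvdE)
  obtain B' where B': "B = sset_y0 B + ?y * B'" using sset_y0_dvd[of B] by (metis add.commute diff_add_cancel dvdE)
  obtain R1' where R1': "?R1 = sset_y0 ?R1 + ?y * R1'" using sset_y0_dvd[of ?R1] by (metis add.commute diff_add_cancel dvdE)
  obtain R2' where R2': "?R2 = sset_y0 ?R2 + ?y * R2'" using sset_y0_dvd[of ?R2] by (metis add.commute diff_add_cancel dvdE)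
  \<comment> \<open>The Koszul part of the cofactors cancels against the reductions of R1 and R2,
    and every remaining term carries a factor y.\<close>
  have gen: "(C * p + y * A') * r1 + (- (q * C) + y * B') * r2 = y * ((A' - C * R2') * r1 + (B' + C * R1') * r2)"
    if "r1 = q + y * R1'" "r2 = p + y * R2'" for p q r1 r2 y C A' R1' R2' B' :: spoly
    unfolding that by (simp add: algebra_simps)
  have "sset_y0 B = - (sset_y0 ?R1 * C)" unfolding B1 C R1 by (simp only: mult_minus_left minus_minus mult.assoc)
  then have "A * ?R1 + B * ?R2 = (C * \<rho> + ?y * A') * ?R1 + (- (sset_y0 ?R1 * C) + ?y * B') * ?R2"
    using A' B' A0 by simp
  also have "\<dots> = ?y * ((A' - C * R2') * ?R1 + (B' + C * R1') * ?R2)"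
    by (rule gen[OF R1' R2'[folded \<rho>_def]])
  finally have "?y * G = ?y * ((A' - C * R2') * ?R1 + (B' + C * R1') * ?R2)" unfolding AB .
  moreover have "?y \<noteq> 0" by (simp add: var_y_def)
  ultimately have "G = (A' - C * R2') * ?R1 + (B' + C * R1') * ?R2" by (metis mult_left_cancel)
  then show ?thesis unfolding syz_ideal_iff by blast
qed

lemma linear_type_2:
  assumes k2: "k = 2" and F: "rees_eval (curve_C k) F = 0"
  shows "F \<in> syz_ideal (syz1 k) (syz2 k)"
proof -
  have step: "G \<in> syz_ideal (syz1 k) (syz2 k)" if G: "tconst (2 * var_y ^ k) * G \<in> syz_ideal (syz1 k) (syz2 k)" for G
  proof -
    have "tconst (const3 (inverse 2)) * (tconst (2 * var_y ^ k) * G) \<in> syz_ideal (syz1 k) (syz2 k)" using syz_ideal_closed(3)[OF G] .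
    moreover have "tconst (const3 (inverse 2)) * (tconst (2 * var_y ^ k) * G) = tconst var_y * (tconst var_y * G)"
    proof -
      have "const3 (inverse 2) * (const3 2 * var_y ^ 2) = var_y ^ 2" by (rule const3_inverse_mult) simp
      then have e: "const3 (inverse 2) * (2 * var_y ^ k) = var_y * var_y"
        unfolding two_const3 k2 power2_eq_square .
      have t: "tconst a * (tconst b * G) = tconst (a * b) * G" for a b
        by (simp only: tconst.mult mult.assoc)
      show ?thesis unfolding t e ..
    qed
    ultimately show ?thesis using y_regular[OF k2] by simp
  qed
  have "tconst (2 * var_y ^ k) ^ N * G \<in> syz_ideal (syz1 k) (syz2 k) \<Longrightarrow> G \<in> syz_ideal (syz1 k) (syz2 k)" for N G
  proof (induction N)
    case (Suc N)
    then show ?case using step[of "tconst (2 * var_y ^ k) ^ N * G"] by (simp only: power_Suc mult.assoc)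
  qed simp
  then show ?thesis using rees_kernel_power[OF F] by blast
qed

lemma linear_type_curve_C: "linear_type (jacobian_ideal (curve_C k)) \<longleftrightarrow> k = 2"
proof -
  have iff: "linear_type (jacobian_ideal (curve_C k)) \<longleftrightarrow>
      (\<forall>F. rees_eval (curve_C k) F = 0 \<longrightarrow> F \<in> syz_ideal (syz1 k) (syz2 k))"
    by (rule linear_type_jacobian_iff[OF partials_distinct[OF k] syz_in_AR[OF k]]) (rule AR_generated[OF k])
  show ?thesis
  proof (cases "k = 2")
    case True
    show ?thesis unfolding iff using True linear_type_2[OF True] by simp
  next
    case False
    then have "k \<ge> 3" using k by simp
    from not_linear_type[OF k this] show ?thesis unfolding iff using False by blast
  qed
qed

end

theorem theorem4p6:
  fixes k :: nat
  assumes "k \<ge> 2"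
  shows "rational_cuspidal (curve_C k) \<and>
    cuspidal_type (curve_C k) (2 * k + 1) (2 * k - 1) \<and>
    (\<exists>p q. p \<noteq> q \<and> singular_points (curve_C k) = {p, q} \<and>
       cusp_of_type (curve_C k) p (2 * k + 1) (2 * k - 1) \<and>
       cusp_of_type (curve_C k) q (2 * k + 1) 2) \<and>
    free_divisor (curve_C k) \<and>
    (linear_type (jacobian_ideal (curve_C k)) \<longleftrightarrow> k = 2) \<and>
    total_tjurina (curve_C k) = 3 * k ^ 2 \<and>
    total_milnor (curve_C k) = 2 * k * (2 * k - 1) \<and>
    (\<forall>d1 d2. free_with_exponents (curve_C k) d1 d2 \<longleftrightarrow> d1 = k \<and> d2 = k)"
proof -
  have sing: "singular_points (curve_C k) = {(0, 0, 1), (0, 1, 0)}"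
    by (rule singular_points_curve_C[OF assms])
  have cusps: "is_cusp (curve_C k) (0, 0, 1)" "is_cusp (curve_C k) (0, 1, 0)"
    by (rule is_cusp_p[OF assms], rule is_cusp_q[OF assms])
  have rc: "rational_cuspidal (curve_C k)"
    unfolding rational_cuspidal_def sing
    using irreducible_curve_C[OF assms] rational_curve_C[OF assms] cusps by blast
  have p: "cusp_of_type (curve_C k) (0, 0, 1) (2 * k + 1) (2 * k - 1)"
    unfolding cusp_of_type_def using cusps(1) coprime_2k[OF assms] top_type_p[OF assms] by blast
  have q: "cusp_of_type (curve_C k) (0, 1, 0) (2 * k + 1) 2"
  proof -
    have "coprime (2 * k + 1) 2" by (simp add: coprime_commute)
    then show ?thesis
      unfolding cusp_of_type_def using cusps(2) top_type_q[OF assms] by blast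
  qed
  have pq: "(0, 0, 1) \<noteq> ((0, 1, 0) :: point)" by simp
  have free: "free_with_exponents (curve_C k) k k"
    by (rule free_with_exponents_curve_C[OF assms])
  then have fd: "free_divisor (curve_C k)" unfolding free_divisor_def by blast
  have exps: "free_with_exponents (curve_C k) d1 d2 \<longleftrightarrow> d1 = k \<and> d2 = k" for d1 d2
    using free free_exponents_unique[OF assms, of d1 d2] by blast
  show ?thesis
    by (intro conjI allI exI) (rule rc cuspidal_type_curve_C[OF assms] pq sing p q fd
      linear_type_curve_C[OF assms] total_tjurina_curve_C[OF assms] total_milnor_curve_C[OF assms] exps)+
qed

end
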